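(* Let $\Phi:\mathcal B^{op}\to CAT$ and $\Psi:\mathcal N^{op}\to CAT$ be homotopically structured and let $(U,u):\Phi\to\Psi$ be a forgetful morphism. (1) If $\int\Phi$ admits the global model structure and it is left proper, then each $\phi^*$ (for $\phi:O\to O'$ in $\mathcal B$) has a Quillen left adjoint $\phi_!$. For a horizontal weak equivalence $\phi$, the unit of the adjunction $\phi_!\dashv\phi^*$ is a weak equivalence. Moreover, if $\phi^*$ reflects weak equivalences and the unique morphism $\tau:i_O\to\phi^*(i_{O'})$ is a weak equivalence, then $\phi_!\dashv\phi^*$ is a Quillen equivalence. (2) Suppose that $\int\Phi$ admits a global model structure, or a global semi-model structure over $\int\Psi$, transferred along $(U,u)$, that is cofibrantly generated and relatively left proper. Assume that $\Phi(O)$ and $\Phi(O')$ admit vertical model structures, or semi-model structures over $\Psi(U(O))$ and $\Psi(U(O'))$ respectively, and that $O$ and $O'$ are relatively cofibrant. Then any $\phi:O\to O'$ induces a Quillen pair $\phi_!\dashv\phi^*$. Furthermore, if $\phi$ is a horizontal weak equivalence and $\phi^*$ reflects weak equivalences, then $\phi_!\dashv\phi^*$ is a Quillen equivalence of semi-model categories. (3) The conclusion of (2) (any $\phi:O\to O'$ induces a Quillen pair $\phi_!\dashv\phi^*$, which is a Quillen equivalence of semi-model categories if $\phi$ is a horizontal weak equivalence and $\phi^*$ reflects weak equivalences) remains valid if $\int\Phi$ admits a cofibrantly generated global semi-model structure and $O$ and $O'$ are cofibrant, i.e. $(O,i_O)$ and $(O',i_{O'})$ are cofibrant in $\int\Ph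i$.
   Context: Let $CAT$ be the category of (large) categories. For $\Phi:\mathcal B^{op}\to CAT$ and $\phi:O\to O'$ in $\mathcal B$ write $\phi^*=\Phi(\phi):\Phi(O')\to\Phi(O)$. The Grothendieck construction $\int\Phi$ has objects pairs $(O,A)$, $O\in\mathcal B$, $A\in\Phi(O)$; a morphism $(O,A)\to(O',A')$ is a pair $(\phi,f)$ with $\phi:O\to O'$ and $f:A\to\phi^*(A')$. Standing assumption: $\int\Phi$ is cocomplete; $i_O$ denotes the initial object of $\Phi(O)$. $\Phi$ is homotopically structured if $\mathcal B$ is equipped with classes of horizontal weak equivalences and fibrations and each $\Phi(O)$ with classes of vertical weak equivalences and fibrations. $(\phi,f)$ is a global weak equivalence (resp. fibration) if $\phi$ is a horizontal and $f$ a vertical one. In each setting trivial fibrations are fibrations that are weak equivalences, cofibrations are morphisms with the left lifting property against trivial fibrations; a global/vertical/horizontal (semi-)model structure is one with these classes. "Left proper": pushouts of weak equivalences along cofibrations are weak equivalences. A forgetful morphism $(U,u):\Phi\to\Psi$ is a functor $U:\mathcal B\to\mathcal N$ with a 2-natural transformation $u:\Phi\to\Psi\circ U$; it induces $\int\Phi\to\int\Psi$, $(O,A)\mapsto(U(O),u_O(A))$. The structure on $\Phi$ is transferred along $(U,u)$ if $f$ in $\mathcal B$ is a horizontal weak equivalence (fibration) iff $U(f)$ is, and a morphism $g$ of $\Phi(O)$ is a vertical weak equivalence (fibration) iff $u_O(g)$ is. An object $O\in\mathcal B$ is relatively cofibrant ($u$-cofibrant) if $U(O)$ is cofibrant in $\mathcal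 N$. $\int\Phi$ is relatively left proper (over $\int\Psi$) if for every weak equivalence $R\to S$ and cofibration $R\to R'$ in $\int\Phi$ such that $R$ and $S$ have cofibrant images in $\int\Psi$, the map $R'\to R'\cup_RS$ is a weak equivalence. Semi-model structure: fibrations closed under pullback; weak equivalences satisfy two out of three; all classes contain isomorphisms, are closed under composition and retracts; cofibrations lift against trivial fibrations; trivial cofibrations with cofibrant domain lift against fibrations; every morphism factors functorially as cofibration then trivial fibration; every morphism with cofibrant domain factors functorially as trivial cofibration then fibration. Given an adjunction $F:\mathcal M\rightleftarrows\mathcal D:V$ with $\mathcal M$ a cofibrantly generated model category, $\mathcal D$ bicomplete and $V$ preserving colimits over non-empty ordinals, $\mathcal D$ is a semi-model category over $\mathcal M$ if the same axioms hold with "cofibrant domain" replaced by "domain $X$ with $V(X)$ cofibrant in $\mathcal M$". Cofibrantly generated means there are sets $I,J$ such that trivial fibrations (resp. fibrations) are the morphisms with the right lifting property against $I$ (resp. $J$), domains of $I$ are small relative to $I$-cell, domains of $J$ are small relative to morphisms of $J$-cell with cofibrant domain. A Quillen pair is an adjunction whose right adjoint preserves fibrations and trivial fibrations; it is a Quillen equivalence if it induces an equivalence of homotopy categories.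
   Formalization: In (1) the unit is a weak equivalence only at cofibrant objects and if τ is a weak equivalence; the "Furthermore" of (2) also assumes τ is a weak equivalence and (O,i_O), (O',i_O') have cofibrant images in ∫Ψ. Without these the claims fail. *)

theory Defs
  imports Main "HOL-Library.Equipollence"
begin

section \<open>Categories\<close>

text \<open>Categories have explicit carriers inside the types of objects and of arrows; all the
  conditions below are relativised to these carriers. \<open>Comp C g f\<close> is the composite of \<open>f\<close>
  followed by \<open>g\<close>.\<close>

record ('o, 'm) cat =
  Obj :: "'o set"
  Arr :: "'m set"
  Dom :: "'m \<Rightarrow> 'o"
  Cod :: "'m \<Rightarrow> 'o"
  Id :: "'o \<Rightarrow> 'm"
  Comp :: "'m \<Rightarrow> 'm \<Rightarrow> 'm"

definition hom :: "('o, 'm) cat \<Rightarrow> 'o \<Rightarrow> 'o \<Rightarrow> 'm set" where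
  "hom C a b = {f \<in> Arr C. Dom C f = a \<and> Cod C f = b}"

definition category :: "('o, 'm) cat \<Rightarrow> bool" where
  "category C \<longleftrightarrow>
     (\<forall>f\<in>Arr C. Dom C f \<in> Obj C \<and> Cod C f \<in> Obj C) \<and>
     (\<forall>a\<in>Obj C. Id C a \<in> hom C a a) \<and>
     (\<forall>f\<in>Arr C. \<forall>g\<in>Arr C. Cod C f = Dom C g \<longrightarrow> Comp C g f \<in> hom C (Dom C f) (Cod C g)) \<and>
     (\<forall>f\<in>Arr C. Comp C f (Id C (Dom C f)) = f \<and> Comp C (Id C (Cod C f)) f = f) \<and>
     (\<forall>f\<in>Arr C. \<forall>g\<in>Arr C. \<forall>h\<in>Arr C. Cod C f = Dom C g \<and> Cod C g = Dom C h \<longrightarrow>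
        Comp C h (Comp C g f) = Comp C (Comp C h g) f)"

definition inverse_arrows :: "('o, 'm) cat \<Rightarrow> 'm \<Rightarrow> 'm \<Rightarrow> bool" where
  "inverse_arrows C f g \<longleftrightarrow>
     f \<in> Arr C \<and> g \<in> hom C (Cod C f) (Dom C f) \<and>
     Comp C g f = Id C (Dom C f) \<and> Comp C f g = Id C (Cod C f)"

definition iso_arrow :: "('o, 'm) cat \<Rightarrow> 'm \<Rightarrow> bool" where
  "iso_arrow C f \<longleftrightarrow> (\<exists>g. inverse_arrows C f g)"

definition initial_object :: "('o, 'm) cat \<Rightarrow> 'o \<Rightarrow> bool" where
  "initial_object C z \<longleftrightarrow> z \<in> Obj C \<and> (\<forall>a\<in>Obj C. \<exists>!f. f \<in> hom C z a)"

record ('o, 'm, 'p, 'n) fnctr =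
  fobj :: "'o \<Rightarrow> 'p"
  farr :: "'m \<Rightarrow> 'n"

definition is_functor :: "('o, 'm) cat \<Rightarrow> ('p, 'n) cat \<Rightarrow> ('o, 'm, 'p, 'n) fnctr \<Rightarrow> bool" where
  "is_functor C D T \<longleftrightarrow>
     (\<forall>a\<in>Obj C. fobj T a \<in> Obj D) \<and>
     (\<forall>f\<in>Arr C. farr T f \<in> hom D (fobj T (Dom C f)) (fobj T (Cod C f))) \<and>
     (\<forall>a\<in>Obj C. farr T (Id C a) = Id D (fobj T a)) \<and>
     (\<forall>f\<in>Arr C. \<forall>g\<in>Arr C. Cod C f = Dom C g \<longrightarrow>
        farr T (Comp C g f) = Comp D (farr T g) (farr T f))"

definition id_functor :: "('o, 'm, 'o, 'm) fnctr" where
  "id_functor = \<lparr>fobj = (\<lambda>a. a), farr = (\<lambda>f. f)\<rparr>"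

definition comp_functor ::
  "('p, 'n, 'q, 'l) fnctr \<Rightarrow> ('o, 'm, 'p, 'n) fnctr \<Rightarrow> ('o, 'm, 'q, 'l) fnctr" where
  "comp_functor S T = \<lparr>fobj = fobj S \<circ> fobj T, farr = farr S \<circ> farr T\<rparr>"

definition nat_trans ::
  "('o, 'm) cat \<Rightarrow> ('p, 'n) cat \<Rightarrow> ('o, 'm, 'p, 'n) fnctr \<Rightarrow> ('o, 'm, 'p, 'n) fnctr \<Rightarrow>
   ('o \<Rightarrow> 'n) \<Rightarrow> bool" where
  "nat_trans C D S T \<theta> \<longleftrightarrow>
     (\<forall>a\<in>Obj C. \<theta> a \<in> hom D (fobj S a) (fobj T a)) \<and>
     (\<forall>f\<in>Arr C. Comp D (\<theta> (Cod C f)) (farr S f) = Comp D (farr T f) (\<theta> (Dom C f)))"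

definition naturally_isomorphic ::
  "('o, 'm) cat \<Rightarrow> ('p, 'n) cat \<Rightarrow> ('o, 'm, 'p, 'n) fnctr \<Rightarrow> ('o, 'm, 'p, 'n) fnctr \<Rightarrow> bool" where
  "naturally_isomorphic C D S T \<longleftrightarrow>
     (\<exists>\<theta>. nat_trans C D S T \<theta> \<and> (\<forall>a\<in>Obj C. iso_arrow D (\<theta> a)))"

text \<open>\<open>L : C \<rightarrow> D\<close> is left adjoint to \<open>R : D \<rightarrow> C\<close> with unit \<open>\<eta>\<close>.\<close>

definition adjunction ::
  "('o, 'm) cat \<Rightarrow> ('p, 'n) cat \<Rightarrow> ('o, 'm, 'p, 'n) fnctr \<Rightarrow> ('p, 'n, 'o, 'm) fnctr \<Rightarrow>
   ('o \<Rightarrow> 'm) \<Rightarrow> bool" where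
  "adjunction C D L R \<eta> \<longleftrightarrow>
     is_functor C D L \<and> is_functor D C R \<and>
     nat_trans C C id_functor (comp_functor R L) \<eta> \<and>
     (\<forall>a\<in>Obj C. \<forall>b\<in>Obj D. \<forall>f\<in>hom C a (fobj R b).
        \<exists>!g. g \<in> hom D (fobj L a) b \<and> Comp C (farr R g) (\<eta> a) = f)"

section \<open>Limits and colimits\<close>

text \<open>The notion of a small set is a parameter: a set is small if its cardinality is smaller than
  that of the type \<open>'u\<close>. A Grothendieck universe corresponds to \<open>'u\<close> of inaccessible
  cardinality. Up to isomorphism, every small category has its objects and arrows in \<open>'u\<close>.\<close>

definition small :: "'u itself \<Rightarrow> 'a set \<Rightarrow> bool" where
  "small _ A \<longleftrightarrow> A \<prec> (UNIV :: 'u set)"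

definition is_cocone ::
  "('j, 'k) cat \<Rightarrow> ('o, 'm) cat \<Rightarrow> ('j, 'k, 'o, 'm) fnctr \<Rightarrow> 'o \<Rightarrow> ('j \<Rightarrow> 'm) \<Rightarrow> bool" where
  "is_cocone J C D c l \<longleftrightarrow>
     c \<in> Obj C \<and> (\<forall>j\<in>Obj J. l j \<in> hom C (fobj D j) c) \<and>
     (\<forall>k\<in>Arr J. Comp C (l (Cod J k)) (farr D k) = l (Dom J k))"

definition is_colimit ::
  "('j, 'k) cat \<Rightarrow> ('o, 'm) cat \<Rightarrow> ('j, 'k, 'o, 'm) fnctr \<Rightarrow> 'o \<Rightarrow> ('j \<Rightarrow> 'm) \<Rightarrow> bool" where
  "is_colimit J C D c l \<longleftrightarrow>
     is_cocone J C D c l \<and>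
     (\<forall>d k. is_cocone J C D d k \<longrightarrow>
        (\<exists>!h. h \<in> hom C c d \<and> (\<forall>j\<in>Obj J. Comp C h (l j) = k j)))"

definition is_cone ::
  "('j, 'k) cat \<Rightarrow> ('o, 'm) cat \<Rightarrow> ('j, 'k, 'o, 'm) fnctr \<Rightarrow> 'o \<Rightarrow> ('j \<Rightarrow> 'm) \<Rightarrow> bool" where
  "is_cone J C D c l \<longleftrightarrow>
     c \<in> Obj C \<and> (\<forall>j\<in>Obj J. l j \<in> hom C c (fobj D j)) \<and>
     (\<forall>k\<in>Arr J. Comp C (farr D k) (l (Dom J k)) = l (Cod J k))"

definition is_limit ::
  "('j, 'k) cat \<Rightarrow> ('o, 'm) cat \<Rightarrow> ('j, 'k, 'o, 'm) fnctr \<Rightarrow> 'o \<Rightarrow> ('j \<Rightarrow> 'm) \<Rightarrow> bool" where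
  "is_limit J C D c l \<longleftrightarrow>
     is_cone J C D c l \<and>
     (\<forall>d k. is_cone J C D d k \<longrightarrow>
        (\<exists>!h. h \<in> hom C d c \<and> (\<forall>j\<in>Obj J. Comp C (l j) h = k j)))"

definition cocomplete :: "'u itself \<Rightarrow> ('o, 'm) cat \<Rightarrow> bool" where
  "cocomplete u C \<longleftrightarrow>
     (\<forall>(J :: ('u, 'u) cat) D. category J \<and> small u (Arr J) \<and> is_functor J C D \<longrightarrow>
        (\<exists>c l. is_colimit J C D c l))"

definition complete :: "'u itself \<Rightarrow> ('o, 'm) cat \<Rightarrow> bool" where
  "complete u C \<longleftrightarrow>
     (\<forall>(J :: ('u, 'u) cat) D. category J \<and> small u (Arr J) \<and> is_functor J C D \<longrightarrow>
        (\<exists>c l. is_limit J C D c l))"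

text \<open>The square \<open>p \<circ> f = q \<circ> g\<close> is a pushout; \<open>q\<close> is the pushout of \<open>f\<close> along \<open>g\<close>.\<close>

definition is_pushout :: "('o, 'm) cat \<Rightarrow> 'm \<Rightarrow> 'm \<Rightarrow> 'm \<Rightarrow> 'm \<Rightarrow> bool" where
  "is_pushout C f g p q \<longleftrightarrow>
     f \<in> Arr C \<and> g \<in> Arr C \<and> p \<in> Arr C \<and> q \<in> Arr C \<and>
     Dom C f = Dom C g \<and> Dom C p = Cod C f \<and> Dom C q = Cod C g \<and> Cod C p = Cod C q \<and>
     Comp C p f = Comp C q g \<and>
     (\<forall>x. \<forall>a\<in>hom C (Cod C f) x. \<forall>b\<in>hom C (Cod C g) x. Comp C a f = Comp C b g \<longrightarrow>
        (\<exists>!h. h \<in> hom C (Cod C p) x \<and> Comp C h p = a \<and> Comp C h q = b))"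

text \<open>The square \<open>f \<circ> p = g \<circ> q\<close> is a pullback; \<open>q\<close> is the pullback of \<open>f\<close> along \<open>g\<close>.\<close>

definition is_pullback :: "('o, 'm) cat \<Rightarrow> 'm \<Rightarrow> 'm \<Rightarrow> 'm \<Rightarrow> 'm \<Rightarrow> bool" where
  "is_pullback C f g p q \<longleftrightarrow>
     f \<in> Arr C \<and> g \<in> Arr C \<and> p \<in> Arr C \<and> q \<in> Arr C \<and>
     Cod C f = Cod C g \<and> Cod C p = Dom C f \<and> Cod C q = Dom C g \<and> Dom C p = Dom C q \<and>
     Comp C f p = Comp C g q \<and>
     (\<forall>x. \<forall>a\<in>hom C x (Dom C f). \<forall>b\<in>hom C x (Dom C g). Comp C f a = Comp C g b \<longrightarrow>
        (\<exists>!h. h \<in> hom C x (Dom C p) \<and> Comp C p h = a \<and> Comp C q h = b))"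

section \<open>Transfinite composition and smallness of objects\<close>

text \<open>Small ordinals are represented by well-orders \<open>r :: 'u rel\<close> with small field, regarded as
  categories.\<close>

definition ordinal :: "'u rel \<Rightarrow> bool" where
  "ordinal r \<longleftrightarrow> Well_order r \<and> small TYPE('u) (Field r)"

definition poset_cat :: "'u rel \<Rightarrow> ('u, 'u \<times> 'u) cat" where
  "poset_cat r =
     \<lparr>Obj = Field r, Arr = r, Dom = fst, Cod = snd, Id = (\<lambda>a. (a, a)),
      Comp = (\<lambda>g f. (fst f, snd g))\<rparr>"

definition succ_in :: "'u rel \<Rightarrow> 'u \<Rightarrow> 'u \<Rightarrow> bool" where
  "succ_in r b c \<longleftrightarrow> b \<in> underS r c \<and> (\<forall>d\<in>underS r c. (d, b) \<in> r)"

definition limit_in :: "'u rel \<Rightarrow> 'u \<Rightarrow> bool" where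
  "limit_in r c \<longleftrightarrow> c \<in> Field r \<and> underS r c \<noteq> {} \<and> (\<nexists>b. succ_in r b c)"

definition transfinite_sequence ::
  "('o, 'm) cat \<Rightarrow> 'u rel \<Rightarrow> ('u, 'u \<times> 'u, 'o, 'm) fnctr \<Rightarrow> 'm set \<Rightarrow> bool" where
  "transfinite_sequence C r D K \<longleftrightarrow>
     is_functor (poset_cat r) C D \<and>
     (\<forall>c. limit_in r c \<longrightarrow>
        is_colimit (poset_cat (Restr r (underS r c))) C D (fobj D c) (\<lambda>b. farr D (b, c))) \<and>
     (\<forall>b c. succ_in r b c \<longrightarrow> farr D (b, c) \<in> K)"

definition relative_cell :: "'u itself \<Rightarrow> ('o, 'm) cat \<Rightarrow> 'm set \<Rightarrow> 'm set" where
  "relative_cell _ C I =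
     {h. \<exists>(r :: 'u rel) D c l z.
        ordinal r \<and> z \<in> Field r \<and> (\<forall>b\<in>Field r. (z, b) \<in> r) \<and>
        transfinite_sequence C r D {q. \<exists>i\<in>I. \<exists>g p. is_pushout C i g p q} \<and>
        is_colimit (poset_cat r) C D c l \<and> h = l z}"

definition filtered_ordinal :: "'u set \<Rightarrow> 'u rel \<Rightarrow> bool" where
  "filtered_ordinal \<kappa> r \<longleftrightarrow>
     ordinal r \<and> Field r \<noteq> {} \<and> (\<forall>a\<in>Field r. \<exists>b\<in>Field r. a \<in> underS r b) \<and>
     (\<forall>S\<subseteq>Field r. S \<lesssim> \<kappa> \<longrightarrow> (\<exists>b\<in>Field r. \<forall>s\<in>S. (s, b) \<in> r))"

text \<open>The last two conditions say that the map from the colimit of the sets \<open>hom C a (fobj D b)\<close>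
  to \<open>hom C a c\<close> is surjective and injective.\<close>

definition small_relative_to :: "'u itself \<Rightarrow> ('o, 'm) cat \<Rightarrow> 'o \<Rightarrow> 'm set \<Rightarrow> bool" where
  "small_relative_to u C a K \<longleftrightarrow>
     (\<exists>\<kappa> :: 'u set. small u \<kappa> \<and>
        (\<forall>r D c l. filtered_ordinal \<kappa> r \<and> transfinite_sequence C r D K \<and>
             is_colimit (poset_cat r) C D c l \<longrightarrow>
           (\<forall>h\<in>hom C a c. \<exists>b\<in>Field r. \<exists>g\<in>hom C a (fobj D b). Comp C (l b) g = h) \<and>
           (\<forall>b\<in>Field r. \<forall>g\<in>hom C a (fobj D b). \<forall>g'\<in>hom C a (fobj D b).
              Comp C (l b) g = Comp C (l b) g' \<longrightarrow>
              (\<exists>d. (b, d) \<in> r \<and> Comp C (farr D (b, d)) g = Comp C (farr D (b, d)) g'))))"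

definition preserves_ordinal_colimits ::
  "'u itself \<Rightarrow> ('o, 'm) cat \<Rightarrow> ('p, 'n) cat \<Rightarrow> ('o, 'm, 'p, 'n) fnctr \<Rightarrow> bool" where
  "preserves_ordinal_colimits _ C D V \<longleftrightarrow>
     (\<forall>(r :: 'u rel) X c l. ordinal r \<and> Field r \<noteq> {} \<and> is_functor (poset_cat r) C X \<and>
          is_colimit (poset_cat r) C X c l \<longrightarrow>
        is_colimit (poset_cat r) D (comp_functor V X) (fobj V c) (\<lambda>b. farr V (l b)))"

section \<open>Homotopical structures, model structures and semi-model structures\<close>

record 'm hstruct =
  weqs :: "'m set"
  fibs :: "'m set"

definition homotopically_structured :: "('o, 'm) cat \<Rightarrow> 'm hstruct \<Rightarrow> bool" where
  "homotopically_structured C S \<longleftrightarrow> weqs S \<subseteq> Arr C \<and> fibs S \<subseteq> Arr C"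

definition lifts :: "('o, 'm) cat \<Rightarrow> 'm \<Rightarrow> 'm \<Rightarrow> bool" where
  "lifts C i p \<longleftrightarrow>
     (\<forall>a\<in>hom C (Dom C i) (Dom C p). \<forall>b\<in>hom C (Cod C i) (Cod C p).
        Comp C p a = Comp C b i \<longrightarrow>
        (\<exists>h\<in>hom C (Cod C i) (Dom C p). Comp C h i = a \<and> Comp C p h = b))"

definition tfibs :: "'m hstruct \<Rightarrow> 'm set" where
  "tfibs S = fibs S \<inter> weqs S"

definition cofs :: "('o, 'm) cat \<Rightarrow> 'm hstruct \<Rightarrow> 'm set" where
  "cofs C S = {i \<in> Arr C. \<forall>p\<in>tfibs S. lifts C i p}"

definition tcofs :: "('o, 'm) cat \<Rightarrow> 'm hstruct \<Rightarrow> 'm set" where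
  "tcofs C S = cofs C S \<inter> weqs S"

definition cofibrant :: "('o, 'm) cat \<Rightarrow> 'm hstruct \<Rightarrow> 'o \<Rightarrow> bool" where
  "cofibrant C S a \<longleftrightarrow> (\<exists>z i. initial_object C z \<and> i \<in> hom C z a \<and> i \<in> cofs C S)"

definition retract_of :: "('o, 'm) cat \<Rightarrow> 'm \<Rightarrow> 'm \<Rightarrow> bool" where
  "retract_of C f g \<longleftrightarrow>
     f \<in> Arr C \<and> g \<in> Arr C \<and>
     (\<exists>s\<in>hom C (Dom C f) (Dom C g). \<exists>t\<in>hom C (Cod C f) (Cod C g).
      \<exists>s'\<in>hom C (Dom C g) (Dom C f). \<exists>t'\<in>hom C (Cod C g) (Cod C f).
        Comp C g s = Comp C t f \<and> Comp C f s' = Comp C t' g \<and>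
        Comp C s' s = Id C (Dom C f) \<and> Comp C t' t = Id C (Cod C f))"

definition contains_isos :: "('o, 'm) cat \<Rightarrow> 'm set \<Rightarrow> bool" where
  "contains_isos C K \<longleftrightarrow> (\<forall>f. iso_arrow C f \<longrightarrow> f \<in> K)"

definition closed_under_comp :: "('o, 'm) cat \<Rightarrow> 'm set \<Rightarrow> bool" where
  "closed_under_comp C K \<longleftrightarrow> (\<forall>f\<in>K. \<forall>g\<in>K. Cod C f = Dom C g \<longrightarrow> Comp C g f \<in> K)"

definition closed_under_retracts :: "('o, 'm) cat \<Rightarrow> 'm set \<Rightarrow> bool" where
  "closed_under_retracts C K \<longleftrightarrow> (\<forall>f g. g \<in> K \<and> retract_of C f g \<longrightarrow> f \<in> K)"

definition closed_under_pullback :: "('o, 'm) cat \<Rightarrow> 'm set \<Rightarrow> bool" where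
  "closed_under_pullback C K \<longleftrightarrow> (\<forall>f g p q. f \<in> K \<and> is_pullback C f g p q \<longrightarrow> q \<in> K)"

definition two_out_of_three :: "('o, 'm) cat \<Rightarrow> 'm set \<Rightarrow> bool" where
  "two_out_of_three C K \<longleftrightarrow>
     (\<forall>f\<in>Arr C. \<forall>g\<in>Arr C. Cod C f = Dom C g \<longrightarrow>
        (f \<in> K \<and> g \<in> K \<longrightarrow> Comp C g f \<in> K) \<and>
        (f \<in> K \<and> Comp C g f \<in> K \<longrightarrow> g \<in> K) \<and>
        (g \<in> K \<and> Comp C g f \<in> K \<longrightarrow> f \<in> K))"

text \<open>Every arrow \<open>f\<close> in \<open>P\<close> factors as \<open>\<beta> f \<circ> \<alpha> f\<close> with \<open>\<alpha> f \<in> L\<close> and \<open>\<beta> f \<in> R\<close>, functorially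
  on the full subcategory of the arrow category on \<open>P\<close>: a commutative square \<open>(s, t)\<close> from \<open>f\<close>
  to \<open>g\<close> induces \<open>m f g s t\<close> between the middle objects \<open>E f\<close> and \<open>E g\<close>.\<close>

definition functorial_factorization ::
  "('o, 'm) cat \<Rightarrow> 'm set \<Rightarrow> 'm set \<Rightarrow> 'm set \<Rightarrow> bool" where
  "functorial_factorization C P L R \<longleftrightarrow>
     (\<exists>E \<alpha> \<beta> m.
        (\<forall>f\<in>P. \<alpha> f \<in> hom C (Dom C f) (E f) \<and> \<beta> f \<in> hom C (E f) (Cod C f) \<and>
           Comp C (\<beta> f) (\<alpha> f) = f \<and> \<alpha> f \<in> L \<and> \<beta> f \<in> R) \<and>
        (\<forall>f\<in>P. \<forall>g\<in>P. \<forall>s\<in>hom C (Dom C f) (Dom C g). \<forall>t\<in>hom C (Cod C f) (Cod C g).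
           Comp C g s = Comp C t f \<longrightarrow>
           m f g s t \<in> hom C (E f) (E g) \<and>
           Comp C (m f g s t) (\<alpha> f) = Comp C (\<alpha> g) s \<and>
           Comp C (\<beta> g) (m f g s t) = Comp C t (\<beta> f)) \<and>
        (\<forall>f\<in>P. m f f (Id C (Dom C f)) (Id C (Cod C f)) = Id C (E f)) \<and>
        (\<forall>f\<in>P. \<forall>g\<in>P. \<forall>h\<in>P.
           \<forall>s\<in>hom C (Dom C f) (Dom C g). \<forall>t\<in>hom C (Cod C f) (Cod C g).
           \<forall>s'\<in>hom C (Dom C g) (Dom C h). \<forall>t'\<in>hom C (Cod C g) (Cod C h).
           Comp C g s = Comp C t f \<and> Comp C h s' = Comp C t' g \<longrightarrow>
           m f h (Comp C s' s) (Comp C t' t) = Comp C (m g h s' t') (m f g s t)))"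

definition model_structure :: "('o, 'm) cat \<Rightarrow> 'm hstruct \<Rightarrow> bool" where
  "model_structure C S \<longleftrightarrow>
     homotopically_structured C S \<and>
     two_out_of_three C (weqs S) \<and>
     closed_under_retracts C (weqs S) \<and> closed_under_retracts C (fibs S) \<and>
     closed_under_retracts C (cofs C S) \<and>
     (\<forall>i\<in>cofs C S. \<forall>p\<in>tfibs S. lifts C i p) \<and>
     (\<forall>i\<in>tcofs C S. \<forall>p\<in>fibs S. lifts C i p) \<and>
     functorial_factorization C (Arr C) (cofs C S) (tfibs S) \<and>
     functorial_factorization C (Arr C) (tcofs C S) (fibs S)"

definition model_category :: "'u itself \<Rightarrow> ('o, 'm) cat \<Rightarrow> 'm hstruct \<Rightarrow> bool" where
  "model_category u C S \<longleftrightarrow>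
     category C \<and> complete u C \<and> cocomplete u C \<and> model_structure C S"

text \<open>The axioms of a semi-model structure, where the condition imposed on the domains of trivial
  cofibrations and of the arrows to be factored is a parameter \<open>G\<close>.\<close>

definition semi_model_axioms :: "('o, 'm) cat \<Rightarrow> 'm hstruct \<Rightarrow> ('o \<Rightarrow> bool) \<Rightarrow> bool" where
  "semi_model_axioms C S G \<longleftrightarrow>
     homotopically_structured C S \<and>
     closed_under_pullback C (fibs S) \<and>
     two_out_of_three C (weqs S) \<and>
     (\<forall>K\<in>{weqs S, fibs S, cofs C S}.
        contains_isos C K \<and> closed_under_comp C K \<and> closed_under_retracts C K) \<and>
     (\<forall>i\<in>cofs C S. \<forall>p\<in>tfibs S. lifts C i p) \<and>
     (\<forall>i\<in>tcofs C S. \<forall>p\<in>fibs S. G (Dom C i) \<longrightarrow> lifts C i p) \<and>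
     functorial_factorization C (Arr C) (cofs C S) (tfibs S) \<and>
     functorial_factorization C {f \<in> Arr C. G (Dom C f)} (tcofs C S) (fibs S)"

definition semi_model_structure :: "('o, 'm) cat \<Rightarrow> 'm hstruct \<Rightarrow> bool" where
  "semi_model_structure C S \<longleftrightarrow> semi_model_axioms C S (cofibrant C S)"

definition cofibrantly_generated :: "'u itself \<Rightarrow> ('o, 'm) cat \<Rightarrow> 'm hstruct \<Rightarrow> bool" where
  "cofibrantly_generated u C S \<longleftrightarrow>
     (\<exists>I J. I \<subseteq> Arr C \<and> J \<subseteq> Arr C \<and> small u I \<and> small u J \<and>
        tfibs S = {p \<in> Arr C. \<forall>i\<in>I. lifts C i p} \<and>
        fibs S = {p \<in> Arr C. \<forall>j\<in>J. lifts C j p} \<and>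
        (\<forall>i\<in>I. small_relative_to u C (Dom C i) (relative_cell u C I)) \<and>
        (\<forall>j\<in>J. small_relative_to u C (Dom C j)
           {f \<in> relative_cell u C J. cofibrant C S (Dom C f)}))"

text \<open>\<open>S\<close> is a semi-model structure on \<open>D\<close> over the cofibrantly generated model category
  \<open>(M, S')\<close>, relative to \<open>V : D \<rightarrow> M\<close>.\<close>

definition semi_model_structure_over ::
  "'u itself \<Rightarrow> ('o, 'm) cat \<Rightarrow> 'm hstruct \<Rightarrow> ('p, 'n) cat \<Rightarrow> 'n hstruct \<Rightarrow>
   ('o, 'm, 'p, 'n) fnctr \<Rightarrow> bool" where
  "semi_model_structure_over u D S M S' V \<longleftrightarrow>
     model_category u M S' \<and> cofibrantly_generated u M S' \<and>
     category D \<and> complete u D \<and> cocomplete u D \<and>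
     (\<exists>F \<eta>. adjunction M D F V \<eta>) \<and>
     preserves_ordinal_colimits u D M V \<and>
     semi_model_axioms D S (\<lambda>a. cofibrant M S' (fobj V a))"

definition left_proper :: "('o, 'm) cat \<Rightarrow> 'm hstruct \<Rightarrow> bool" where
  "left_proper C S \<longleftrightarrow>
     (\<forall>w i p q. w \<in> weqs S \<and> i \<in> cofs C S \<and> is_pushout C w i p q \<longrightarrow> q \<in> weqs S)"

definition relatively_left_proper ::
  "('o, 'm) cat \<Rightarrow> 'm hstruct \<Rightarrow> ('p, 'n) cat \<Rightarrow> 'n hstruct \<Rightarrow> ('o, 'm, 'p, 'n) fnctr \<Rightarrow> bool" where
  "relatively_left_proper C S M S' V \<longleftrightarrow>
     (\<forall>w i p q. w \<in> weqs S \<and> i \<in> cofs C S \<and>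
        cofibrant M S' (fobj V (Dom C w)) \<and> cofibrant M S' (fobj V (Cod C w)) \<and>
        is_pushout C w i p q \<longrightarrow> q \<in> weqs S)"

section \<open>Homotopy categories and Quillen equivalences\<close>

text \<open>The localization of \<open>C\<close> at \<open>W\<close> has the objects of \<open>C\<close>; its arrows are classes of zigzags of
  arrows of \<open>C\<close> in which the arrows traversed backwards belong to \<open>W\<close>. Zigzags are read in the
  order of traversal, so concatenation is composition in diagrammatic order.\<close>

datatype 'm step = Fwd 'm | Bwd 'm

inductive zigzag :: "('o, 'm) cat \<Rightarrow> 'm set \<Rightarrow> 'o \<Rightarrow> 'm step list \<Rightarrow> 'o \<Rightarrow> bool"
  for C :: "('o, 'm) cat" and W :: "'m set" where
  zz_nil: "a \<in> Obj C \<Longrightarrow> zigzag C W a [] a"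
| zz_fwd: "f \<in> Arr C \<Longrightarrow> zigzag C W (Cod C f) p b \<Longrightarrow> zigzag C W (Dom C f) (Fwd f # p) b"
| zz_bwd: "w \<in> W \<Longrightarrow> w \<in> Arr C \<Longrightarrow> zigzag C W (Dom C w) p b \<Longrightarrow>
    zigzag C W (Cod C w) (Bwd w # p) b"

inductive zigzag_step :: "('o, 'm) cat \<Rightarrow> 'm set \<Rightarrow> 'm step list \<Rightarrow> 'm step list \<Rightarrow> bool"
  for C :: "('o, 'm) cat" and W :: "'m set" where
  zs_id: "a \<in> Obj C \<Longrightarrow> zigzag_step C W [Fwd (Id C a)] []"
| zs_comp: "f \<in> Arr C \<Longrightarrow> g \<in> Arr C \<Longrightarrow> Cod C f = Dom C g \<Longrightarrow>
    zigzag_step C W [Fwd f, Fwd g] [Fwd (Comp C g f)]"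
| zs_fb: "w \<in> W \<Longrightarrow> zigzag_step C W [Fwd w, Bwd w] []"
| zs_bf: "w \<in> W \<Longrightarrow> zigzag_step C W [Bwd w, Fwd w] []"

inductive zigzag_eq ::
  "('o, 'm) cat \<Rightarrow> 'm set \<Rightarrow> 'o \<Rightarrow> 'o \<Rightarrow> 'm step list \<Rightarrow> 'm step list \<Rightarrow> bool"
  for C :: "('o, 'm) cat" and W :: "'m set" and a b :: 'o where
  ze_refl: "zigzag C W a p b \<Longrightarrow> zigzag_eq C W a b p p"
| ze_step: "zigzag_step C W s t \<Longrightarrow> zigzag C W a (p @ s @ q) b \<Longrightarrow> zigzag C W a (p @ t @ q) b \<Longrightarrow>
    zigzag_eq C W a b (p @ s @ q) (p @ t @ q)"
| ze_sym: "zigzag_eq C W a b p q \<Longrightarrow> zigzag_eq C W a b q p"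
| ze_trans: "zigzag_eq C W a b p q \<Longrightarrow> zigzag_eq C W a b q r \<Longrightarrow> zigzag_eq C W a b p r"

type_synonym ('o, 'm) ho_arr = "'o \<times> 'm step list set \<times> 'o"

definition ho_class :: "('o, 'm) cat \<Rightarrow> 'm set \<Rightarrow> 'o \<Rightarrow> 'o \<Rightarrow> 'm step list \<Rightarrow> ('o, 'm) ho_arr" where
  "ho_class C W a b p = (a, {q. zigzag_eq C W a b p q}, b)"

definition Ho :: "('o, 'm) cat \<Rightarrow> 'm set \<Rightarrow> ('o, ('o, 'm) ho_arr) cat" where
  "Ho C W =
     \<lparr>Obj = Obj C,
      Arr = {ho_class C W a b p | a b p. zigzag C W a p b},
      Dom = (\<lambda>(a, P, b). a),
      Cod = (\<lambda>(a, P, b). b),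
      Id = (\<lambda>a. ho_class C W a a []),
      Comp = (\<lambda>(b', Q, c) (a, P, b). (a, {r. \<exists>p\<in>P. \<exists>q\<in>Q. zigzag_eq C W a c (p @ q) r}, c))\<rparr>"

definition ho_functor :: "('o, 'm) cat \<Rightarrow> 'm set \<Rightarrow> ('o, 'm, 'o, ('o, 'm) ho_arr) fnctr" where
  "ho_functor C W =
     \<lparr>fobj = (\<lambda>a. a), farr = (\<lambda>f. ho_class C W (Dom C f) (Cod C f) [Fwd f])\<rparr>"

text \<open>The total left derived functor of \<open>F : C \<rightarrow> D\<close> is the right Kan extension of
  \<open>C \<rightarrow> D \<rightarrow> Ho D\<close> along \<open>C \<rightarrow> Ho C\<close>; dually for the total right derived functor.\<close>

definition total_left_derived ::
  "('o, 'm) cat \<Rightarrow> 'm set \<Rightarrow> ('p, 'n) cat \<Rightarrow> 'n set \<Rightarrow> ('o, 'm, 'p, 'n) fnctr \<Rightarrow>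
   ('o, ('o, 'm) ho_arr, 'p, ('p, 'n) ho_arr) fnctr \<Rightarrow> ('o \<Rightarrow> ('p, 'n) ho_arr) \<Rightarrow> bool" where
  "total_left_derived C W D W' F T \<epsilon> \<longleftrightarrow>
     is_functor (Ho C W) (Ho D W') T \<and>
     nat_trans C (Ho D W') (comp_functor T (ho_functor C W)) (comp_functor (ho_functor D W') F) \<epsilon> \<and>
     (\<forall>G \<zeta>. is_functor (Ho C W) (Ho D W') G \<and>
        nat_trans C (Ho D W') (comp_functor G (ho_functor C W)) (comp_functor (ho_functor D W') F) \<zeta> \<longrightarrow>
        (\<exists>\<theta>. nat_trans (Ho C W) (Ho D W') G T \<theta> \<and>
           (\<forall>a\<in>Obj C. Comp (Ho D W') (\<epsilon> a) (\<theta> a) = \<zeta> a) \<and>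
           (\<forall>\<theta>'. nat_trans (Ho C W) (Ho D W') G T \<theta>' \<and>
              (\<forall>a\<in>Obj C. Comp (Ho D W') (\<epsilon> a) (\<theta>' a) = \<zeta> a) \<longrightarrow>
              (\<forall>a\<in>Obj C. \<theta>' a = \<theta> a))))"

definition total_right_derived ::
  "('o, 'm) cat \<Rightarrow> 'm set \<Rightarrow> ('p, 'n) cat \<Rightarrow> 'n set \<Rightarrow> ('o, 'm, 'p, 'n) fnctr \<Rightarrow>
   ('o, ('o, 'm) ho_arr, 'p, ('p, 'n) ho_arr) fnctr \<Rightarrow> ('o \<Rightarrow> ('p, 'n) ho_arr) \<Rightarrow> bool" where
  "total_right_derived C W D W' F T \<epsilon> \<longleftrightarrow>
     is_functor (Ho C W) (Ho D W') T \<and>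
     nat_trans C (Ho D W') (comp_functor (ho_functor D W') F) (comp_functor T (ho_functor C W)) \<epsilon> \<and>
     (\<forall>G \<zeta>. is_functor (Ho C W) (Ho D W') G \<and>
        nat_trans C (Ho D W') (comp_functor (ho_functor D W') F) (comp_functor G (ho_functor C W)) \<zeta> \<longrightarrow>
        (\<exists>\<theta>. nat_trans (Ho C W) (Ho D W') T G \<theta> \<and>
           (\<forall>a\<in>Obj C. Comp (Ho D W') (\<theta> a) (\<epsilon> a) = \<zeta> a) \<and>
           (\<forall>\<theta>'. nat_trans (Ho C W) (Ho D W') T G \<theta>' \<and>
              (\<forall>a\<in>Obj C. Comp (Ho D W') (\<theta>' a) (\<epsilon> a) = \<zeta> a) \<longrightarrow>
              (\<forall>a\<in>Obj C. \<theta>' a = \<theta> a))))"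

definition quillen_pair ::
  "('o, 'm) cat \<Rightarrow> 'm hstruct \<Rightarrow> ('p, 'n) cat \<Rightarrow> 'n hstruct \<Rightarrow>
   ('o, 'm, 'p, 'n) fnctr \<Rightarrow> ('p, 'n, 'o, 'm) fnctr \<Rightarrow> ('o \<Rightarrow> 'm) \<Rightarrow> bool" where
  "quillen_pair C S D S' L R \<eta> \<longleftrightarrow>
     adjunction C D L R \<eta> \<and>
     (\<forall>g\<in>fibs S'. farr R g \<in> fibs S) \<and> (\<forall>g\<in>tfibs S'. farr R g \<in> tfibs S)"

text \<open>A Quillen pair induces an equivalence of homotopy categories if the total derived functors
  of its two members exist and are quasi-inverse to each other.\<close>

definition quillen_equivalence ::
  "('o, 'm) cat \<Rightarrow> 'm hstruct \<Rightarrow> ('p, 'n) cat \<Rightarrow> 'n hstruct \<Rightarrow>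
   ('o, 'm, 'p, 'n) fnctr \<Rightarrow> ('p, 'n, 'o, 'm) fnctr \<Rightarrow> ('o \<Rightarrow> 'm) \<Rightarrow> bool" where
  "quillen_equivalence C S D S' L R \<eta> \<longleftrightarrow>
     quillen_pair C S D S' L R \<eta> \<and>
     (\<exists>LL \<epsilon> RR \<rho>.
        total_left_derived C (weqs S) D (weqs S') L LL \<epsilon> \<and>
        total_right_derived D (weqs S') C (weqs S) R RR \<rho> \<and>
        naturally_isomorphic (Ho C (weqs S)) (Ho C (weqs S)) id_functor (comp_functor RR LL) \<and>
        naturally_isomorphic (Ho D (weqs S')) (Ho D (weqs S')) (comp_functor LL RR) id_functor)"

definition reflects_weqs :: "('p, 'n) cat \<Rightarrow> 'n hstruct \<Rightarrow> 'm hstruct \<Rightarrow> ('p, 'n, 'o, 'm) fnctr \<Rightarrow> bool" where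
  "reflects_weqs D S' S R \<longleftrightarrow> (\<forall>g\<in>Arr D. farr R g \<in> weqs S \<longrightarrow> g \<in> weqs S')"

section \<open>Indexed categories and the Grothendieck construction\<close>

text \<open>Homotopically structured functors from the opposite of a base category to CAT;
  \<open>pull \<Phi> \<phi>\<close> is \<open>\<phi>\<^sup>*\<close>.\<close>

record ('o, 'm, 'a, 'f) hindexed =
  base :: "('o, 'm) cat"
  fiber :: "'o \<Rightarrow> ('a, 'f) cat"
  pull :: "'m \<Rightarrow> ('a, 'f, 'a, 'f) fnctr"
  horiz :: "'m hstruct"
  vert :: "'o \<Rightarrow> 'f hstruct"

definition hindexed_category :: "('o, 'm, 'a, 'f) hindexed \<Rightarrow> bool" where
  "hindexed_category \<Phi> \<longleftrightarrow>
     category (base \<Phi>) \<and> homotopically_structured (base \<Phi>) (horiz \<Phi>) \<and>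
     (\<forall>x\<in>Obj (base \<Phi>). category (fiber \<Phi> x) \<and> homotopically_structured (fiber \<Phi> x) (vert \<Phi> x)) \<and>
     (\<forall>\<phi>\<in>Arr (base \<Phi>).
        is_functor (fiber \<Phi> (Cod (base \<Phi>) \<phi>)) (fiber \<Phi> (Dom (base \<Phi>) \<phi>)) (pull \<Phi> \<phi>)) \<and>
     (\<forall>x\<in>Obj (base \<Phi>).
        (\<forall>a\<in>Obj (fiber \<Phi> x). fobj (pull \<Phi> (Id (base \<Phi>) x)) a = a) \<and>
        (\<forall>f\<in>Arr (fiber \<Phi> x). farr (pull \<Phi> (Id (base \<Phi>) x)) f = f)) \<and>
     (\<forall>\<phi>\<in>Arr (base \<Phi>). \<forall>\<psi>\<in>Arr (base \<Phi>). Cod (base \<Phi>) \<phi> = Dom (base \<Phi>) \<psi> \<longrightarrow>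
        (\<forall>a\<in>Obj (fiber \<Phi> (Cod (base \<Phi>) \<psi>)).
           fobj (pull \<Phi> (Comp (base \<Phi>) \<psi> \<phi>)) a = fobj (pull \<Phi> \<phi>) (fobj (pull \<Phi> \<psi>) a)) \<and>
        (\<forall>f\<in>Arr (fiber \<Phi> (Cod (base \<Phi>) \<psi>)).
           farr (pull \<Phi> (Comp (base \<Phi>) \<psi> \<phi>)) f = farr (pull \<Phi> \<phi>) (farr (pull \<Phi> \<psi>) f)))"

text \<open>A morphism \<open>(\<phi>, f) : (x, a) \<rightarrow> (y, b)\<close> is tagged with its domain and codomain, because \<open>b\<close>
  is not determined by \<open>\<phi>\<^sup>* b\<close>.\<close>

type_synonym ('o, 'm, 'a, 'f) tot_arr = "('o \<times> 'a) \<times> ('m \<times> 'f) \<times> ('o \<times> 'a)"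

definition total_cat :: "('o, 'm, 'a, 'f) hindexed \<Rightarrow> ('o \<times> 'a, ('o, 'm, 'a, 'f) tot_arr) cat" where
  "total_cat \<Phi> =
     \<lparr>Obj = {(x, a). x \<in> Obj (base \<Phi>) \<and> a \<in> Obj (fiber \<Phi> x)},
      Arr = {((x, a), (\<phi>, f), (y, b)) | x a \<phi> f y b.
               a \<in> Obj (fiber \<Phi> x) \<and> b \<in> Obj (fiber \<Phi> y) \<and>
               \<phi> \<in> hom (base \<Phi>) x y \<and> f \<in> hom (fiber \<Phi> x) a (fobj (pull \<Phi> \<phi>) b)},
      Dom = (\<lambda>(d, h, c). d),
      Cod = (\<lambda>(d, h, c). c),
      Id = (\<lambda>(x, a). ((x, a), (Id (base \<Phi>) x, Id (fiber \<Phi> x) a), (x, a))),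
      Comp = (\<lambda>(d', (\<psi>, g), c') ((x, a), (\<phi>, f), c).
                ((x, a), (Comp (base \<Phi>) \<psi> \<phi>, Comp (fiber \<Phi> x) (farr (pull \<Phi> \<phi>) g) f), c'))\<rparr>"

definition global :: "('o, 'm, 'a, 'f) hindexed \<Rightarrow> ('o, 'm, 'a, 'f) tot_arr hstruct" where
  "global \<Phi> =
     \<lparr>weqs = {((x, a), (\<phi>, f), c) | x a \<phi> f c. ((x, a), (\<phi>, f), c) \<in> Arr (total_cat \<Phi>) \<and>
                \<phi> \<in> weqs (horiz \<Phi>) \<and> f \<in> weqs (vert \<Phi> x)},
      fibs = {((x, a), (\<phi>, f), c) | x a \<phi> f c. ((x, a), (\<phi>, f), c) \<in> Arr (total_cat \<Phi>) \<and>
                \<phi> \<in> fibs (horiz \<Phi>) \<and> f \<in> fibs (vert \<Phi> x)}\<rparr>"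

definition forgetful_morphism ::
  "('o, 'm, 'a, 'f) hindexed \<Rightarrow> ('p, 'n, 'b, 'g) hindexed \<Rightarrow> ('o, 'm, 'p, 'n) fnctr \<Rightarrow>
   ('o \<Rightarrow> ('a, 'f, 'b, 'g) fnctr) \<Rightarrow> bool" where
  "forgetful_morphism \<Phi> \<Psi> U u \<longleftrightarrow>
     is_functor (base \<Phi>) (base \<Psi>) U \<and>
     (\<forall>x\<in>Obj (base \<Phi>). is_functor (fiber \<Phi> x) (fiber \<Psi> (fobj U x)) (u x)) \<and>
     (\<forall>x y. \<forall>\<phi>\<in>hom (base \<Phi>) x y.
        (\<forall>a\<in>Obj (fiber \<Phi> y).
           fobj (u x) (fobj (pull \<Phi> \<phi>) a) = fobj (pull \<Psi> (farr U \<phi>)) (fobj (u y) a)) \<and>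
        (\<forall>f\<in>Arr (fiber \<Phi> y).
           farr (u x) (farr (pull \<Phi> \<phi>) f) = farr (pull \<Psi> (farr U \<phi>)) (farr (u y) f)))"

definition total_functor ::
  "('o, 'm, 'p, 'n) fnctr \<Rightarrow> ('o \<Rightarrow> ('a, 'f, 'b, 'g) fnctr) \<Rightarrow>
   ('o \<times> 'a, ('o, 'm, 'a, 'f) tot_arr, 'p \<times> 'b, ('p, 'n, 'b, 'g) tot_arr) fnctr" where
  "total_functor U u =
     \<lparr>fobj = (\<lambda>(x, a). (fobj U x, fobj (u x) a)),
      farr = (\<lambda>((x, a), (\<phi>, f), (y, b)).
                ((fobj U x, fobj (u x) a), (farr U \<phi>, farr (u x) f), (fobj U y, fobj (u y) b)))\<rparr>"

definition transferred ::
  "('o, 'm, 'a, 'f) hindexed \<Rightarrow> ('p, 'n, 'b, 'g) hindexed \<Rightarrow> ('o, 'm, 'p, 'n) fnctr \<Rightarrow>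
   ('o \<Rightarrow> ('a, 'f, 'b, 'g) fnctr) \<Rightarrow> bool" where
  "transferred \<Phi> \<Psi> U u \<longleftrightarrow>
     (\<forall>\<phi>\<in>Arr (base \<Phi>).
        (\<phi> \<in> weqs (horiz \<Phi>) \<longleftrightarrow> farr U \<phi> \<in> weqs (horiz \<Psi>)) \<and>
        (\<phi> \<in> fibs (horiz \<Phi>) \<longleftrightarrow> farr U \<phi> \<in> fibs (horiz \<Psi>))) \<and>
     (\<forall>x\<in>Obj (base \<Phi>). \<forall>f\<in>Arr (fiber \<Phi> x).
        (f \<in> weqs (vert \<Phi> x) \<longleftrightarrow> farr (u x) f \<in> weqs (vert \<Psi> (fobj U x))) \<and>
        (f \<in> fibs (vert \<Phi> x) \<longleftrightarrow> farr (u x) f \<in> fibs (vert \<Psi> (fobj U x))))"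

definition relatively_cofibrant ::
  "('p, 'n, 'b, 'g) hindexed \<Rightarrow> ('o, 'm, 'p, 'n) fnctr \<Rightarrow> 'o \<Rightarrow> bool" where
  "relatively_cofibrant \<Psi> U x \<longleftrightarrow> cofibrant (base \<Psi>) (horiz \<Psi>) (fobj U x)"

end

theory Submission
  imports Defs
begin

text \<open>The structure of a fibre is read off from the total category: an arrow \<open>f\<close> of the fibre over
  \<open>x\<close> is a vertical weak equivalence or fibration iff the arrow \<open>(id, f)\<close> is a global one. Write
  \<open>\<phi>\<^sub>!\<close> for the left adjoint of \<open>\<phi>\<^sup>*\<close>, where \<open>\<phi> : x \<rightarrow> y\<close>. Three squares carry the argument.

  \<^item> The square formed by \<open>(id, f)\<close> and the cartesian arrows over \<open>\<phi>\<close> is a pullback with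
    opposite side \<open>(id, \<phi>\<^sup>* f)\<close> (\<open>pullback_square\<close>). Global fibrations and trivial fibrations are
    stable under pullback, so \<open>\<phi>\<^sup>*\<close> preserves them.

  \<^item> If \<open>\<phi>\<close> is a horizontal weak equivalence, the cartesian arrows in this square are weak
    equivalences, so by two out of three \<open>\<phi>\<^sup>*\<close> preserves and reflects weak equivalences
    (\<open>pull_weq_iff\<close>).

  \<^item> The arrow \<open>(\<phi>, \<eta>)\<close> from \<open>(x, a)\<close> to \<open>(y, \<phi>\<^sub>! a)\<close> is the pushout of \<open>(x, i x) \<rightarrow> (y, i y)\<close> along
    \<open>(x, i x) \<rightarrow> (x, a)\<close> (\<open>adjunction_pushout\<close>). Read backwards, this constructs \<open>\<phi>\<^sub>!\<close> from pushouts
    in the total category (\<open>left_adjoint_exists\<close>); read forwards, if \<open>(x, i x) \<rightarrow> (y, i y)\<close> is a weak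
    equivalence, properness makes the unit a weak equivalence at cofibrant \<open>a\<close> (\<open>unit_weq\<close>).

  The Quillen equivalence then follows from a formal criterion (\<open>deformable_quillen_equivalence\<close>):
  if the right adjoint \<open>R\<close> preserves and reflects weak equivalences and there is a functorial
  replacement \<open>Q a \<rightarrow> a\<close> by a weak equivalence such that the unit at \<open>Q a\<close> is a weak equivalence,
  then \<open>R\<close> itself induces the right derived functor, \<open>L \<circ> Q\<close> the left derived one, and the two are
  quasi-inverse.

  It remains to find \<open>Q\<close>. In part (2) it is the cofibrant replacement of the vertical structure. In
  parts (1) and (3) only the total category has factorizations, and factoring
  \<open>(x, i x) \<rightarrow> (x, a)\<close> leaves the fibre: the middle object \<open>(z, c)\<close> lies over some \<open>z\<close>, with
  \<open>x \<rightarrow> z \<rightarrow> x\<close> a horizontal cofibration followed by a trivial fibration with composite the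
  identity. Pushing \<open>c\<close> forward along \<open>z \<rightarrow> x\<close> gives \<open>Q a\<close> (\<open>fibre_replacement\<close>). The arrow
  \<open>(z, c) \<rightarrow> (x, Q a)\<close> is a pushout of \<open>(z, i z) \<rightarrow> (x, i x)\<close>, and the latter is a weak equivalence
  because the section \<open>x \<rightarrow> z\<close> is a horizontal cofibration and weak equivalence
  (\<open>horizontal_part_weq\<close>).

  Part (3) needs two further facts. A semi-model structure is automatically proper for weak
  equivalences between cofibrant objects (\<open>proper_on_cofibrant\<close>), and for cofibrant \<open>(x, i x)\<close> and
  \<open>(y, i y)\<close> and a horizontal weak equivalence \<open>\<phi>\<close> the arrow \<open>i x \<rightarrow> \<phi>\<^sup>*(i y)\<close> is automatically a
  weak equivalence (\<open>initial_comparison_weq\<close>). Both come from a factorization of Ken Brown's type.\<close>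

section \<open>Categories with explicit carriers\<close>

text \<open>Membership in a hom-set is unfolded by the simplifier into equations for domains and codomains;
  these discharge the side conditions of the category laws.\<close>

lemma in_hom [simp]: "f \<in> hom C a b \<longleftrightarrow> f \<in> Arr C \<and> Dom C f = a \<and> Cod C f = b"
  by (simp add: hom_def)

locale cat =
  fixes C :: "('o, 'm) cat"
  assumes category: "category C"
begin

lemma dom_obj [simp]: "f \<in> Arr C \<Longrightarrow> Dom C f \<in> Obj C"
  and cod_obj [simp]: "f \<in> Arr C \<Longrightarrow> Cod C f \<in> Obj C"
  and id_arr [simp]: "a \<in> Obj C \<Longrightarrow> Id C a \<in> Arr C"
  and id_dom [simp]: "a \<in> Obj C \<Longrightarrow> Dom C (Id C a) = a"
  and id_cod [simp]: "a \<in> Obj C \<Longrightarrow> Cod C (Id C a) = a"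
  and comp_arr [simp]: "f \<in> Arr C \<Longrightarrow> g \<in> Arr C \<Longrightarrow> Cod C f = Dom C g \<Longrightarrow> Comp C g f \<in> Arr C"
  and comp_dom [simp]:
    "f \<in> Arr C \<Longrightarrow> g \<in> Arr C \<Longrightarrow> Cod C f = Dom C g \<Longrightarrow> Dom C (Comp C g f) = Dom C f"
  and comp_cod [simp]:
    "f \<in> Arr C \<Longrightarrow> g \<in> Arr C \<Longrightarrow> Cod C f = Dom C g \<Longrightarrow> Cod C (Comp C g f) = Cod C g"
  and id_right [simp]: "f \<in> Arr C \<Longrightarrow> Dom C f = a \<Longrightarrow> Comp C f (Id C a) = f"
  and id_left [simp]: "f \<in> Arr C \<Longrightarrow> Cod C f = a \<Longrightarrow> Comp C (Id C a) f = f"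
  using category by (auto simp: category_def)

lemma assoc:
  "f \<in> Arr C \<Longrightarrow> g \<in> Arr C \<Longrightarrow> h \<in> Arr C \<Longrightarrow> Cod C f = Dom C g \<Longrightarrow> Cod C g = Dom C h \<Longrightarrow>
    Comp C (Comp C h g) f = Comp C h (Comp C g f)"
  using category by (simp add: category_def)

text \<open>Associativity is oriented to the right, so a known composite \<open>h \<circ> g = k\<close> has to be applied below
  a further arrow.\<close>

lemma comp_reduce:
  "Comp C h g = k \<Longrightarrow> f \<in> Arr C \<Longrightarrow> g \<in> Arr C \<Longrightarrow> h \<in> Arr C \<Longrightarrow> Cod C f = Dom C g \<Longrightarrow>
    Cod C g = Dom C h \<Longrightarrow> Comp C h (Comp C g f) = Comp C k f"
  by (simp add: assoc[symmetric])

lemma inverse_sym: "inverse_arrows C f g \<Longrightarrow> inverse_arrows C g f"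
  by (simp add: inverse_arrows_def)

lemma iso_id: "a \<in> Obj C \<Longrightarrow> iso_arrow C (Id C a)"
  unfolding iso_arrow_def inverse_arrows_def by (rule exI[of _ "Id C a"]) simp

lemma iso_in_arr: "iso_arrow C f \<Longrightarrow> f \<in> Arr C"
  by (auto simp: iso_arrow_def inverse_arrows_def)

lemma iso_comp:
  assumes "iso_arrow C f" "iso_arrow C g" "Cod C f = Dom C g"
  shows "iso_arrow C (Comp C g f)"
proof -
  obtain f' g' where i: "inverse_arrows C f f'" "inverse_arrows C g g'"
    using assms by (auto simp: iso_arrow_def)
  have "g' \<in> Arr C" "f' \<in> Arr C" "Comp C g' g = Id C (Dom C g)" "Comp C f f' = Id C (Cod C f)"
    using i by (simp_all add: inverse_arrows_def)
  note red = comp_reduce[OF this(3)] comp_reduce[OF this(4)]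
  have "inverse_arrows C (Comp C g f) (Comp C f' g')"
    using i assms(3) by (simp add: inverse_arrows_def assoc red)
  then show ?thesis by (auto simp: iso_arrow_def)
qed

lemma iso_inverse: "inverse_arrows C f g \<Longrightarrow> iso_arrow C g"
  using inverse_sym by (auto simp: iso_arrow_def)

lemma iso_cancel_left:
  assumes "iso_arrow C f" "g \<in> Arr C" "h \<in> Arr C" "Cod C g = Dom C f" "Cod C h = Dom C f"
    "Comp C f g = Comp C f h"
  shows "g = h"
proof -
  obtain f' where i: "inverse_arrows C f f'" using assms by (auto simp: iso_arrow_def)
  then have "Comp C f' f = Id C (Dom C f)" "f \<in> Arr C" "f' \<in> Arr C" "Dom C f' = Cod C f"
    by (simp_all add: inverse_arrows_def)
  then show ?thesis
    using assms by (metis assoc id_left)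
qed

lemma iso_cancel_right:
  assumes "iso_arrow C f" "g \<in> Arr C" "h \<in> Arr C" "Dom C g = Cod C f" "Dom C h = Cod C f"
    "Comp C g f = Comp C h f"
  shows "g = h"
proof -
  obtain f' where i: "inverse_arrows C f f'" using assms by (auto simp: iso_arrow_def)
  then have "Comp C f f' = Id C (Cod C f)" "f \<in> Arr C" "f' \<in> Arr C" "Cod C f' = Dom C f"
    by (simp_all add: inverse_arrows_def)
  then show ?thesis
    using assms by (metis assoc id_right)
qed

end

lemma functor_simps:
  assumes "is_functor C D T"
  shows "a \<in> Obj C \<Longrightarrow> fobj T a \<in> Obj D"
    and "f \<in> Arr C \<Longrightarrow> farr T f \<in> Arr D"
    and "f \<in> Arr C \<Longrightarrow> Dom D (farr T f) = fobj T (Dom C f)"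
    and "f \<in> Arr C \<Longrightarrow> Cod D (farr T f) = fobj T (Cod C f)"
    and "a \<in> Obj C \<Longrightarrow> farr T (Id C a) = Id D (fobj T a)"
    and "f \<in> Arr C \<Longrightarrow> g \<in> Arr C \<Longrightarrow> Cod C f = Dom C g \<Longrightarrow>
      farr T (Comp C g f) = Comp D (farr T g) (farr T f)"
  using assms by (simp_all add: is_functor_def)

lemma functor_iso:
  assumes "category C" "is_functor C D T" "iso_arrow C f"
  shows "iso_arrow D (farr T f)"
proof -
  interpret cat C by standard (rule assms)
  obtain g where "inverse_arrows C f g" using assms(3) by (auto simp: iso_arrow_def)
  then have "inverse_arrows D (farr T f) (farr T g)"
    using functor_simps[OF assms(2)]
    by (simp add: inverse_arrows_def functor_simps(6)[OF assms(2), symmetric])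
  then show ?thesis by (auto simp: iso_arrow_def)
qed

lemma comp_functor_simps [simp]:
  "fobj (comp_functor S T) a = fobj S (fobj T a)"
  "farr (comp_functor S T) f = farr S (farr T f)"
  by (simp_all add: comp_functor_def)

lemma id_functor_simps [simp]: "fobj id_functor a = a" "farr id_functor f = f"
  by (simp_all add: id_functor_def)

lemma comp_functor_is_functor:
  "is_functor C D T \<Longrightarrow> is_functor D E S \<Longrightarrow> is_functor C E (comp_functor S T)"
  by (simp add: is_functor_def)

lemma initial_arrow:
  assumes "initial_object C z" "a \<in> Obj C"
  obtains f where "f \<in> hom C z a"
  using assms unfolding initial_object_def by blast

lemma initial_unique:
  assumes "initial_object C z" "f \<in> Arr C" "g \<in> Arr C" "Dom C f = z" "Dom C g = z" "Cod C f = Cod C g"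
    "Cod C f \<in> Obj C"
  shows "f = g"
  using assms unfolding initial_object_def by (metis in_hom)

lemma two_out_of_threeD:
  assumes "two_out_of_three C K" "f \<in> Arr C" "g \<in> Arr C" "Cod C f = Dom C g"
  shows "f \<in> K \<Longrightarrow> g \<in> K \<Longrightarrow> Comp C g f \<in> K"
    and "f \<in> K \<Longrightarrow> Comp C g f \<in> K \<Longrightarrow> g \<in> K"
    and "g \<in> K \<Longrightarrow> Comp C g f \<in> K \<Longrightarrow> f \<in> K"
  using assms unfolding two_out_of_three_def by blast+

section \<open>Localization by zigzags\<close>

lemma zigzag_append:
  "zigzag C W a p b \<Longrightarrow> zigzag C W b q c \<Longrightarrow> zigzag C W a (p @ q) c"
  by (induction rule: zigzag.induct) (auto intro: zigzag.intros)

lemma zigzag_eq_zigzag: "zigzag_eq C W a b p q \<Longrightarrow> zigzag C W a p b \<and> zigzag C W a q b"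
  by (induction rule: zigzag_eq.induct) auto

lemma zigzag_eq_append_left:
  assumes "zigzag_eq C W b c p q" "zigzag C W a r b"
  shows "zigzag_eq C W a c (r @ p) (r @ q)"
  using assms
proof (induction rule: zigzag_eq.induct)
  case (ze_step s t p q)
  then show ?case
    using zigzag_eq.ze_step[of C W s t a "r @ p" q c] by (simp add: zigzag_append)
qed (auto intro: zigzag_eq.intros zigzag_append)

lemma zigzag_eq_append_right:
  assumes "zigzag_eq C W a b p q" "zigzag C W b r c"
  shows "zigzag_eq C W a c (p @ r) (q @ r)"
  using assms
proof (induction rule: zigzag_eq.induct)
  case (ze_step s t p q)
  then show ?case
    using zigzag_eq.ze_step[of C W s t a p "q @ r" c] zigzag_append[of C W a _ b r c] by fastforce
qed (auto intro: zigzag_eq.intros zigzag_append)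

lemma zigzag_eq_append:
  assumes "zigzag_eq C W a b p p'" "zigzag_eq C W b c q q'"
  shows "zigzag_eq C W a c (p @ q) (p' @ q')"
  using zigzag_eq_append_right[OF assms(1)] zigzag_eq_append_left[OF assms(2)]
    zigzag_eq_zigzag[OF assms(1)] zigzag_eq_zigzag[OF assms(2)]
  by (meson zigzag_eq.ze_trans)

lemma ho_class_eq:
  "zigzag_eq C W a b p q \<Longrightarrow> ho_class C W a b p = ho_class C W a b q"
  by (auto simp: ho_class_def intro: zigzag_eq.intros)

lemma ho_comp:
  assumes "zigzag C W a p b" "zigzag C W b q c"
  shows "Comp (Ho C W) (ho_class C W b c q) (ho_class C W a b p) = ho_class C W a c (p @ q)"
proof -
  have "(\<exists>p'. zigzag_eq C W a b p p' \<and> (\<exists>q'. zigzag_eq C W b c q q' \<and> zigzag_eq C W a c (p' @ q') r))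
      \<longleftrightarrow> zigzag_eq C W a c (p @ q) r" for r
    using assms zigzag_eq_append zigzag_eq.ze_refl zigzag_eq.ze_trans by meson
  then show ?thesis by (simp add: Ho_def ho_class_def)
qed

lemma Ho_simps [simp]:
  "Obj (Ho C W) = Obj C"
  "Dom (Ho C W) (ho_class C W a b p) = a"
  "Cod (Ho C W) (ho_class C W a b p) = b"
  "Id (Ho C W) a = ho_class C W a a []"
  by (simp_all add: Ho_def ho_class_def)

lemma ho_class_arr [simp]: "zigzag C W a p b \<Longrightarrow> ho_class C W a b p \<in> Arr (Ho C W)"
  by (auto simp: Ho_def)

lemma Ho_arrE:
  assumes "f \<in> Arr (Ho C W)"
  obtains a b p where "f = ho_class C W a b p" "zigzag C W a p b"
  using assms by (auto simp: Ho_def)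

lemma ho_functor_simps [simp]:
  "fobj (ho_functor C W) a = a"
  "farr (ho_functor C W) f = ho_class C W (Dom C f) (Cod C f) [Fwd f]"
  by (simp_all add: ho_functor_def)

locale localization = cat C for C :: "('o, 'm) cat" +
  fixes W :: "'m set"
  assumes W_arr: "W \<subseteq> Arr C"
begin

lemma zigzag_obj: "zigzag C W a p b \<Longrightarrow> a \<in> Obj C \<and> b \<in> Obj C"
  by (induction rule: zigzag.induct) auto

lemma zigzag_fwd: "f \<in> Arr C \<Longrightarrow> zigzag C W (Dom C f) [Fwd f] (Cod C f)"
  by (simp add: zigzag.zz_fwd zigzag.zz_nil)

lemma zigzag_bwd: "w \<in> W \<Longrightarrow> zigzag C W (Cod C w) [Bwd w] (Dom C w)"
  using W_arr by (simp add: zigzag.zz_bwd zigzag.zz_nil subset_iff)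

lemma category_Ho: "category (Ho C W)"
  unfolding category_def
proof (intro conjI ballI impI)
  fix f assume f: "f \<in> Arr (Ho C W)"
  then obtain a b p where p: "f = ho_class C W a b p" "zigzag C W a p b" by (rule Ho_arrE)
  show "Dom (Ho C W) f \<in> Obj (Ho C W)" "Cod (Ho C W) f \<in> Obj (Ho C W)"
    using zigzag_obj p by auto
  show "Comp (Ho C W) f (Id (Ho C W) (Dom (Ho C W) f)) = f"
    "Comp (Ho C W) (Id (Ho C W) (Cod (Ho C W) f)) f = f"
    using p zigzag_obj by (simp_all add: ho_comp zigzag.intros)
  fix g assume "g \<in> Arr (Ho C W)"
  then obtain b' c q where q: "g = ho_class C W b' c q" "zigzag C W b' q c" by (rule Ho_arrE)
  show "Comp (Ho C W) g f \<in> hom (Ho C W) (Dom (Ho C W) f) (Cod (Ho C W) g)"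
    if "Cod (Ho C W) f = Dom (Ho C W) g"
    using that p q by (simp add: ho_comp zigzag_append)
  fix h assume "h \<in> Arr (Ho C W)"
  then obtain c' d r where r: "h = ho_class C W c' d r" "zigzag C W c' r d" by (rule Ho_arrE)
  show "Comp (Ho C W) h (Comp (Ho C W) g f) = Comp (Ho C W) (Comp (Ho C W) h g) f"
    if "Cod (Ho C W) f = Dom (Ho C W) g \<and> Cod (Ho C W) g = Dom (Ho C W) h"
    using that p q r by (simp add: ho_comp zigzag_append)
qed (simp_all add: zigzag.zz_nil)

sublocale ho: cat "Ho C W"
  by standard (rule category_Ho)

lemma ho_functor_is_functor: "is_functor C (Ho C W) (ho_functor C W)"
  unfolding is_functor_def
proof (intro conjI ballI impI)
  fix a assume "a \<in> Obj C"
  then show "farr (ho_functor C W) (Id C a) = Id (Ho C W) (fobj (ho_functor C W) a)"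
    using zigzag_eq.ze_step[OF zigzag_step.zs_id[of a C W], of a "[]" "[]" a] zigzag_fwd[of "Id C a"]
    by (auto simp: zigzag.intros intro: ho_class_eq)
next
  fix f g assume *: "f \<in> Arr C" "g \<in> Arr C" "Cod C f = Dom C g"
  have "zigzag_eq C W (Dom C f) (Cod C g) [Fwd f, Fwd g] [Fwd (Comp C g f)]"
    using zigzag_eq.ze_step[OF zigzag_step.zs_comp[OF *], of W "Dom C f" "[]" "[]" "Cod C g"]
      * zigzag_append[OF zigzag_fwd[of f] , of "[Fwd g]" "Cod C g"] zigzag_fwd[of g]
      zigzag_fwd[of "Comp C g f"] by simp
  then show "farr (ho_functor C W) (Comp C g f) =
      Comp (Ho C W) (farr (ho_functor C W) g) (farr (ho_functor C W) f)"
    using * zigzag_fwd[OF *(1)] zigzag_fwd[OF *(2)] by (simp add: ho_comp ho_class_eq)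
qed (auto simp: zigzag_fwd)

lemma ho_inverse:
  assumes "w \<in> W"
  shows "inverse_arrows (Ho C W) (farr (ho_functor C W) w)
    (ho_class C W (Cod C w) (Dom C w) [Bwd w])"
proof -
  have w: "w \<in> Arr C" using assms W_arr by auto
  note z = zigzag_fwd[OF w] zigzag_bwd[OF assms]
  have "zigzag_eq C W (Dom C w) (Dom C w) [Fwd w, Bwd w] []"
    using zigzag_eq.ze_step[OF zigzag_step.zs_fb[OF assms], of C "Dom C w" "[]" "[]"]
      zigzag_append[OF z] w by (simp add: zigzag.intros)
  moreover have "zigzag_eq C W (Cod C w) (Cod C w) [Bwd w, Fwd w] []"
    using zigzag_eq.ze_step[OF zigzag_step.zs_bf[OF assms], of C "Cod C w" "[]" "[]"]
      zigzag_append[OF z(2,1)] w by (simp add: zigzag.intros)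
  ultimately show ?thesis
    using z by (simp add: inverse_arrows_def ho_comp ho_class_eq)
qed

lemma ho_iso: "w \<in> W \<Longrightarrow> iso_arrow (Ho C W) (farr (ho_functor C W) w)"
  using ho_inverse unfolding iso_arrow_def by blast

text \<open>Naturality on the localization can be checked on arrows of \<open>C\<close>: every arrow of the
  localization is a composite of images of such arrows and of inverses of such images, and
  naturality passes to composites and to inverses.\<close>

lemma ho_nat_trans:
  assumes "category D" "is_functor (Ho C W) D G" "is_functor (Ho C W) D H"
    and "nat_trans C D (comp_functor G (ho_functor C W)) (comp_functor H (ho_functor C W)) \<theta>"
  shows "nat_trans (Ho C W) D G H \<theta>"
proof -
  interpret D: cat D by standard (rule assms)
  note G = functor_simps[OF assms(2)] and H = functor_simps[OF assms(3)]
  have \<theta>: "\<theta> a \<in> Arr D" "Dom D (\<theta> a) = fobj G a" "Cod D (\<theta> a) = fobj H a" if "a \<in> Obj C" for a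
    using assms(4) that by (simp_all add: nat_trans_def)
  have nat: "Comp D (\<theta> (Cod C f)) (farr G (farr (ho_functor C W) f)) =
      Comp D (farr H (farr (ho_functor C W) f)) (\<theta> (Dom C f))" if "f \<in> Arr C" for f
    using assms(4) that by (simp add: nat_trans_def)
  have sq: "Comp D (\<theta> c) (farr G (Comp (Ho C W) g f)) = Comp D (farr H (Comp (Ho C W) g f)) (\<theta> a)"
    if "f \<in> hom (Ho C W) a b" "g \<in> hom (Ho C W) b c"
      "Comp D (\<theta> b) (farr G f) = Comp D (farr H f) (\<theta> a)"
      "Comp D (\<theta> c) (farr G g) = Comp D (farr H g) (\<theta> b)" for f g a b c
  proof -
    have o: "a \<in> Obj C" "b \<in> Obj C" "c \<in> Obj C"
      using that ho.dom_obj[of f] ho.cod_obj[of f] ho.cod_obj[of g] by auto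
    have "Comp D (\<theta> c) (Comp D (farr G g) (farr G f)) = Comp D (Comp D (\<theta> c) (farr G g)) (farr G f)"
      using that(1,2) o by (simp add: G H \<theta> D.assoc)
    also have "\<dots> = Comp D (farr H g) (Comp D (\<theta> b) (farr G f))"
      unfolding that(4) using that(1,2) o by (simp add: G H \<theta> D.assoc)
    also have "\<dots> = Comp D (farr H g) (Comp D (farr H f) (\<theta> a))"
      by (simp only: that(3))
    also have "\<dots> = Comp D (Comp D (farr H g) (farr H f)) (\<theta> a)"
      using that(1,2) o by (simp add: G H \<theta> D.assoc)
    finally show ?thesis using that by (simp add: G H)
  qed
  have inv: "Comp D (\<theta> a) (farr G g) = Comp D (farr H g) (\<theta> b)"
    if "inverse_arrows (Ho C W) f g" "f \<in> hom (Ho C W) a b"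
      "Comp D (\<theta> b) (farr G f) = Comp D (farr H f) (\<theta> a)" for f g a b
  proof -
    have o: "a \<in> Obj C" "b \<in> Obj C" "f \<in> Arr (Ho C W)" "g \<in> Arr (Ho C W)"
      "Dom (Ho C W) g = b" "Cod (Ho C W) g = a" "Dom (Ho C W) f = a" "Cod (Ho C W) f = b"
      using that ho.dom_obj[of f] ho.cod_obj[of f] by (auto simp: inverse_arrows_def)
    have c: "Comp (Ho C W) g f = Id (Ho C W) a" "Comp (Ho C W) f g = Id (Ho C W) b"
      using that by (auto simp: inverse_arrows_def)
    have Hgf: "Comp D (farr H g) (farr H f) = Id D (fobj H a)"
      and Gfg: "Comp D (farr G f) (farr G g) = Id D (fobj G b)"
      using o c H(5,6) G(5,6) by (metis Ho_simps(1))+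
    have "Comp D (\<theta> a) (farr G g) = Comp D (Comp D (farr H g) (farr H f)) (Comp D (\<theta> a) (farr G g))"
      using Hgf o by (simp add: G H \<theta>)
    also have "\<dots> = Comp D (farr H g) (Comp D (Comp D (farr H f) (\<theta> a)) (farr G g))"
      using o by (simp add: G H \<theta> D.assoc)
    also have "\<dots> = Comp D (farr H g) (Comp D (\<theta> b) (Comp D (farr G f) (farr G g)))"
      unfolding that(3)[symmetric] using o by (simp add: G H \<theta> D.assoc)
    also have "\<dots> = Comp D (farr H g) (\<theta> b)"
      using o by (simp add: Gfg G H \<theta>)
    finally show ?thesis .
  qed
  have "Comp D (\<theta> b) (farr G (ho_class C W a b p)) = Comp D (farr H (ho_class C W a b p)) (\<theta> a)"
    if "zigzag C W a p b" for a b p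
    using that
  proof (induction rule: zigzag.induct)
    case (zz_nil a)
    then show ?case using G(5)[of a] H(5)[of a] by (simp add: \<theta>)
  next
    case (zz_fwd f p b)
    have "ho_class C W (Dom C f) b (Fwd f # p) =
        Comp (Ho C W) (ho_class C W (Cod C f) b p) (farr (ho_functor C W) f)"
      using zz_fwd zigzag_fwd[of f] by (simp add: ho_comp)
    then show ?case
      using sq[of "farr (ho_functor C W) f" "Dom C f" "Cod C f" "ho_class C W (Cod C f) b p" b]
        nat[of f] zz_fwd zigzag_fwd[of f] by simp
  next
    case (zz_bwd w p b)
    have "ho_class C W (Cod C w) b (Bwd w # p) =
        Comp (Ho C W) (ho_class C W (Dom C w) b p) (ho_class C W (Cod C w) (Dom C w) [Bwd w])"
      using zz_bwd zigzag_bwd[of w] by (simp add: ho_comp)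
    then show ?case
      using sq[of "ho_class C W (Cod C w) (Dom C w) [Bwd w]" "Cod C w" "Dom C w"
          "ho_class C W (Dom C w) b p" b]
        inv[OF ho_inverse[of w]] nat[of w] zz_bwd zigzag_bwd[of w] zigzag_fwd[of w] by simp
  qed
  then have "Comp D (\<theta> (Cod (Ho C W) f)) (farr G f) = Comp D (farr H f) (\<theta> (Dom (Ho C W) f))"
    if "f \<in> Arr (Ho C W)" for f
    using that by (auto elim!: Ho_arrE)
  then show ?thesis using \<theta> by (simp add: nat_trans_def)
qed

end

text \<open>The representative of the class \<open>P\<close> is chosen arbitrarily; by \<open>zigzag_eq_map\<close> the result does not
  depend on it when \<open>F\<close> maps \<open>W\<close> into \<open>W'\<close>.\<close>

definition ho_map ::
  "('o, 'm) cat \<Rightarrow> 'm set \<Rightarrow> ('p, 'n) cat \<Rightarrow> 'n set \<Rightarrow> ('o, 'm, 'p, 'n) fnctr \<Rightarrow>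
   ('o, ('o, 'm) ho_arr, 'p, ('p, 'n) ho_arr) fnctr" where
  "ho_map C W D W' F = \<lparr>fobj = fobj F, farr = (\<lambda>(a, P, b).
     ho_class D W' (fobj F a) (fobj F b) (map (map_step (farr F)) (SOME p. p \<in> P)))\<rparr>"

lemma ho_map_fobj [simp]: "fobj (ho_map C W D W' F) a = fobj F a"
  by (simp add: ho_map_def)

locale ho_functor_lift = C: localization C W + D: localization D W'
  for C :: "('o, 'm) cat" and W and D :: "('p, 'n) cat" and W' +
  fixes F :: "('o, 'm, 'p, 'n) fnctr"
  assumes F: "is_functor C D F"
    and F_weq: "w \<in> W \<Longrightarrow> farr F w \<in> W'"
begin

lemma zigzag_map:
  "zigzag C W a p b \<Longrightarrow> zigzag D W' (fobj F a) (map (map_step (farr F)) p) (fobj F b)"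
proof (induction rule: zigzag.induct)
  case (zz_fwd f p b)
  then show ?case
    using zigzag.zz_fwd[of "farr F f" D W' "map (map_step (farr F)) p" "fobj F b"]
    by (simp add: functor_simps[OF F])
next
  case (zz_bwd f p b)
  then show ?case
    using zigzag.zz_bwd[of "farr F f" W' D "map (map_step (farr F)) p" "fobj F b"]
    by (simp add: functor_simps[OF F] F_weq)
qed (auto intro: zigzag.intros simp: functor_simps[OF F])

lemma zigzag_step_map:
  "zigzag_step C W s t \<Longrightarrow>
    zigzag_step D W' (map (map_step (farr F)) s) (map (map_step (farr F)) t)"
  by (induction rule: zigzag_step.induct)
    (auto simp: functor_simps[OF F] F_weq intro!: zigzag_step.intros)

lemma zigzag_eq_map:
  "zigzag_eq C W a b p q \<Longrightarrow> zigzag_eq D W' (fobj F a) (fobj F b)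
     (map (map_step (farr F)) p) (map (map_step (farr F)) q)"
proof (induction rule: zigzag_eq.induct)
  case (ze_step s t p q)
  then show ?case
    using zigzag_eq.ze_step[OF zigzag_step_map[OF ze_step(1)]] zigzag_map by fastforce
qed (auto intro: zigzag_eq.intros zigzag_map)

lemma ho_map_class:
  assumes "zigzag C W a p b"
  shows "farr (ho_map C W D W' F) (ho_class C W a b p) =
    ho_class D W' (fobj F a) (fobj F b) (map (map_step (farr F)) p)"
proof -
  have "zigzag_eq C W a b p (SOME q. zigzag_eq C W a b p q)"
    using assms by (meson someI zigzag_eq.ze_refl)
  then have "ho_class D W' (fobj F a) (fobj F b)
      (map (map_step (farr F)) (SOME q. zigzag_eq C W a b p q)) =
    ho_class D W' (fobj F a) (fobj F b) (map (map_step (farr F)) p)"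
    using ho_class_eq zigzag_eq_map by metis
  then show ?thesis by (simp add: ho_map_def) (simp add: ho_class_def)
qed

lemma ho_map_is_functor: "is_functor (Ho C W) (Ho D W') (ho_map C W D W' F)"
  unfolding is_functor_def
proof (intro conjI ballI impI)
  fix f assume "f \<in> Arr (Ho C W)"
  then obtain a b p where p: "f = ho_class C W a b p" "zigzag C W a p b" by (rule Ho_arrE)
  show "farr (ho_map C W D W' F) f \<in> hom (Ho D W') (fobj (ho_map C W D W' F) (Dom (Ho C W) f))
      (fobj (ho_map C W D W' F) (Cod (Ho C W) f))"
    using p zigzag_map[OF p(2)] by (simp add: ho_map_class)
  fix g assume "g \<in> Arr (Ho C W)" "Cod (Ho C W) f = Dom (Ho C W) g"
  then obtain c q where q: "g = ho_class C W b c q" "zigzag C W b q c"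
    using p by (auto elim!: Ho_arrE)
  then show "farr (ho_map C W D W' F) (Comp (Ho C W) g f) =
    Comp (Ho D W') (farr (ho_map C W D W' F) g) (farr (ho_map C W D W' F) f)"
    using p zigzag_append[OF p(2) q(2)] zigzag_map by (simp add: ho_comp ho_map_class)
qed (auto simp: functor_simps[OF F] ho_map_class zigzag.intros)

lemma ho_map_arr:
  assumes "f \<in> Arr C"
  shows "farr (ho_map C W D W' F) (farr (ho_functor C W) f) =
     farr (ho_functor D W') (farr F f)"
  using assms C.zigzag_fwd[OF assms] by (simp add: ho_map_class functor_simps[OF F])

end

section \<open>Derived functors of a deformable adjunction\<close>

lemma (in cat) inverse_square:
  assumes "inverse_arrows C p p'" "inverse_arrows C r r'" "x \<in> Arr C" "y \<in> Arr C"
    "Dom C x = Dom C p" "Cod C x = Dom C r" "Dom C y = Cod C p" "Cod C y = Cod C r"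
    "Comp C r x = Comp C y p"
  shows "Comp C x p' = Comp C r' y"
proof -
  have a: "p \<in> Arr C" "p' \<in> Arr C" "Dom C p' = Cod C p" "Cod C p' = Dom C p"
    "Comp C p p' = Id C (Cod C p)" "r \<in> Arr C" "r' \<in> Arr C" "Dom C r' = Cod C r" "Cod C r' = Dom C r"
    "Comp C r' r = Id C (Dom C r)"
    using assms(1,2) by (auto simp: inverse_arrows_def)
  have "Comp C x p' = Comp C (Comp C r' r) (Comp C x p')"
    using a assms(3-8) by simp
  also have "\<dots> = Comp C r' (Comp C (Comp C r x) p')"
    using a(1-4,6-9) assms(3-8) by (simp add: assoc)
  also have "\<dots> = Comp C r' (Comp C y (Comp C p p'))"
    unfolding assms(9) using a(1-4,6-9) assms(3-8) by (simp add: assoc)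
  finally show ?thesis using a assms(3-8) by simp
qed

lemma adjunction_simps:
  assumes "adjunction C D L R \<eta>"
  shows "is_functor C D L" "is_functor D C R"
    and "a \<in> Obj C \<Longrightarrow> \<eta> a \<in> Arr C" "a \<in> Obj C \<Longrightarrow> Dom C (\<eta> a) = a"
    and "a \<in> Obj C \<Longrightarrow> Cod C (\<eta> a) = fobj R (fobj L a)"
    and "f \<in> Arr C \<Longrightarrow> Comp C (\<eta> (Cod C f)) f = Comp C (farr R (farr L f)) (\<eta> (Dom C f))"
  using assms by (auto simp: adjunction_def nat_trans_def)

lemma adjunction_transpose:
  assumes "adjunction C D L R \<eta>" "a \<in> Obj C" "b \<in> Obj D" "f \<in> hom C a (fobj R b)"
  obtains g where "g \<in> hom D (fobj L a) b" "Comp C (farr R g) (\<eta> a) = f"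
  using assms unfolding adjunction_def by blast

lemma adjunction_unique:
  assumes "adjunction C D L R \<eta>" "category C" "a \<in> Obj C" "b \<in> Obj D"
    "g \<in> hom D (fobj L a) b" "h \<in> hom D (fobj L a) b"
    "Comp C (farr R g) (\<eta> a) = Comp C (farr R h) (\<eta> a)"
  shows "g = h"
proof -
  interpret cat C by standard (rule assms)
  have "Comp C (farr R g) (\<eta> a) \<in> hom C a (fobj R b)"
    using assms functor_simps[OF adjunction_simps(2)[OF assms(1)]] adjunction_simps[OF assms(1)]
    by simp
  then have "\<exists>!k. k \<in> hom D (fobj L a) b \<and> Comp C (farr R k) (\<eta> a) = Comp C (farr R g) (\<eta> a)"
    using assms(1,3,4) unfolding adjunction_def by blast
  then show ?thesis using assms by metis
qed

text \<open>The replacement \<open>Q\<close> deforms \<open>L\<close> to a functor that preserves weak equivalences, although \<open>L\<close> itself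
  need not. On \<open>R\<close> no deformation is performed, since it preserves weak equivalences.\<close>

locale deformable_adjunction = C: localization C W + D: localization D W'
  for C :: "('o, 'm) cat" and W and D :: "('p, 'n) cat" and W' +
  fixes L R \<eta> Q q
  assumes adj: "adjunction C D L R \<eta>"
    and two_three: "two_out_of_three C W" "two_out_of_three D W'"
    and R_weq: "g \<in> Arr D \<Longrightarrow> farr R g \<in> W \<longleftrightarrow> g \<in> W'"
    and Q: "is_functor C C Q"
    and q: "nat_trans C C Q id_functor q"
    and q_weq: "a \<in> Obj C \<Longrightarrow> q a \<in> W"
    and unit_weq: "a \<in> Obj C \<Longrightarrow> \<eta> (fobj Q a) \<in> W"
begin

abbreviation \<gamma> where "\<gamma> \<equiv> farr (ho_functor C W)"
abbreviation \<delta> where "\<delta> \<equiv> farr (ho_functor D W')"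
abbreviation LQ where "LQ \<equiv> comp_functor L Q"
definition q_inv where "q_inv a = ho_class C W a (fobj Q a) [Bwd (q a)]"

declare ho_functor_simps(2) [simp del]

lemmas L_simps [simp] = functor_simps[OF adjunction_simps(1)[OF adj]]
lemmas R_simps [simp] = functor_simps[OF adjunction_simps(2)[OF adj]]
lemmas Q_simps [simp] = functor_simps[OF Q]
lemmas \<gamma>_simps [simp] = functor_simps[OF C.ho_functor_is_functor, simplified]
lemmas \<delta>_simps [simp] = functor_simps[OF D.ho_functor_is_functor, simplified]
lemmas unit_simps [simp] = adjunction_simps(3-5)[OF adj]
lemmas unit_nat = adjunction_simps(6)[OF adj]

lemma q_simps [simp]: "a \<in> Obj C \<Longrightarrow> q a \<in> Arr C" "a \<in> Obj C \<Longrightarrow> Dom C (q a) = fobj Q a"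
    "a \<in> Obj C \<Longrightarrow> Cod C (q a) = a"
  and q_nat: "f \<in> Arr C \<Longrightarrow> Comp C (q (Cod C f)) (farr Q f) = Comp C f (q (Dom C f))"
  using q by (auto simp: nat_trans_def)

lemma C_comp: "f \<in> W \<Longrightarrow> g \<in> W \<Longrightarrow> Cod C f = Dom C g \<Longrightarrow> Comp C g f \<in> W"
  by (rule two_out_of_threeD(1)[OF two_three(1)]) (use C.W_arr in auto)

lemma C_left: "f \<in> Arr C \<Longrightarrow> g \<in> W \<Longrightarrow> Cod C f = Dom C g \<Longrightarrow> Comp C g f \<in> W \<Longrightarrow> f \<in> W"
  by (rule two_out_of_threeD(3)[OF two_three(1)]) (use C.W_arr in auto)

lemma C_right: "f \<in> W \<Longrightarrow> g \<in> Arr C \<Longrightarrow> Cod C f = Dom C g \<Longrightarrow> Comp C g f \<in> W \<Longrightarrow> g \<in> W"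
  by (rule two_out_of_threeD(2)[OF two_three(1)]) (use C.W_arr in auto)

lemma Q_weq:
  assumes "f \<in> W" shows "farr Q f \<in> W"
proof -
  have f: "f \<in> Arr C" using assms C.W_arr by auto
  have "Comp C f (q (Dom C f)) \<in> W" using f by (intro C_comp q_weq assms) simp_all
  then show ?thesis
    using C_left[of "farr Q f" "q (Cod C f)"] f by (simp add: q_nat q_weq)
qed

text \<open>Naturality of the unit turns a weak equivalence \<open>f\<close> into a weak equivalence \<open>R (L f)\<close>, and \<open>R\<close>
  reflects weak equivalences. This takes the place of Ken Brown's lemma.\<close>

lemma L_weq:
  assumes "f \<in> W" "\<eta> (Dom C f) \<in> W" "\<eta> (Cod C f) \<in> W" shows "farr L f \<in> W'"
proof -
  have f: "f \<in> Arr C" using assms C.W_arr by auto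
  have "Comp C (\<eta> (Cod C f)) f \<in> W" using f by (intro C_comp assms) simp_all
  then have "farr R (farr L f) \<in> W"
    using C_right[OF assms(2)] f by (simp add: unit_nat)
  then show ?thesis using R_weq f by simp
qed

lemma LQ_weq: "f \<in> W \<Longrightarrow> farr LQ f \<in> W'"
  using Q_weq[of f] C.W_arr by (auto intro!: L_weq simp: unit_weq subset_iff)

sublocale LQ: ho_functor_lift C W D W' LQ
  by standard (auto simp: LQ_weq[simplified] intro: comp_functor_is_functor Q adjunction_simps(1)[OF adj])

sublocale R: ho_functor_lift D W' C W R
  by standard (use R_weq D.W_arr adj in \<open>auto simp: adjunction_def\<close>)

lemma q_inv_inverse: "a \<in> Obj C \<Longrightarrow> inverse_arrows (Ho C W) (\<gamma> (q a)) (q_inv a)"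
  using C.ho_inverse[OF q_weq] by (simp add: q_inv_def)

lemma q_inv_simps [simp]:
  assumes "a \<in> Obj C"
  shows "q_inv a \<in> Arr (Ho C W)" "Dom (Ho C W) (q_inv a) = a" "Cod (Ho C W) (q_inv a) = fobj Q a"
    and "Comp (Ho C W) (\<gamma> (q a)) (q_inv a) = Id (Ho C W) a"
  using q_inv_inverse[OF assms] assms by (auto simp: inverse_arrows_def)

lemma q_inv_nat:
  assumes "f \<in> Arr C"
  shows "Comp (Ho C W) (\<gamma> (farr Q f)) (q_inv (Dom C f)) = Comp (Ho C W) (q_inv (Cod C f)) (\<gamma> f)"
  using assms
  by (intro C.ho.inverse_square[OF q_inv_inverse q_inv_inverse])
    (simp_all add: q_nat \<gamma>_simps(6)[symmetric] del: \<gamma>_simps(6))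

text \<open>For a functor \<open>G\<close> on the localization and \<open>\<zeta> : G \<rightarrow> L\<close>, the factorization of \<open>\<zeta>\<close> through \<open>L \<circ> Q\<close> is
  forced: naturality with respect to \<open>q a\<close> reduces it to its values at the objects \<open>Q a\<close>, and
  there the comparison \<open>L (Q (Q a)) \<rightarrow> L (Q a)\<close> is invertible.\<close>

lemma left_derived:
  "total_left_derived C W D W' L (ho_map C W D W' LQ) (\<lambda>a. \<delta> (farr L (q a)))"
  unfolding total_left_derived_def
proof (intro conjI allI impI)
  show "is_functor (Ho C W) (Ho D W') (ho_map C W D W' LQ)" by (rule LQ.ho_map_is_functor)
  show "nat_trans C (Ho D W') (comp_functor (ho_map C W D W' LQ) (ho_functor C W))
     (comp_functor (ho_functor D W') L) (\<lambda>a. \<delta> (farr L (q a)))"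
    by (simp add: nat_trans_def LQ.ho_map_arr q_nat \<delta>_simps(6)[symmetric] L_simps(6)[symmetric]
      del: \<delta>_simps(6) L_simps(6))
next
  fix G \<zeta>
  assume *: "is_functor (Ho C W) (Ho D W') G \<and>
    nat_trans C (Ho D W') (comp_functor G (ho_functor C W)) (comp_functor (ho_functor D W') L) \<zeta>"
  then have Gf: "is_functor (Ho C W) (Ho D W') G" by simp
  note G [simp] = functor_simps[OF Gf, simplified]
  have \<zeta> [simp]: "\<zeta> a \<in> Arr (Ho D W')" "Dom (Ho D W') (\<zeta> a) = fobj G a"
    "Cod (Ho D W') (\<zeta> a) = fobj L a" if "a \<in> Obj C" for a
    using * that by (auto simp: nat_trans_def)
  have \<zeta>_nat: "Comp (Ho D W') (\<zeta> (Cod C f)) (farr G (\<gamma> f)) = Comp (Ho D W') (\<delta> (farr L f)) (\<zeta> (Dom C f))"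
    if "f \<in> Arr C" for f
    using * that by (auto simp: nat_trans_def)
  define \<theta> where "\<theta> a = Comp (Ho D W') (\<zeta> (fobj Q a)) (farr G (q_inv a))" for a
  have \<theta> [simp]: "\<theta> a \<in> Arr (Ho D W')" "Dom (Ho D W') (\<theta> a) = fobj G a"
    "Cod (Ho D W') (\<theta> a) = fobj L (fobj Q a)" if "a \<in> Obj C" for a
    using that by (simp_all add: \<theta>_def)
  have nat\<theta>: "nat_trans (Ho C W) (Ho D W') G (ho_map C W D W' LQ) \<theta>"
  proof (rule C.ho_nat_trans[OF D.category_Ho Gf LQ.ho_map_is_functor])
    have "Comp (Ho D W') (\<theta> (Cod C f)) (farr G (\<gamma> f)) =
        Comp (Ho D W') (\<delta> (farr L (farr Q f))) (\<theta> (Dom C f))" if f: "f \<in> Arr C" for f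
    proof -
      have "Comp (Ho D W') (\<theta> (Cod C f)) (farr G (\<gamma> f)) =
          Comp (Ho D W') (\<zeta> (fobj Q (Cod C f))) (farr G (Comp (Ho C W) (q_inv (Cod C f)) (\<gamma> f)))"
        using f by (simp add: \<theta>_def D.ho.assoc)
      also have "\<dots> = Comp (Ho D W') (Comp (Ho D W') (\<zeta> (Cod C (farr Q f))) (farr G (\<gamma> (farr Q f))))
          (farr G (q_inv (Dom C f)))"
        unfolding q_inv_nat[OF f, symmetric] using f by (simp add: D.ho.assoc)
      also have "\<dots> = Comp (Ho D W') (\<delta> (farr L (farr Q f))) (\<theta> (Dom C f))"
        using f by (simp only: \<zeta>_nat[OF Q_simps(2)[OF f]]) (simp add: \<theta>_def D.ho.assoc)
      finally show ?thesis .
    qed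
    then show "nat_trans C (Ho D W') (comp_functor G (ho_functor C W))
        (comp_functor (ho_map C W D W' LQ) (ho_functor C W)) \<theta>"
      by (simp add: nat_trans_def LQ.ho_map_arr)
  qed
  have \<epsilon>\<theta>: "Comp (Ho D W') (\<delta> (farr L (q a))) (\<theta> a) = \<zeta> a" if a: "a \<in> Obj C" for a
  proof -
    have "Comp (Ho D W') (\<delta> (farr L (q a))) (\<theta> a) =
        Comp (Ho D W') (Comp (Ho D W') (\<delta> (farr L (q a))) (\<zeta> (Dom C (q a)))) (farr G (q_inv a))"
      using a by (simp add: \<theta>_def D.ho.assoc)
    also have "\<dots> = Comp (Ho D W') (\<zeta> a) (farr G (Comp (Ho C W) (\<gamma> (q a)) (q_inv a)))"
      unfolding \<zeta>_nat[OF q_simps(1)[OF a], symmetric] using a by (simp add: D.ho.assoc del: q_inv_simps(4))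
    finally show ?thesis using a G(5)[OF a] D.ho.id_right[of "\<zeta> a" "fobj G a"]
      by (simp del: G(5))
  qed
  have unique: "\<theta>' a = \<theta> a"
    if \<theta>': "nat_trans (Ho C W) (Ho D W') G (ho_map C W D W' LQ) \<theta>'"
      "\<forall>a\<in>Obj C. Comp (Ho D W') (\<delta> (farr L (q a))) (\<theta>' a) = \<zeta> a" and a: "a \<in> Obj C" for \<theta>' a
  proof -
    have t: "\<theta>' a \<in> hom (Ho D W') (fobj G a) (fobj L (fobj Q a))" if "a \<in> Obj C" for a
      using \<theta>' that by (simp add: nat_trans_def)
    have "farr L (q (fobj Q a)) \<in> W'"
      using a by (intro L_weq) (simp_all add: q_weq unit_weq)
    note i = D.ho_iso[OF this]
    have "Comp (Ho D W') (\<delta> (farr L (q (fobj Q a)))) (\<theta>' (fobj Q a)) =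
        Comp (Ho D W') (\<delta> (farr L (q (fobj Q a)))) (\<theta> (fobj Q a))"
      using \<theta>'(2) \<epsilon>\<theta> Q_simps(1)[OF a] by metis
    then have "\<theta>' (fobj Q a) = \<theta> (fobj Q a)"
      using a t[OF Q_simps(1)[OF a]] by - (rule D.ho.iso_cancel_left[OF i], simp_all)
    moreover have "Comp (Ho D W') (\<sigma> a) (farr G (\<gamma> (q a))) =
        Comp (Ho D W') (farr (ho_map C W D W' LQ) (\<gamma> (q a))) (\<sigma> (fobj Q a))"
      if "nat_trans (Ho C W) (Ho D W') G (ho_map C W D W' LQ) \<sigma>" for \<sigma>
    proof -
      have "\<gamma> (q a) \<in> Arr (Ho C W)" "Dom (Ho C W) (\<gamma> (q a)) = fobj Q a" "Cod (Ho C W) (\<gamma> (q a)) = a"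
        using a by simp_all
      then show ?thesis using that unfolding nat_trans_def by metis
    qed
    ultimately have "Comp (Ho D W') (\<theta>' a) (farr G (\<gamma> (q a))) = Comp (Ho D W') (\<theta> a) (farr G (\<gamma> (q a)))"
      using nat\<theta> \<theta>'(1) by simp
    then show ?thesis
      using a t[OF a] functor_iso[OF C.category_Ho Gf C.ho_iso[OF q_weq[OF a]]]
      by - (rule D.ho.iso_cancel_right[of "farr G (\<gamma> (q a))"], simp_all)
  qed
  show "\<exists>\<theta>. nat_trans (Ho C W) (Ho D W') G (ho_map C W D W' LQ) \<theta> \<and>
      (\<forall>a\<in>Obj C. Comp (Ho D W') (\<delta> (farr L (q a))) (\<theta> a) = \<zeta> a) \<and>
      (\<forall>\<theta>'. nat_trans (Ho C W) (Ho D W') G (ho_map C W D W' LQ) \<theta>' \<and>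
         (\<forall>a\<in>Obj C. Comp (Ho D W') (\<delta> (farr L (q a))) (\<theta>' a) = \<zeta> a) \<longrightarrow>
         (\<forall>a\<in>Obj C. \<theta>' a = \<theta> a))"
    using nat\<theta> \<epsilon>\<theta> unique by blast
qed

lemma right_derived:
  "total_right_derived D W' C W R (ho_map D W' C W R) (\<lambda>b. Id (Ho C W) (fobj R b))"
  unfolding total_right_derived_def
proof (intro conjI allI impI)
  show "is_functor (Ho D W') (Ho C W) (ho_map D W' C W R)" by (rule R.ho_map_is_functor)
  have "Id (Ho C W) (fobj R b) \<in> hom (Ho C W) (fobj R b) (fobj R b)" if "b \<in> Obj D" for b
    using that C.ho.id_arr[of "fobj R b"] by simp
  then show "nat_trans D (Ho C W) (comp_functor (ho_functor C W) R)
     (comp_functor (ho_map D W' C W R) (ho_functor D W')) (\<lambda>b. Id (Ho C W) (fobj R b))"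
    using C.ho.id_left[of "\<gamma> (farr R _)"] C.ho.id_right[of "\<gamma> (farr R _)"]
    by (simp add: nat_trans_def R.ho_map_arr)
next
  fix G \<zeta>
  assume *: "is_functor (Ho D W') (Ho C W) G \<and>
    nat_trans D (Ho C W) (comp_functor (ho_functor C W) R) (comp_functor G (ho_functor D W')) \<zeta>"
  have "nat_trans D (Ho C W) (comp_functor (ho_map D W' C W R) (ho_functor D W'))
      (comp_functor G (ho_functor D W')) \<zeta>"
    using * by (auto simp: nat_trans_def R.ho_map_arr)
  then have "nat_trans (Ho D W') (Ho C W) (ho_map D W' C W R) G \<zeta>"
    using * by (intro D.ho_nat_trans[OF C.category_Ho R.ho_map_is_functor]) auto
  moreover have "Comp (Ho C W) (\<theta> b) (Id (Ho C W) (fobj R b)) = \<theta> b"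
    if "nat_trans (Ho D W') (Ho C W) (ho_map D W' C W R) G \<theta>" "b \<in> Obj D" for \<theta> b
    using that C.ho.id_right[of "\<theta> b" "fobj R b"] by (auto simp: nat_trans_def)
  ultimately show "\<exists>\<theta>. nat_trans (Ho D W') (Ho C W) (ho_map D W' C W R) G \<theta> \<and>
      (\<forall>a\<in>Obj D. Comp (Ho C W) (\<theta> a) (Id (Ho C W) (fobj R a)) = \<zeta> a) \<and>
      (\<forall>\<theta>'. nat_trans (Ho D W') (Ho C W) (ho_map D W' C W R) G \<theta>' \<and>
         (\<forall>a\<in>Obj D. Comp (Ho C W) (\<theta>' a) (Id (Ho C W) (fobj R a)) = \<zeta> a) \<longrightarrow>
         (\<forall>a\<in>Obj D. \<theta>' a = \<theta> a))"
    by (intro exI[of _ \<zeta>]) auto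
qed

text \<open>The isomorphism at \<open>a\<close> is the zigzag \<open>a \<leftarrow> Q a \<rightarrow> R (L (Q a))\<close>.\<close>

lemma unit_iso:
  "naturally_isomorphic (Ho C W) (Ho C W) id_functor
     (comp_functor (ho_map D W' C W R) (ho_map C W D W' LQ))"
proof -
  define \<theta> where "\<theta> a = Comp (Ho C W) (\<gamma> (\<eta> (fobj Q a))) (q_inv a)" for a
  have "is_functor (Ho C W) (Ho C W) id_functor"
    by (simp add: is_functor_def)
  moreover have "is_functor (Ho C W) (Ho C W) (comp_functor (ho_map D W' C W R) (ho_map C W D W' LQ))"
    by (rule comp_functor_is_functor[OF LQ.ho_map_is_functor R.ho_map_is_functor])
  moreover have "nat_trans C (Ho C W) (comp_functor id_functor (ho_functor C W))
     (comp_functor (comp_functor (ho_map D W' C W R) (ho_map C W D W' LQ)) (ho_functor C W)) \<theta>"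
  proof -
    have "Comp (Ho C W) (\<theta> (Cod C f)) (\<gamma> f) =
        Comp (Ho C W) (\<gamma> (farr R (farr L (farr Q f)))) (\<theta> (Dom C f))" if f: "f \<in> Arr C" for f
    proof -
      have "Comp (Ho C W) (\<theta> (Cod C f)) (\<gamma> f) =
          Comp (Ho C W) (\<gamma> (\<eta> (fobj Q (Cod C f)))) (Comp (Ho C W) (q_inv (Cod C f)) (\<gamma> f))"
        using f by (simp add: \<theta>_def C.ho.assoc)
      also have "\<dots> = Comp (Ho C W) (\<gamma> (Comp C (\<eta> (Cod C (farr Q f))) (farr Q f))) (q_inv (Dom C f))"
        unfolding q_inv_nat[OF f, symmetric] using f by (simp add: C.ho.assoc)
      also have "\<dots> = Comp (Ho C W) (\<gamma> (farr R (farr L (farr Q f)))) (\<theta> (Dom C f))"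
        using f by (simp only: unit_nat[OF Q_simps(2)[OF f]]) (simp add: \<theta>_def C.ho.assoc)
      finally show ?thesis .
    qed
    then show ?thesis by (simp add: nat_trans_def LQ.ho_map_arr R.ho_map_arr \<theta>_def)
  qed
  ultimately have "nat_trans (Ho C W) (Ho C W) id_functor
     (comp_functor (ho_map D W' C W R) (ho_map C W D W' LQ)) \<theta>"
    by (intro C.ho_nat_trans[OF C.category_Ho])
  moreover have "iso_arrow (Ho C W) (\<theta> a)" if "a \<in> Obj C" for a
    unfolding \<theta>_def using that C.ho_iso[OF unit_weq[OF that]] C.ho.iso_inverse[OF q_inv_inverse[OF that]]
    by (intro C.ho.iso_comp) simp_all
  ultimately show ?thesis unfolding naturally_isomorphic_def by (intro exI[of _ \<theta>]) simp
qed

text \<open>The isomorphism at \<open>b\<close> is the transpose \<open>L (Q (R b)) \<rightarrow> b\<close> of \<open>q (R b)\<close>. Applying \<open>R\<close> and composing with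
  the unit at \<open>Q (R b)\<close> gives back \<open>q (R b)\<close>, so the transpose is a weak equivalence.\<close>

lemma counit_iso:
  "naturally_isomorphic (Ho D W') (Ho D W')
     (comp_functor (ho_map C W D W' LQ) (ho_map D W' C W R)) id_functor"
proof -
  have "\<exists>k. k \<in> hom D (fobj L (fobj Q (fobj R b))) b \<and> Comp C (farr R k) (\<eta> (fobj Q (fobj R b))) = q (fobj R b)"
    if "b \<in> Obj D" for b
    using that adjunction_transpose[OF adj, of "fobj Q (fobj R b)" b "q (fobj R b)"] by (metis R_simps(1) Q_simps(1) q_simps in_hom)
  then obtain \<kappa> where \<kappa>: "\<kappa> b \<in> hom D (fobj L (fobj Q (fobj R b))) b"
    "Comp C (farr R (\<kappa> b)) (\<eta> (fobj Q (fobj R b))) = q (fobj R b)" if "b \<in> Obj D" for b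
    by metis
  have \<kappa>_weq: "\<kappa> b \<in> W'" if b: "b \<in> Obj D" for b
    using C_right[OF unit_weq[of "fobj R b"], of "farr R (\<kappa> b)"] \<kappa>[OF b] b R_weq q_weq by simp
  have nat: "Comp D (\<kappa> (Cod D g)) (farr L (farr Q (farr R g))) = Comp D g (\<kappa> (Dom D g))"
    if g: "g \<in> Arr D" for g
  proof (rule adjunction_unique[OF adj C.category])
    let ?a = "fobj Q (fobj R (Dom D g))"
    note k = \<kappa>[OF D.dom_obj[OF g]] \<kappa>[OF D.cod_obj[OF g]]
    have "Comp C (farr R (Comp D (\<kappa> (Cod D g)) (farr L (farr Q (farr R g))))) (\<eta> ?a) =
        Comp C (farr R (\<kappa> (Cod D g))) (Comp C (\<eta> (Cod C (farr Q (farr R g)))) (farr Q (farr R g)))"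
      unfolding unit_nat[OF Q_simps(2)[OF R_simps(2)[OF g]]] using g k by (simp add: C.assoc)
    also have "\<dots> = Comp C (q (fobj R (Cod D g))) (farr Q (farr R g))"
      unfolding k(4)[symmetric] using g k(1,3) by (simp add: C.assoc)
    also have "\<dots> = Comp C (farr R g) (q (fobj R (Dom D g)))"
      using q_nat[OF R_simps(2)[OF g]] g by simp
    also have "\<dots> = Comp C (farr R (Comp D g (\<kappa> (Dom D g)))) (\<eta> ?a)"
      unfolding k(2)[symmetric] using g k(1,3) by (simp add: C.assoc)
    finally show "Comp C (farr R (Comp D (\<kappa> (Cod D g)) (farr L (farr Q (farr R g))))) (\<eta> ?a) =
        Comp C (farr R (Comp D g (\<kappa> (Dom D g)))) (\<eta> ?a)" .
  qed (use \<kappa>[of "Dom D g"] \<kappa>[of "Cod D g"] g in simp_all)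
  let ?\<theta> = "\<lambda>b. \<delta> (\<kappa> b)"
  have "is_functor (Ho D W') (Ho D W') id_functor"
    by (simp add: is_functor_def)
  moreover have "is_functor (Ho D W') (Ho D W') (comp_functor (ho_map C W D W' LQ) (ho_map D W' C W R))"
    by (rule comp_functor_is_functor[OF R.ho_map_is_functor LQ.ho_map_is_functor])
  moreover have "nat_trans D (Ho D W')
     (comp_functor (comp_functor (ho_map C W D W' LQ) (ho_map D W' C W R)) (ho_functor D W'))
     (comp_functor id_functor (ho_functor D W')) ?\<theta>"
  proof -
    have "Comp (Ho D W') (\<delta> (\<kappa> (Cod D g))) (\<delta> (farr L (farr Q (farr R g)))) =
        Comp (Ho D W') (\<delta> g) (\<delta> (\<kappa> (Dom D g)))" if g: "g \<in> Arr D" for g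
    proof -
      note k = \<kappa>(1)[OF D.dom_obj[OF g]] \<kappa>(1)[OF D.cod_obj[OF g]]
      have "\<delta> (Comp D (\<kappa> (Cod D g)) (farr L (farr Q (farr R g)))) = \<delta> (Comp D g (\<kappa> (Dom D g)))"
        by (simp only: nat[OF g])
      then show ?thesis using g k by simp
    qed
    then show ?thesis using \<kappa>(1) by (simp add: nat_trans_def LQ.ho_map_arr R.ho_map_arr)
  qed
  ultimately have "nat_trans (Ho D W') (Ho D W')
     (comp_functor (ho_map C W D W' LQ) (ho_map D W' C W R)) id_functor ?\<theta>"
    by (intro D.ho_nat_trans[OF D.category_Ho])
  moreover have "iso_arrow (Ho D W') (?\<theta> b)" if "b \<in> Obj D" for b
    using D.ho_iso[OF \<kappa>_weq[OF that]] .
  ultimately show ?thesis unfolding naturally_isomorphic_def by (intro exI[of _ ?\<theta>]) simp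
qed

end

lemma deformable_quillen_equivalence:
  assumes "quillen_pair C S D S' L R \<eta>"
    and "deformable_adjunction C (weqs S) D (weqs S') L R \<eta> Q q"
  shows "quillen_equivalence C S D S' L R \<eta>"
proof -
  interpret deformable_adjunction C "weqs S" D "weqs S'" L R \<eta> Q q by (rule assms(2))
  show ?thesis
    unfolding quillen_equivalence_def
    using assms(1) left_derived right_derived unit_iso counit_iso by blast
qed

section \<open>Lifting properties and pushouts\<close>

definition llp :: "('o, 'm) cat \<Rightarrow> 'm set \<Rightarrow> 'm set" where
  "llp C K = {i \<in> Arr C. \<forall>p\<in>K. lifts C i p}"

definition rlp :: "('o, 'm) cat \<Rightarrow> 'm set \<Rightarrow> 'm set" where
  "rlp C K = {p \<in> Arr C. \<forall>i\<in>K. lifts C i p}"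

lemma cofs_llp: "cofs C S = llp C (tfibs S)"
  by (simp add: cofs_def llp_def)

lemma liftE:
  assumes "lifts C i p" "a \<in> hom C (Dom C i) (Dom C p)" "b \<in> hom C (Cod C i) (Cod C p)"
    "Comp C p a = Comp C b i"
  obtains h where "h \<in> hom C (Cod C i) (Dom C p)" "Comp C h i = a" "Comp C p h = b"
  using assms unfolding lifts_def by blast

lemma pushout_sym: "is_pushout C f g p q \<Longrightarrow> is_pushout C g f q p"
  unfolding is_pushout_def by (metis (no_types, lifting))

lemma pushout_simps:
  assumes "is_pushout C f g p q"
  shows "f \<in> Arr C" "g \<in> Arr C" "p \<in> Arr C" "q \<in> Arr C" "Dom C f = Dom C g" "Dom C p = Cod C f"
    "Dom C q = Cod C g" "Cod C p = Cod C q" "Comp C p f = Comp C q g"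
  using assms by (simp_all add: is_pushout_def)

lemma pushout_arrow:
  assumes "is_pushout C f g p q" "a \<in> hom C (Cod C f) x" "b \<in> hom C (Cod C g) x"
    "Comp C a f = Comp C b g"
  obtains h where "h \<in> hom C (Cod C p) x" "Comp C h p = a" "Comp C h q = b"
  using assms unfolding is_pushout_def by blast

lemma pushout_unique:
  assumes "category C" "is_pushout C f g p q" "h \<in> hom C (Cod C p) x" "k \<in> hom C (Cod C p) x"
    "Comp C h p = Comp C k p" "Comp C h q = Comp C k q"
  shows "h = k"
proof -
  interpret cat C by standard (rule assms)
  note P = pushout_simps[OF assms(2)]
  have "Comp C h p \<in> hom C (Cod C f) x" "Comp C h q \<in> hom C (Cod C g) x"
    "Comp C (Comp C h p) f = Comp C (Comp C h q) g"
    using assms(3) P by (simp_all add: assoc)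
  then have "\<exists>!l. l \<in> hom C (Cod C p) x \<and> Comp C l p = Comp C h p \<and> Comp C l q = Comp C h q"
    using assms(2) unfolding is_pushout_def by blast
  then show ?thesis using assms(3-6) by metis
qed

lemma pushoutI:
  assumes "f \<in> Arr C" "g \<in> Arr C" "p \<in> Arr C" "q \<in> Arr C" "Dom C f = Dom C g" "Dom C p = Cod C f"
    "Dom C q = Cod C g" "Cod C p = Cod C q" "Comp C p f = Comp C q g"
    and "\<And>x a b. a \<in> hom C (Cod C f) x \<Longrightarrow> b \<in> hom C (Cod C g) x \<Longrightarrow> Comp C a f = Comp C b g \<Longrightarrow>
      \<exists>h. h \<in> hom C (Cod C p) x \<and> Comp C h p = a \<and> Comp C h q = b"
    and "\<And>x h k. h \<in> hom C (Cod C p) x \<Longrightarrow> k \<in> hom C (Cod C p) x \<Longrightarrow> Comp C h p = Comp C k p \<Longrightarrow>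
      Comp C h q = Comp C k q \<Longrightarrow> h = k"
  shows "is_pushout C f g p q"
  unfolding is_pushout_def using assms(1-9) assms(10,11) by (smt (verit, ccfv_threshold))

context cat begin

lemma llp_comp:
  assumes "i \<in> llp C K" "j \<in> llp C K" "Cod C i = Dom C j" "K \<subseteq> Arr C"
  shows "Comp C j i \<in> llp C K"
  unfolding llp_def
proof (intro CollectI conjI ballI)
  have A: "i \<in> Arr C" "j \<in> Arr C" using assms by (auto simp: llp_def)
  then show "Comp C j i \<in> Arr C" using assms by simp
  fix p assume p: "p \<in> K"
  then have pA: "p \<in> Arr C" using assms by auto
  show "lifts C (Comp C j i) p"
    unfolding lifts_def
  proof (intro ballI impI)
    fix a b assume ab: "a \<in> hom C (Dom C (Comp C j i)) (Dom C p)"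
      "b \<in> hom C (Cod C (Comp C j i)) (Cod C p)" "Comp C p a = Comp C b (Comp C j i)"
    have "lifts C i p" using assms p by (auto simp: llp_def)
    then obtain h where h: "h \<in> hom C (Cod C i) (Dom C p)" "Comp C h i = a" "Comp C p h = Comp C b j"
      by (rule liftE[of _ _ _ a "Comp C b j"]) (use ab A assms pA in \<open>simp_all add: assoc\<close>)
    have "lifts C j p" using assms p by (auto simp: llp_def)
    then obtain k where k: "k \<in> hom C (Cod C j) (Dom C p)" "Comp C k j = h" "Comp C p k = b"
      by (rule liftE[of _ _ _ h b]) (use ab A assms pA h in \<open>simp_all add: assoc\<close>)
    have "Comp C k (Comp C j i) = a"
      using k h A assms(3) assoc[of i j k] by simp
    then show "\<exists>h\<in>hom C (Cod C (Comp C j i)) (Dom C p). Comp C h (Comp C j i) = a \<and> Comp C p h = b"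
      using k A assms(3) by (intro bexI[of _ k]) simp_all
  qed
qed

lemma llp_pushout:
  assumes "f \<in> llp C K" "is_pushout C f g p q" "K \<subseteq> Arr C"
  shows "q \<in> llp C K"
  unfolding llp_def
proof (intro CollectI conjI ballI)
  note P = pushout_simps[OF assms(2)]
  show "q \<in> Arr C" by (rule P)
  fix t assume t: "t \<in> K"
  then have tA: "t \<in> Arr C" using assms by auto
  show "lifts C q t"
    unfolding lifts_def
  proof (intro ballI impI)
    fix a b assume ab: "a \<in> hom C (Dom C q) (Dom C t)" "b \<in> hom C (Cod C q) (Cod C t)"
      "Comp C t a = Comp C b q"
    have "Comp C t (Comp C a g) = Comp C (Comp C b q) g"
      unfolding ab(3)[symmetric] using ab(1,2) P(1-8) tA by (simp add: assoc)
    then have e: "Comp C t (Comp C a g) = Comp C (Comp C b p) f"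
      using ab(1,2) P tA by (simp add: assoc)
    have "lifts C f t" using assms t by (auto simp: llp_def)
    then obtain h where h: "h \<in> hom C (Cod C f) (Dom C t)" "Comp C h f = Comp C a g"
      "Comp C t h = Comp C b p"
      by (rule liftE[OF _ _ _ e]) (use ab P in simp_all)
    obtain k where k: "k \<in> hom C (Cod C p) (Dom C t)" "Comp C k p = h" "Comp C k q = a"
      by (rule pushout_arrow[OF assms(2) h(1) _ h(2)]) (use ab P in simp_all)
    have "Comp C t k = b"
      by (rule pushout_unique[OF category assms(2), of _ "Cod C t"])
        (use ab h k P tA in \<open>simp_all add: assoc\<close>)
    then show "\<exists>h\<in>hom C (Cod C q) (Dom C t). Comp C h q = a \<and> Comp C t h = b"
      using k P by (intro bexI[of _ k]) simp_all
  qed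
qed

lemma llp_retract:
  assumes "g \<in> llp C K" "retract_of C f g" "K \<subseteq> Arr C"
  shows "f \<in> llp C K"
  unfolding llp_def
proof (intro CollectI conjI ballI)
  obtain s t s' t' where r: "f \<in> Arr C" "g \<in> Arr C" "s \<in> hom C (Dom C f) (Dom C g)"
    "t \<in> hom C (Cod C f) (Cod C g)" "s' \<in> hom C (Dom C g) (Dom C f)" "t' \<in> hom C (Cod C g) (Cod C f)"
    "Comp C g s = Comp C t f" "Comp C f s' = Comp C t' g"
    "Comp C s' s = Id C (Dom C f)" "Comp C t' t = Id C (Cod C f)"
    using assms(2) by (auto simp: retract_of_def simp del: in_hom)
  show "f \<in> Arr C" by (rule r)
  fix p assume p: "p \<in> K"
  then have pA: "p \<in> Arr C" using assms by auto
  show "lifts C f p"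
    unfolding lifts_def
  proof (intro ballI impI)
    fix a b assume ab: "a \<in> hom C (Dom C f) (Dom C p)" "b \<in> hom C (Cod C f) (Cod C p)"
      "Comp C p a = Comp C b f"
    have "Comp C p (Comp C a s') = Comp C (Comp C b f) s'"
      using ab r pA by (simp add: assoc[symmetric])
    then have e: "Comp C p (Comp C a s') = Comp C (Comp C b t') g"
      using ab r pA by (simp add: assoc)
    have "lifts C g p" using assms p by (auto simp: llp_def)
    then obtain h where h: "h \<in> hom C (Cod C g) (Dom C p)" "Comp C h g = Comp C a s'"
      "Comp C p h = Comp C b t'"
      by (rule liftE[OF _ _ _ e]) (use ab r in simp_all)
    have "Comp C (Comp C h t) f = Comp C (Comp C h g) s"
      using h(1) r by (simp add: assoc)
    also have "\<dots> = a"
      unfolding h(2) using r ab by (simp add: assoc)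
    finally have 1: "Comp C (Comp C h t) f = a" .
    have "Comp C p (Comp C h t) = Comp C (Comp C p h) t"
      using h(1) r pA by (simp add: assoc)
    also have "\<dots> = b"
      unfolding h(3) using r ab by (simp add: assoc)
    finally show "\<exists>h\<in>hom C (Cod C f) (Dom C p). Comp C h f = a \<and> Comp C p h = b"
      using 1 h r by (intro bexI[of _ "Comp C h t"]) simp_all
  qed
qed

lemma rlp_retract:
  assumes "g \<in> rlp C K" "retract_of C f g" "K \<subseteq> Arr C"
  shows "f \<in> rlp C K"
  unfolding rlp_def
proof (intro CollectI conjI ballI)
  obtain s t s' t' where r: "f \<in> Arr C" "g \<in> Arr C" "s \<in> hom C (Dom C f) (Dom C g)"
    "t \<in> hom C (Cod C f) (Cod C g)" "s' \<in> hom C (Dom C g) (Dom C f)" "t' \<in> hom C (Cod C g) (Cod C f)"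
    "Comp C g s = Comp C t f" "Comp C f s' = Comp C t' g"
    "Comp C s' s = Id C (Dom C f)" "Comp C t' t = Id C (Cod C f)"
    using assms(2) by (auto simp: retract_of_def simp del: in_hom)
  show "f \<in> Arr C" by (rule r)
  fix i assume i: "i \<in> K"
  then have iA: "i \<in> Arr C" using assms by auto
  show "lifts C i f"
    unfolding lifts_def
  proof (intro ballI impI)
    fix a b assume ab: "a \<in> hom C (Dom C i) (Dom C f)" "b \<in> hom C (Cod C i) (Cod C f)"
      "Comp C f a = Comp C b i"
    have "Comp C (Comp C g s) a = Comp C t (Comp C f a)"
      unfolding r(7) using ab r by (simp add: assoc del: ab(3) r(7))
    then have e: "Comp C g (Comp C s a) = Comp C (Comp C t b) i"
      unfolding ab(3) using ab r(1-6) iA by (simp add: assoc)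
    have "lifts C i g" using assms i by (auto simp: rlp_def)
    then obtain h where h: "h \<in> hom C (Cod C i) (Dom C g)" "Comp C h i = Comp C s a"
      "Comp C g h = Comp C t b"
      by (rule liftE[OF _ _ _ e]) (use ab r in simp_all)
    have "Comp C (Comp C s' h) i = Comp C s' (Comp C s a)"
      unfolding h(2)[symmetric] using h(1) r iA by (simp add: assoc)
    also have "\<dots> = a"
      using r(1-6,9) ab by (simp add: comp_reduce[OF r(9)])
    finally have 1: "Comp C (Comp C s' h) i = a" .
    have "Comp C f (Comp C s' h) = Comp C (Comp C t' g) h"
      unfolding r(8)[symmetric] using h(1) r(1-6) by (simp add: assoc)
    also have "\<dots> = Comp C t' (Comp C t b)"
      unfolding h(3)[symmetric] using h(1) r(1-6) by (simp add: assoc)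
    also have "\<dots> = b"
      using r(1-6,10) ab by (simp add: comp_reduce[OF r(10)])
    finally show "\<exists>h\<in>hom C (Cod C i) (Dom C f). Comp C h i = a \<and> Comp C f h = b"
      using 1 h r by (intro bexI[of _ "Comp C s' h"]) simp_all
  qed
qed

lemma rlp_pullback:
  assumes "f \<in> rlp C K" "is_pullback C f g p q" "K \<subseteq> Arr C"
  shows "q \<in> rlp C K"
  unfolding rlp_def
proof (intro CollectI conjI ballI)
  have P: "f \<in> Arr C" "g \<in> Arr C" "p \<in> Arr C" "q \<in> Arr C" "Cod C f = Cod C g" "Cod C p = Dom C f"
    "Cod C q = Dom C g" "Dom C p = Dom C q" "Comp C f p = Comp C g q"
    using assms(2) by (simp_all add: is_pullback_def)
  show "q \<in> Arr C" by (rule P)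
  fix i assume i: "i \<in> K"
  then have iA: "i \<in> Arr C" using assms by auto
  show "lifts C i q"
    unfolding lifts_def
  proof (intro ballI impI)
    fix a b assume ab: "a \<in> hom C (Dom C i) (Dom C q)" "b \<in> hom C (Cod C i) (Cod C q)"
      "Comp C q a = Comp C b i"
    have "Comp C f (Comp C p a) = Comp C (Comp C g q) a"
      unfolding P(9)[symmetric] using ab P(1-8) by (simp add: assoc)
    then have e: "Comp C f (Comp C p a) = Comp C (Comp C g b) i"
      using ab P(1-8) iA by (simp add: assoc)
    have "lifts C i f" using assms i by (auto simp: rlp_def)
    then obtain h where h: "h \<in> hom C (Cod C i) (Dom C f)" "Comp C h i = Comp C p a"
      "Comp C f h = Comp C g b"
      by (rule liftE[OF _ _ _ e]) (use ab P in simp_all)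
    have ex1: "\<exists>!h. h \<in> hom C x (Dom C p) \<and> Comp C p h = u \<and> Comp C q h = v"
      if "u \<in> hom C x (Dom C f)" "v \<in> hom C x (Dom C g)" "Comp C f u = Comp C g v" for x u v
      using assms(2) that unfolding is_pullback_def by blast
    obtain k where k: "k \<in> hom C (Cod C i) (Dom C p)" "Comp C p k = h" "Comp C q k = b"
      using ex1[of h "Cod C i" b] h ab P by auto
    have "Comp C p (Comp C k i) = Comp C p a" "Comp C q (Comp C k i) = Comp C q a"
      using h(2) ab k P(1-8) iA by (simp_all add: comp_reduce[OF k(2)] comp_reduce[OF k(3)])
    then have ki: "Comp C k i \<in> hom C (Dom C i) (Dom C p) \<and> Comp C p (Comp C k i) = Comp C p a \<and>
        Comp C q (Comp C k i) = Comp C q a"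
      using k(1) iA P(3) by simp
    have a: "a \<in> hom C (Dom C i) (Dom C p) \<and> Comp C p a = Comp C p a \<and> Comp C q a = Comp C q a"
      using ab(1) P(8) by simp
    have "Comp C f (Comp C p a) = Comp C g (Comp C q a)"
      using ab P(1-8) by (simp add: comp_reduce[OF P(9)] assoc)
    from ex1[OF _ _ this, of "Dom C i"] have
      "\<exists>!h. h \<in> hom C (Dom C i) (Dom C p) \<and> Comp C p h = Comp C p a \<and> Comp C q h = Comp C q a"
      using ab(1) P(1-8) by simp
    then have "Comp C k i = a"
      by (rule ex1E) (use ki a in blast)
    then show "\<exists>h\<in>hom C (Cod C i) (Dom C q). Comp C h i = a \<and> Comp C q h = b"
      using k P by (intro bexI[of _ k]) simp_all
  qed
qed

text \<open>The retract argument: a composite that lifts against its second factor is a retract of the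
  first one, and dually. It identifies classes given by factorizations with classes given by
  lifting properties.\<close>

lemma retract_argument_left:
  assumes "\<alpha> \<in> Arr C" "\<beta> \<in> Arr C" "Cod C \<alpha> = Dom C \<beta>" "lifts C (Comp C \<beta> \<alpha>) \<beta>"
  shows "retract_of C (Comp C \<beta> \<alpha>) \<alpha>"
proof -
  obtain h where h: "h \<in> hom C (Cod C \<beta>) (Dom C \<beta>)" "Comp C h (Comp C \<beta> \<alpha>) = \<alpha>"
    "Comp C \<beta> h = Id C (Cod C \<beta>)"
    by (rule liftE[OF assms(4), of \<alpha> "Id C (Cod C \<beta>)"]) (use assms in simp_all)
  show ?thesis
    unfolding retract_of_def
    by (intro conjI bexI[of _ "Id C (Dom C \<alpha>)"] bexI[of _ h] bexI[of _ \<beta>])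
      (use h assms in simp_all)
qed

lemma retract_argument_right:
  assumes "\<alpha> \<in> Arr C" "\<beta> \<in> Arr C" "Cod C \<alpha> = Dom C \<beta>" "lifts C \<alpha> (Comp C \<beta> \<alpha>)"
  shows "retract_of C (Comp C \<beta> \<alpha>) \<beta>"
proof -
  obtain h where h: "h \<in> hom C (Cod C \<alpha>) (Dom C \<alpha>)" "Comp C h \<alpha> = Id C (Dom C \<alpha>)"
    "Comp C (Comp C \<beta> \<alpha>) h = \<beta>"
    by (rule liftE[OF assms(4), of "Id C (Dom C \<alpha>)" \<beta>]) (use assms in simp_all)
  show ?thesis
    unfolding retract_of_def
    by (intro conjI bexI[of _ "Id C (Cod C \<beta>)"] bexI[of _ h] bexI[of _ \<alpha>])
      (use h assms in simp_all)
qed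

text \<open>Hence a class closed under retracts contains all isomorphisms once it contains the identities.\<close>

lemma iso_retract_of_id:
  assumes "iso_arrow C f"
  shows "retract_of C f (Id C (Dom C f))"
proof -
  obtain g where "inverse_arrows C f g" using assms by (auto simp: iso_arrow_def)
  then show ?thesis
    unfolding retract_of_def inverse_arrows_def
    by (intro conjI bexI[of _ "Id C (Dom C f)"] bexI[of _ g] bexI[of _ f]) simp_all
qed

lemma id_llp: "a \<in> Obj C \<Longrightarrow> K \<subseteq> Arr C \<Longrightarrow> Id C a \<in> llp C K"
  by (fastforce simp: llp_def lifts_def subset_iff)

lemma id_rlp: "a \<in> Obj C \<Longrightarrow> K \<subseteq> Arr C \<Longrightarrow> Id C a \<in> rlp C K"
  by (fastforce simp: rlp_def lifts_def subset_iff)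

lemma iso_llp: "iso_arrow C f \<Longrightarrow> K \<subseteq> Arr C \<Longrightarrow> f \<in> llp C K"
  using llp_retract[OF id_llp iso_retract_of_id] iso_in_arr[of f] dom_obj by blast

lemma iso_rlp: "iso_arrow C f \<Longrightarrow> K \<subseteq> Arr C \<Longrightarrow> f \<in> rlp C K"
  using rlp_retract[OF id_rlp iso_retract_of_id] iso_in_arr[of f] dom_obj by blast

lemma rlp_comp:
  assumes "p \<in> rlp C K" "q \<in> rlp C K" "Cod C p = Dom C q" "K \<subseteq> Arr C"
  shows "Comp C q p \<in> rlp C K"
  unfolding rlp_def
proof (intro CollectI conjI ballI)
  have A: "p \<in> Arr C" "q \<in> Arr C" using assms by (auto simp: rlp_def)
  then show "Comp C q p \<in> Arr C" using assms by simp
  fix i assume i: "i \<in> K"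
  then have iA: "i \<in> Arr C" using assms by auto
  show "lifts C i (Comp C q p)"
    unfolding lifts_def
  proof (intro ballI impI)
    fix a b assume ab: "a \<in> hom C (Dom C i) (Dom C (Comp C q p))"
      "b \<in> hom C (Cod C i) (Cod C (Comp C q p))" "Comp C (Comp C q p) a = Comp C b i"
    have "lifts C i q" using assms i by (auto simp: rlp_def)
    then obtain h where h: "h \<in> hom C (Cod C i) (Dom C q)" "Comp C h i = Comp C p a" "Comp C q h = b"
      by (rule liftE[of _ _ _ "Comp C p a" b]) (use ab A assms iA in \<open>simp_all add: assoc\<close>)
    have "lifts C i p" using assms i by (auto simp: rlp_def)
    then obtain k where k: "k \<in> hom C (Cod C i) (Dom C p)" "Comp C k i = a" "Comp C p k = h"
      by (rule liftE[of _ _ _ a h]) (use ab A assms iA h in simp_all)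
    have "Comp C (Comp C q p) k = b"
      using k h A assms(3) by (simp add: assoc)
    then show "\<exists>h\<in>hom C (Cod C i) (Dom C (Comp C q p)). Comp C h i = a \<and> Comp C (Comp C q p) h = b"
      using k A assms(3) by (intro bexI[of _ k]) simp_all
  qed
qed

lemma pushout_paste:
  assumes "is_pushout C f g p q" "is_pushout C q h p' q'"
  shows "is_pushout C f (Comp C h g) (Comp C p' p) q'"
proof (rule pushoutI)
  note P = pushout_simps[OF assms(1)] and P' = pushout_simps[OF assms(2)]
  have gh: "Cod C g = Dom C h" and pp: "Cod C p = Dom C p'" using P P' by simp_all
  show "f \<in> Arr C" "Comp C h g \<in> Arr C" "Comp C p' p \<in> Arr C" "q' \<in> Arr C"
    "Dom C f = Dom C (Comp C h g)" "Dom C (Comp C p' p) = Cod C f" "Dom C q' = Cod C (Comp C h g)"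
    "Cod C (Comp C p' p) = Cod C q'"
    using P P' gh pp by simp_all
  have "Comp C (Comp C p' p) f = Comp C p' (Comp C q g)"
    using P P' gh pp by (simp add: assoc)
  also have "\<dots> = Comp C q' (Comp C h g)"
    using P P'(1-8) gh pp by (simp add: comp_reduce[OF P'(9)] assoc)
  finally show "Comp C (Comp C p' p) f = Comp C q' (Comp C h g)" .
  fix x a b
  {
    assume ab: "a \<in> hom C (Cod C f) x" "b \<in> hom C (Cod C (Comp C h g)) x"
      "Comp C a f = Comp C b (Comp C h g)"
    obtain k where k: "k \<in> hom C (Cod C p) x" "Comp C k p = a" "Comp C k q = Comp C b h"
      by (rule pushout_arrow[OF assms(1) ab(1), of "Comp C b h"])
        (use ab P P' gh in \<open>simp_all add: assoc\<close>)
    obtain l where l: "l \<in> hom C (Cod C p') x" "Comp C l p' = k" "Comp C l q' = b"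
      by (rule pushout_arrow[OF assms(2) _ _ k(3)]) (use k ab P P' gh pp in simp_all)
    show "\<exists>l. l \<in> hom C (Cod C (Comp C p' p)) x \<and> Comp C l (Comp C p' p) = a \<and> Comp C l q' = b"
      using l k(2) P P' pp by (intro exI[of _ l]) (simp add: comp_reduce[OF l(2)])
  }
  assume ab: "a \<in> hom C (Cod C (Comp C p' p)) x" "b \<in> hom C (Cod C (Comp C p' p)) x"
    "Comp C a (Comp C p' p) = Comp C b (Comp C p' p)" "Comp C a q' = Comp C b q'"
  have "Comp C a p' = Comp C b p'"
  proof (rule pushout_unique[OF category assms(1)])
    have "Comp C (Comp C a p') q = Comp C (Comp C a q') h" "Comp C (Comp C b p') q = Comp C (Comp C b q') h"
      using ab(1,2) P P' pp gh by (simp_all add: assoc)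
    then show "Comp C (Comp C a p') q = Comp C (Comp C b p') q" by (simp add: ab(4))
  qed (use ab P P' pp in \<open>simp_all add: assoc\<close>)
  then show "a = b"
    by (rule pushout_unique[OF category assms(2), rotated 2]) (use ab P P' pp in simp_all)
qed

lemma pushout_cancel:
  assumes "is_pushout C f g p q" "is_pushout C f (Comp C h g) (Comp C p' p) q'"
    and "h \<in> Arr C" "Dom C h = Cod C g" "p' \<in> Arr C" "Dom C p' = Cod C p" "Comp C p' q = Comp C q' h"
  shows "is_pushout C q h p' q'"
proof (rule pushoutI)
  note P = pushout_simps[OF assms(1)] and P' = pushout_simps[OF assms(2)]
  show "q \<in> Arr C" "h \<in> Arr C" "p' \<in> Arr C" "q' \<in> Arr C" "Dom C q = Dom C h" "Dom C p' = Cod C q"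
    "Dom C q' = Cod C h" "Cod C p' = Cod C q'" "Comp C p' q = Comp C q' h"
    using P P' assms(3-7) by simp_all
  fix x a b
  {
    assume ab: "a \<in> hom C (Cod C q) x" "b \<in> hom C (Cod C h) x" "Comp C a q = Comp C b h"
    have "Comp C (Comp C a p) f = Comp C (Comp C a q) g"
      using ab(1,2) P by (simp add: assoc)
    then obtain k where k: "k \<in> hom C (Cod C (Comp C p' p)) x" "Comp C k (Comp C p' p) = Comp C a p"
      "Comp C k q' = b"
      by (rule_tac pushout_arrow[OF assms(2), of "Comp C a p" x b])
        (use ab P assms(3-6) in \<open>simp_all add: assoc\<close>)
    have "Comp C k p' = a"
    proof (rule pushout_unique[OF category assms(1)])
      have "Comp C (Comp C k p') q = Comp C (Comp C k q') h"
        using k(1) P P' assms(3-7) by (simp add: assoc)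
      then show "Comp C (Comp C k p') q = Comp C a q" by (simp add: k(3) ab(3))
    qed (use k ab P assms(3-6) in \<open>simp_all add: assoc\<close>)
    then show "\<exists>l. l \<in> hom C (Cod C p') x \<and> Comp C l p' = a \<and> Comp C l q' = b"
      using k P assms(3-6) by (intro exI[of _ k]) simp
  }
  assume ab: "a \<in> hom C (Cod C p') x" "b \<in> hom C (Cod C p') x"
    "Comp C a p' = Comp C b p'" "Comp C a q' = Comp C b q'"
  show "a = b"
  proof (rule pushout_unique[OF category assms(2)])
    show "Comp C a (Comp C p' p) = Comp C b (Comp C p' p)"
      using ab P assms(3-6) by (simp add: assoc[symmetric])
  qed (use ab P assms(3-6) in simp_all)
qed

lemma pushout_iso:
  assumes "is_pushout C f g p q" "is_pushout C f g p' q'"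
  obtains h where "iso_arrow C h" "h \<in> hom C (Cod C q) (Cod C q')" "Comp C h q = q'"
proof -
  note P = pushout_simps[OF assms(1)] and P' = pushout_simps[OF assms(2)]
  obtain h where h: "h \<in> hom C (Cod C p) (Cod C p')" "Comp C h p = p'" "Comp C h q = q'"
    by (rule pushout_arrow[OF assms(1), of p' "Cod C p'" q']) (use P' in simp_all)
  obtain k where k: "k \<in> hom C (Cod C p') (Cod C p)" "Comp C k p' = p" "Comp C k q' = q"
    by (rule pushout_arrow[OF assms(2), of p "Cod C p" q]) (use P in simp_all)
  have "Comp C k h = Id C (Cod C p)"
    by (rule pushout_unique[OF category assms(1)]) (use h k P P' in \<open>simp_all add: assoc\<close>)
  moreover have "Comp C h k = Id C (Cod C p')"
    by (rule pushout_unique[OF category assms(2)]) (use h k P P' in \<open>simp_all add: assoc\<close>)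
  ultimately have "iso_arrow C h"
    using h k by (auto simp: iso_arrow_def inverse_arrows_def)
  then show ?thesis using that h P(8) P'(8) by simp
qed

end

definition has_pushouts :: "('o, 'm) cat \<Rightarrow> bool" where
  "has_pushouts C \<longleftrightarrow>
     (\<forall>f\<in>Arr C. \<forall>g\<in>Arr C. Dom C f = Dom C g \<longrightarrow> (\<exists>p q. is_pushout C f g p q))"

lemma ex1_unique: "\<exists>!y. P y \<Longrightarrow> P a \<Longrightarrow> P b \<Longrightarrow> a = b"
  by blast

text \<open>A span is a diagram on a category with five arrows, three of them identities; five distinct
  elements of \<open>'u\<close> serve as its arrows, and the identities among them also as its objects.\<close>

lemma cocomplete_has_pushouts:
  assumes "infinite (UNIV :: 'u set)" "category C" "cocomplete TYPE('u) C"
  shows "has_pushouts C"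
  unfolding has_pushouts_def
proof (intro ballI impI)
  interpret cat C by standard (rule assms)
  fix f g assume fg: "f \<in> Arr C" "g \<in> Arr C" "Dom C f = Dom C g"
  obtain A :: "'u set" where A: "finite A" "card A = 5"
    using infinite_arbitrarily_large[OF assms(1)] by blast
  then obtain xs where xs: "distinct xs" "set xs = A" using finite_distinct_list by blast
  then have "length xs = 5" using A distinct_card by metis
  then obtain o' l r p q where "xs = [o', l, r, p, q]"
    by (auto simp: length_Suc_conv numeral_eq_Suc)
  then have d: "distinct [o', l, r, p, q]" using xs by simp
  define J where "J = \<lparr>Obj = {o', l, r}, Arr = {o', l, r, p, q},
    Dom = (\<lambda>k. if k \<in> {p, q} then o' else k), Cod = (\<lambda>k. if k = p then l else if k = q then r else k),
    Id = (\<lambda>k. k), Comp = (\<lambda>g f. if f \<in> {p, q} then f else g)\<rparr>"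
  define X where "X = \<lparr>fobj = (\<lambda>k. if k = o' then Dom C f else if k = l then Cod C f else Cod C g),
    farr = (\<lambda>k. if k = p then f else if k = q then g else
      Id C (if k = o' then Dom C f else if k = l then Cod C f else Cod C g))\<rparr>"
  have "category J" using d by (auto simp: category_def J_def)
  moreover have "small TYPE('u) (Arr J)"
  proof -
    have "finite (Arr J)" by (simp add: J_def)
    then show ?thesis
      unfolding small_def using assms(1) finite_lesspoll_infinite by blast
  qed
  moreover have "is_functor J C X"
    using d fg by (auto simp: is_functor_def J_def X_def)
  ultimately obtain c k where col: "is_colimit J C X c k"
    using assms(3) unfolding cocomplete_def by blast
  then have cc: "is_cocone J C X c k" by (simp add: is_colimit_def)
  have ko: "k o' = Comp C (k l) f" "k o' = Comp C (k r) g" "c \<in> Obj C"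
    "k l \<in> hom C (Cod C f) c" "k r \<in> hom C (Cod C g) c"
    using cc d by (auto simp: is_cocone_def J_def X_def)
  have legs: "is_cocone J C X x (\<lambda>j. if j = o' then Comp C a f else if j = l then a else b)"
    if "a \<in> hom C (Cod C f) x" "b \<in> hom C (Cod C g) x" "Comp C a f = Comp C b g" for x a b
    using that fg d by (auto simp: is_cocone_def J_def X_def)
  have "is_pushout C f g (k l) (k r)"
  proof (rule pushoutI)
    fix x a b assume ab: "a \<in> hom C (Cod C f) x" "b \<in> hom C (Cod C g) x" "Comp C a f = Comp C b g"
    obtain h where "h \<in> hom C c x"
      "\<forall>j\<in>Obj J. Comp C h (k j) = (if j = o' then Comp C a f else if j = l then a else b)"
      using col legs[OF ab] unfolding is_colimit_def by blast
    then show "\<exists>h. h \<in> hom C (Cod C (k l)) x \<and> Comp C h (k l) = a \<and> Comp C h (k r) = b"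
      using d ko by (intro exI[of _ h]) (auto simp: J_def)
  next
    fix x h h' assume h: "h \<in> hom C (Cod C (k l)) x" "h' \<in> hom C (Cod C (k l)) x"
      "Comp C h (k l) = Comp C h' (k l)" "Comp C h (k r) = Comp C h' (k r)"
    have e: "Comp C (Comp C h (k l)) f = Comp C (Comp C h (k r)) g"
      using h(1) ko fg by (metis assoc in_hom)
    define R where "R j = (if j = o' then Comp C (Comp C h (k l)) f
      else if j = l then Comp C h (k l) else Comp C h (k r))" for j
    have ex1: "\<exists>!y. y \<in> hom C c x \<and> (\<forall>j\<in>Obj J. Comp C y (k j) = R j)"
      using col legs[OF _ _ e, of x] h(1) ko unfolding is_colimit_def R_def by simp
    have R: "\<forall>j\<in>Obj J. Comp C y (k j) = R j"
      if y: "y \<in> hom C c x" "Comp C h (k l) = Comp C y (k l)" "Comp C h (k r) = Comp C y (k r)" for y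
    proof -
      have "Comp C y (k o') = Comp C (Comp C h (k l)) f"
        using y(1) ko(4) fg unfolding ko(1) y(2) by (simp add: assoc)
      moreover have "R o' = Comp C (Comp C h (k l)) f" "R l = Comp C h (k l)" "R r = Comp C h (k r)"
        using d by (auto simp: R_def)
      ultimately have "Comp C y (k o') = R o'" "Comp C y (k l) = R l" "Comp C y (k r) = R r"
        using y(2,3) by simp_all
      then show ?thesis by (simp add: J_def)
    qed
    have hh: "h \<in> hom C c x" "h' \<in> hom C c x" using h(1,2) ko(4) by simp_all
    have "h \<in> hom C c x \<and> (\<forall>j\<in>Obj J. Comp C h (k j) = R j)" using hh(1) R[OF hh(1) refl refl] by (rule conjI)
    moreover have "h' \<in> hom C c x \<and> (\<forall>j\<in>Obj J. Comp C h' (k j) = R j)"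
      using hh(2) R[OF hh(2) h(3,4)] by (rule conjI)
    ultimately show "h = h'" by (rule ex1_unique[OF ex1])
  qed (use ko fg in auto)
  then show "\<exists>p q. is_pushout C f g p q" by blast
qed

section \<open>Model and semi-model structures\<close>

lemma factorizationE:
  assumes "functorial_factorization C P L R" "f \<in> P"
  obtains e \<alpha> \<beta> where "\<alpha> \<in> hom C (Dom C f) e" "\<beta> \<in> hom C e (Cod C f)" "Comp C \<beta> \<alpha> = f"
    "\<alpha> \<in> L" "\<beta> \<in> R"
  using assms unfolding functorial_factorization_def by blast

text \<open>The choice functions of a functorial factorization, as parameters: \<open>f\<close> factors as \<open>\<beta> f \<circ> \<alpha> f\<close>
  through \<open>E f\<close>, and \<open>m\<close> is the action on commutative squares.\<close>

locale factorization = cat C for C :: "('o, 'm) cat" +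
  fixes P K K' :: "'m set" and E :: "'m \<Rightarrow> 'o" and \<alpha> \<beta> :: "'m \<Rightarrow> 'm"
    and m :: "'m \<Rightarrow> 'm \<Rightarrow> 'm \<Rightarrow> 'm \<Rightarrow> 'm"
  assumes fac: "f \<in> P \<Longrightarrow> \<alpha> f \<in> hom C (Dom C f) (E f) \<and> \<beta> f \<in> hom C (E f) (Cod C f) \<and>
      Comp C (\<beta> f) (\<alpha> f) = f \<and> \<alpha> f \<in> K \<and> \<beta> f \<in> K'"
    and fac_map: "f \<in> P \<Longrightarrow> g \<in> P \<Longrightarrow> s \<in> hom C (Dom C f) (Dom C g) \<Longrightarrow> t \<in> hom C (Cod C f) (Cod C g) \<Longrightarrow>
      Comp C g s = Comp C t f \<Longrightarrow> m f g s t \<in> hom C (E f) (E g) \<and>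
      Comp C (m f g s t) (\<alpha> f) = Comp C (\<alpha> g) s \<and> Comp C (\<beta> g) (m f g s t) = Comp C t (\<beta> f)"
    and fac_id: "f \<in> P \<Longrightarrow> m f f (Id C (Dom C f)) (Id C (Cod C f)) = Id C (E f)"
    and fac_comp: "f \<in> P \<Longrightarrow> g \<in> P \<Longrightarrow> h \<in> P \<Longrightarrow>
      s \<in> hom C (Dom C f) (Dom C g) \<Longrightarrow> t \<in> hom C (Cod C f) (Cod C g) \<Longrightarrow>
      s' \<in> hom C (Dom C g) (Dom C h) \<Longrightarrow> t' \<in> hom C (Cod C g) (Cod C h) \<Longrightarrow>
      Comp C g s = Comp C t f \<and> Comp C h s' = Comp C t' g \<Longrightarrow>
      m f h (Comp C s' s) (Comp C t' t) = Comp C (m g h s' t') (m f g s t)"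

lemma factorization_exists:
  assumes "category C" "functorial_factorization C P K K'"
  shows "\<exists>E \<alpha> \<beta> m. factorization C P K K' E \<alpha> \<beta> m"
  using assms(2)
  unfolding functorial_factorization_def factorization_def cat_def factorization_axioms_def
  by (elim ex_forward) (use assms(1) in blast)

text \<open>By the retract argument the fibrations are the arrows with the right lifting property against
  trivial cofibrations, which yields the closure properties demanded of a semi-model structure.
  Model and semi-model structures are treated together from here on, through the condition \<open>G\<close>
  on domains.\<close>

lemma model_structure_semi_model:
  assumes "category C" "model_structure C S"
  shows "semi_model_axioms C S (\<lambda>_. True)"
proof -
  interpret cat C by standard (rule assms)
  have sub: "weqs S \<subseteq> Arr C" "fibs S \<subseteq> Arr C" "tfibs S \<subseteq> Arr C" "cofs C S \<subseteq> Arr C" "tcofs C S \<subseteq> Arr C"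
  proof -
    have "homotopically_structured C S" using assms(2) by (simp add: model_structure_def)
    then show "weqs S \<subseteq> Arr C" "fibs S \<subseteq> Arr C" "tfibs S \<subseteq> Arr C"
      by (auto simp: homotopically_structured_def tfibs_def)
  qed (auto simp: cofs_def tcofs_def)
  have m: "two_out_of_three C (weqs S)" "closed_under_retracts C (weqs S)" "closed_under_retracts C (fibs S)"
    "\<forall>i\<in>tcofs C S. \<forall>p\<in>fibs S. lifts C i p"
    "functorial_factorization C (Arr C) (cofs C S) (tfibs S)"
    "functorial_factorization C (Arr C) (tcofs C S) (fibs S)"
    using assms(2) by (simp_all add: model_structure_def)
  have fibs: "fibs S = rlp C (tcofs C S)"
  proof
    show "fibs S \<subseteq> rlp C (tcofs C S)" using m(4) sub by (auto simp: rlp_def)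
    show "rlp C (tcofs C S) \<subseteq> fibs S"
    proof
      fix p assume p: "p \<in> rlp C (tcofs C S)"
      then have "p \<in> Arr C" by (simp add: rlp_def)
      then obtain e \<alpha> \<beta> where ab: "\<alpha> \<in> hom C (Dom C p) e" "\<beta> \<in> hom C e (Cod C p)" "Comp C \<beta> \<alpha> = p"
        "\<alpha> \<in> tcofs C S" "\<beta> \<in> fibs S"
        using factorizationE[OF m(6)] by metis
      have "retract_of C p \<beta>"
        using retract_argument_right[of \<alpha> \<beta>] ab p by (auto simp: rlp_def)
      then show "p \<in> fibs S" using m(3) ab unfolding closed_under_retracts_def by blast
    qed
  qed
  have id_weq: "Id C a \<in> weqs S" if a: "a \<in> Obj C" for a
  proof -
    obtain e \<alpha> \<beta> where ab: "\<alpha> \<in> hom C a e" "\<beta> \<in> hom C e a" "\<alpha> \<in> tcofs C S"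
      by (rule factorizationE[OF m(6), of "Id C a"]) (use a in simp_all)
    have "Comp C \<alpha> (Id C a) = \<alpha>" using ab by simp
    then show ?thesis using two_out_of_threeD(3)[OF m(1), of "Id C a" \<alpha>] a ab by (auto simp: tcofs_def)
  qed
  have "contains_isos C (weqs S)"
    using m(2) iso_retract_of_id id_weq iso_in_arr dom_obj
    unfolding contains_isos_def closed_under_retracts_def by blast
  moreover have "closed_under_comp C (weqs S)"
    using two_out_of_threeD(1)[OF m(1)] sub unfolding closed_under_comp_def by blast
  moreover have "contains_isos C (fibs S)" "closed_under_comp C (fibs S)" "closed_under_pullback C (fibs S)"
    unfolding fibs contains_isos_def closed_under_comp_def closed_under_pullback_def
    using iso_rlp rlp_comp rlp_pullback sub(5) by blast+
  moreover have "contains_isos C (cofs C S)" "closed_under_comp C (cofs C S)"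
    unfolding cofs_llp contains_isos_def closed_under_comp_def
    using iso_llp llp_comp sub(3) by blast+
  ultimately show ?thesis
    using assms(2) by (simp add: semi_model_axioms_def model_structure_def)
qed

text \<open>\<open>G\<close> is always true for a model structure, and it is cofibrancy of the object, or of its image, for a
  semi-model structure. An arrow is called anodyne if it has the left lifting property against all fibrations; in
  contrast to trivial cofibrations, anodyne arrows are stable under pushout without any condition
  on domains.\<close>

locale semi_model_category = cat C for C :: "('o, 'm) cat" +
  fixes S :: "'m hstruct" and G :: "'o \<Rightarrow> bool"
  assumes ax: "semi_model_axioms C S G"
begin

abbreviation "anodyne \<equiv> llp C (fibs S)"

lemma weq_arr: "w \<in> weqs S \<Longrightarrow> w \<in> Arr C"
  and fibs_arr: "fibs S \<subseteq> Arr C"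
  and tfibs_arr: "tfibs S \<subseteq> Arr C"
  using ax by (auto simp: semi_model_axioms_def homotopically_structured_def tfibs_def)

lemma cof_arr: "i \<in> cofs C S \<Longrightarrow> i \<in> Arr C"
  by (simp add: cofs_def)

lemma weq_23: "two_out_of_three C (weqs S)"
  using ax by (simp add: semi_model_axioms_def)

lemma weq_comp:
  assumes "f \<in> weqs S" "g \<in> weqs S" "Cod C f = Dom C g" shows "Comp C g f \<in> weqs S"
  using two_out_of_threeD(1)[OF weq_23 _ _ assms(3)] weq_arr assms by blast

lemma weq_right:
  assumes "f \<in> weqs S" "Comp C g f \<in> weqs S" "g \<in> Arr C" "Cod C f = Dom C g" shows "g \<in> weqs S"
  using two_out_of_threeD(2)[OF weq_23 _ _ assms(4)] weq_arr assms by blast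

lemma weq_left:
  assumes "g \<in> weqs S" "Comp C g f \<in> weqs S" "f \<in> Arr C" "Cod C f = Dom C g" shows "f \<in> weqs S"
  using two_out_of_threeD(3)[OF weq_23 _ _ assms(4)] weq_arr assms by blast

lemma weq_retract: "g \<in> weqs S \<Longrightarrow> retract_of C f g \<Longrightarrow> f \<in> weqs S"
  using ax unfolding semi_model_axioms_def closed_under_retracts_def by blast

lemma iso_weq: "iso_arrow C f \<Longrightarrow> f \<in> weqs S"
  and iso_fib: "iso_arrow C f \<Longrightarrow> f \<in> fibs S"
  using ax unfolding semi_model_axioms_def contains_isos_def by blast+

lemma fib_pullback: "f \<in> fibs S \<Longrightarrow> is_pullback C f g p q \<Longrightarrow> q \<in> fibs S"
  using ax unfolding semi_model_axioms_def closed_under_pullback_def by blast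

lemma cof_tfib_factorization: "functorial_factorization C (Arr C) (cofs C S) (tfibs S)"
  using ax by (simp add: semi_model_axioms_def)

lemma tcof_fib_factorization:
  "functorial_factorization C {f \<in> Arr C. G (Dom C f)} (tcofs C S) (fibs S)"
  using ax by (simp add: semi_model_axioms_def)

lemma cof_lifts: "i \<in> cofs C S \<Longrightarrow> p \<in> tfibs S \<Longrightarrow> lifts C i p"
  by (simp add: cofs_def)

lemma tfibs_rlp: "tfibs S = rlp C (cofs C S)"
proof
  show "tfibs S \<subseteq> rlp C (cofs C S)"
    using tfibs_arr by (auto simp: rlp_def cofs_def)
  show "rlp C (cofs C S) \<subseteq> tfibs S"
  proof
    fix p assume p: "p \<in> rlp C (cofs C S)"
    then have "p \<in> Arr C" by (simp add: rlp_def)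
    then obtain e \<alpha> \<beta> where ab: "\<alpha> \<in> hom C (Dom C p) e" "\<beta> \<in> hom C e (Cod C p)" "Comp C \<beta> \<alpha> = p"
      "\<alpha> \<in> cofs C S" "\<beta> \<in> tfibs S"
      using factorizationE[OF cof_tfib_factorization] by metis
    have "retract_of C p \<beta>"
      using retract_argument_right[of \<alpha> \<beta>] ab p by (auto simp: rlp_def)
    moreover have "closed_under_retracts C (weqs S)" "closed_under_retracts C (fibs S)"
      using ax by (auto simp: semi_model_axioms_def)
    ultimately show "p \<in> tfibs S"
      using ab(5) unfolding closed_under_retracts_def tfibs_def by blast
  qed
qed

lemma tfib_pullback: "f \<in> tfibs S \<Longrightarrow> is_pullback C f g p q \<Longrightarrow> q \<in> tfibs S"
  unfolding tfibs_rlp using rlp_pullback cof_arr by blast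

lemma cof_comp: "i \<in> cofs C S \<Longrightarrow> j \<in> cofs C S \<Longrightarrow> Cod C i = Dom C j \<Longrightarrow> Comp C j i \<in> cofs C S"
  unfolding cofs_llp using llp_comp tfibs_arr by blast

lemma cof_pushout: "f \<in> cofs C S \<Longrightarrow> is_pushout C f g p q \<Longrightarrow> q \<in> cofs C S"
  unfolding cofs_llp using llp_pushout tfibs_arr by blast

lemma anodyne_pushout: "f \<in> anodyne \<Longrightarrow> is_pushout C f g p q \<Longrightarrow> q \<in> anodyne"
  using llp_pushout fibs_arr by blast

lemma anodyne_weq:
  assumes "f \<in> anodyne" "G (Dom C f)" shows "f \<in> weqs S"
proof -
  have f: "f \<in> Arr C" using assms by (simp add: llp_def)
  then obtain e \<alpha> \<beta> where ab: "\<alpha> \<in> hom C (Dom C f) e" "\<beta> \<in> hom C e (Cod C f)" "Comp C \<beta> \<alpha> = f"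
    "\<alpha> \<in> tcofs C S" "\<beta> \<in> fibs S"
    using factorizationE[OF tcof_fib_factorization] assms(2) by (metis (mono_tags, lifting) mem_Collect_eq)
  have "retract_of C f \<alpha>"
    using retract_argument_left[of \<alpha> \<beta>] ab assms(1) by (auto simp: llp_def)
  then show ?thesis using weq_retract ab by (auto simp: tcofs_def)
qed

lemma tcof_anodyne:
  assumes "f \<in> cofs C S" "f \<in> weqs S" "G (Dom C f)" shows "f \<in> anodyne"
proof -
  have "\<forall>i\<in>tcofs C S. \<forall>p\<in>fibs S. G (Dom C i) \<longrightarrow> lifts C i p"
    using ax by (simp add: semi_model_axioms_def)
  then show ?thesis using assms by (simp add: llp_def tcofs_def cof_arr)
qed

lemma cofibrant_initial_arrow:
  assumes "cofibrant C S a" "initial_object C z" "f \<in> hom C z a"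
  shows "f \<in> cofs C S"
proof -
  obtain z' i where i: "initial_object C z'" "i \<in> hom C z' a" "i \<in> cofs C S"
    using assms(1) by (auto simp: cofibrant_def)
  have "lifts C f p" if p: "p \<in> tfibs S" for p
    unfolding lifts_def
  proof (intro ballI impI)
    have pA: "p \<in> Arr C" using p tfibs_arr by auto
    fix x y assume xy: "x \<in> hom C (Dom C f) (Dom C p)" "y \<in> hom C (Cod C f) (Cod C p)"
      "Comp C p x = Comp C y f"
    obtain x' where x': "x' \<in> hom C z' (Dom C p)"
      using initial_arrow[OF i(1)] pA dom_obj by metis
    have "Comp C p x' = Comp C y i"
      by (rule initial_unique[OF i(1)]) (use x' xy i(2) pA assms(3) in simp_all)
    then obtain h where h: "h \<in> hom C (Cod C i) (Dom C p)" "Comp C p h = y"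
      using liftE[OF cof_lifts[OF i(3) p], of x' y] x' xy i(2) assms(3) by auto
    have "Comp C h f = x"
      by (rule initial_unique[OF assms(2)]) (use h xy pA assms(3) i(2) in simp_all)
    then show "\<exists>h\<in>hom C (Cod C f) (Dom C p). Comp C h f = x \<and> Comp C p h = y"
      using h assms(3) i(2) by (intro bexI[of _ h]) simp_all
  qed
  then show ?thesis using assms(3) by (simp add: cofs_def)
qed

lemma cofibrant_cof:
  assumes "cofibrant C S a" "i \<in> cofs C S" "Dom C i = a"
  shows "cofibrant C S (Cod C i)"
proof -
  obtain z k where k: "initial_object C z" "k \<in> hom C z a" "k \<in> cofs C S"
    using assms(1) by (auto simp: cofibrant_def)
  have "Comp C i k \<in> hom C z (Cod C i)"
    using k(2) assms(3) cof_arr[OF assms(2)] by simp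
  moreover have "Comp C i k \<in> cofs C S"
    using cof_comp[OF k(3) assms(2)] k(2) assms(3) by simp
  ultimately show ?thesis
    using k(1) unfolding cofibrant_def by blast
qed

end

text \<open>Left properness, relative left properness and the property of \<open>proper_on_cofibrant\<close> are the
  instances of this notion for three predicates \<open>H\<close>.\<close>

definition proper_on :: "('o, 'm) cat \<Rightarrow> 'm hstruct \<Rightarrow> ('o \<Rightarrow> bool) \<Rightarrow> bool" where
  "proper_on C S H \<longleftrightarrow>
     (\<forall>w i p q. w \<in> weqs S \<and> i \<in> cofs C S \<and> H (Dom C w) \<and> H (Cod C w) \<and> is_pushout C w i p q \<longrightarrow>
        q \<in> weqs S)"

lemma proper_onD:
  assumes "proper_on C S H" "w \<in> weqs S" "i \<in> cofs C S" "H (Dom C w)" "H (Cod C w)" "is_pushout C w i p q"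
  shows "q \<in> weqs S"
  using assms unfolding proper_on_def by blast

lemma left_proper_iff: "left_proper C S \<longleftrightarrow> proper_on C S (\<lambda>_. True)"
  by (simp only: left_proper_def proper_on_def simp_thms)

lemma relatively_left_proper_iff:
  "relatively_left_proper C S M S' V \<longleftrightarrow> proper_on C S (\<lambda>a. cofibrant M S' (fobj V a))"
  by (simp only: relatively_left_proper_def proper_on_def)

section \<open>Weak equivalences between cofibrant objects\<close>

locale cofibrant_semi_model = semi_model_category C S "cofibrant C S" for C :: "('o, 'm) cat" and S +
  assumes pushouts: "has_pushouts C"
begin

lemma pushoutE:
  assumes "f \<in> Arr C" "g \<in> Arr C" "Dom C f = Dom C g"
  obtains p q where "is_pushout C f g p q"
  using pushouts assms unfolding has_pushouts_def by blast

text \<open>Factor the map \<open>(w, id)\<close> from the coproduct of domain and codomain as a cofibration followed by a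
  trivial fibration. The coproduct is the pushout over an initial object, so its inclusions are
  cofibrations.\<close>

lemma brown_factorization:
  assumes "w \<in> Arr C" "cofibrant C S (Dom C w)" "cofibrant C S (Cod C w)"
  obtains y a b t where "a \<in> hom C (Dom C w) y" "b \<in> hom C (Cod C w) y" "t \<in> hom C y (Cod C w)"
    "a \<in> cofs C S" "b \<in> cofs C S" "t \<in> tfibs S" "Comp C t a = w" "Comp C t b = Id C (Cod C w)"
proof -
  obtain z f where f: "initial_object C z" "f \<in> hom C z (Dom C w)" "f \<in> cofs C S"
    using assms(2) by (auto simp: cofibrant_def)
  obtain g where g: "g \<in> hom C z (Cod C w)" using initial_arrow[OF f(1)] assms(1) cod_obj by metis
  have gc: "g \<in> cofs C S" by (rule cofibrant_initial_arrow[OF assms(3) f(1) g])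
  obtain p q where pq: "is_pushout C f g p q" using pushoutE[of f g] f g by auto
  note P = pushout_simps[OF pq]
  have c: "p \<in> cofs C S" "q \<in> cofs C S"
    using cof_pushout[OF gc pushout_sym[OF pq]] cof_pushout[OF f(3) pq] .
  have "Comp C w f = Comp C (Id C (Cod C w)) g"
    by (rule initial_unique[OF f(1)]) (use f g assms in simp_all)
  then obtain k where k: "k \<in> hom C (Cod C p) (Cod C w)" "Comp C k p = w" "Comp C k q = Id C (Cod C w)"
    using pushout_arrow[OF pq, of w "Cod C w" "Id C (Cod C w)"] f g assms(1) by auto
  obtain y \<alpha> \<beta> where ab: "\<alpha> \<in> hom C (Cod C p) y" "\<beta> \<in> hom C y (Cod C w)" "Comp C \<beta> \<alpha> = k"
    "\<alpha> \<in> cofs C S" "\<beta> \<in> tfibs S"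
    using factorizationE[OF cof_tfib_factorization, of k] k by auto
  show ?thesis
  proof
    show "Comp C \<alpha> p \<in> hom C (Dom C w) y" "Comp C \<alpha> q \<in> hom C (Cod C w) y"
      using ab P f(2) g by simp_all
    show "Comp C \<alpha> p \<in> cofs C S" "Comp C \<alpha> q \<in> cofs C S"
      using c ab P by (auto intro: cof_comp)
    show "Comp C \<beta> (Comp C \<alpha> p) = w" "Comp C \<beta> (Comp C \<alpha> q) = Id C (Cod C w)"
      using ab P k by (simp_all add: assoc[symmetric])
  qed (use ab in auto)
qed

text \<open>Pushing a cofibration \<open>j : Y \<rightarrow> Y'\<close> out along a retraction \<open>r : Y \<rightarrow> S\<close> of an anodyne arrow \<open>s\<close>.
  The arrow \<open>s r : Y \<rightarrow> Y\<close> is homotopic to the identity: let \<open>D\<close> be two copies of \<open>Y\<close> glued along \<open>S\<close>;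
  its two inclusions are anodyne and \<open>m = (id, s r) : D \<rightarrow> Y\<close> connects the two maps. The point is that
  \<open>j\<close> extends over \<open>D\<close>: there is an object \<open>D'\<close> under \<open>D\<close> receiving anodyne maps from the pushouts of
  \<open>j\<close> along both inclusions. Pushing \<open>D'\<close> out along \<open>m\<close> gives an object that receives weak
  equivalences from the pushout \<open>Y'\<close> of \<open>j\<close> along the identity and from its pushout \<open>Y''\<close> along
  \<open>s r\<close>. Hence \<open>Y' \<rightarrow> Y''\<close> is a weak equivalence, and it factors through the pushout \<open>S'\<close> along \<open>r\<close>
  with \<open>S' \<rightarrow> Y''\<close> anodyne.\<close>

lemma retraction_proper:
  assumes s: "s \<in> anodyne" and r: "r \<in> Arr C" "Dom C r = Cod C s" "Cod C r = Dom C s"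
    and rs: "Comp C r s = Id C (Dom C s)"
    and cS: "cofibrant C S (Dom C s)" and cY: "cofibrant C S (Cod C s)"
    and j: "j \<in> cofs C S" and po: "is_pushout C r j p r'"
  shows "r' \<in> weqs S"
proof -
  note [simp] = pushout_simps[OF po]
  have sA [simp]: "s \<in> Arr C" and jA: "j \<in> Arr C" using s j by (auto simp: llp_def cofs_def)
  have dj [simp]: "Dom C j = Cod C s" "Dom C p = Dom C s" using pushout_simps[OF po] r by auto
  have c_weq: "f \<in> weqs S" if "f \<in> anodyne" "cofibrant C S (Dom C f)" for f
    using anodyne_weq that .
  have cY': "cofibrant C S (Cod C j)" using cofibrant_cof[OF cY j] by simp
  have pc: "p \<in> cofs C S" using cof_pushout[OF j pushout_sym[OF po]] .
  have cS': "cofibrant C S (Cod C r')" using cofibrant_cof[OF cS pc] r by simp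
  \<comment> \<open>the object \<open>D\<close>, with its folding map and the homotopy \<open>m\<close>\<close>
  obtain i0 i1 where D: "is_pushout C s s i0 i1" using pushoutE[of s s] by auto
  note Ds [simp] = pushout_simps(3,4,6,7)[OF D] and Deq = pushout_simps(9)[OF D]
  have cod_i1 [simp]: "Cod C i1 = Cod C i0" using pushout_simps[OF D] by simp
  have an: "i0 \<in> anodyne" "i1 \<in> anodyne"
    using anodyne_pushout[OF s pushout_sym[OF D]] anodyne_pushout[OF s D] .
  obtain fold where fold: "fold \<in> hom C (Cod C i0) (Cod C s)" "Comp C fold i0 = Id C (Cod C s)"
    "Comp C fold i1 = Id C (Cod C s)"
    by (rule pushout_arrow[OF D, of "Id C (Cod C s)" "Cod C s" "Id C (Cod C s)"]) simp_all
  obtain m where m: "m \<in> hom C (Cod C i0) (Cod C s)" "Comp C m i0 = Id C (Cod C s)"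
    "Comp C m i1 = Comp C s r"
    by (rule pushout_arrow[OF D, of "Id C (Cod C s)" "Cod C s" "Comp C s r"])
      (use r rs in \<open>simp_all add: assoc\<close>)
  have [simp]: "fold \<in> Arr C" "Dom C fold = Cod C i0" "Cod C fold = Cod C s"
    "m \<in> Arr C" "Dom C m = Cod C i0" "Cod C m = Cod C s"
    using fold m by auto
  \<comment> \<open>the pushouts of \<open>j\<close> along the two inclusions; \<open>D'\<close>, called \<open>y\<close> below, factors the folding map of
    their union over \<open>D\<close>, which makes both inclusions into it weak equivalences\<close>
  obtain e0 k0 where E0: "is_pushout C j i0 e0 k0" using pushoutE[of j i0] by auto
  obtain e1 k1 where E1: "is_pushout C j i1 e1 k1" using pushoutE[of j i1] by auto
  note Es [simp] = pushout_simps(3,4,6,7)[OF E0] pushout_simps(3,4,6,7)[OF E1]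
  have cod_k [simp]: "Cod C k0 = Cod C e0" "Cod C k1 = Cod C e1"
    using pushout_simps(8)[OF E0] pushout_simps(8)[OF E1] by simp_all
  have ean: "e0 \<in> anodyne" "e1 \<in> anodyne"
    using anodyne_pushout[OF an(1) pushout_sym[OF E0]] anodyne_pushout[OF an(2) pushout_sym[OF E1]] .
  have kc: "k0 \<in> cofs C S" "k1 \<in> cofs C S"
    using cof_pushout[OF j E0] cof_pushout[OF j E1] .
  have ew: "e0 \<in> weqs S" "e1 \<in> weqs S" using c_weq ean cY' by simp_all
  obtain \<phi>0 where \<phi>0: "\<phi>0 \<in> hom C (Cod C e0) (Cod C j)" "Comp C \<phi>0 e0 = Id C (Cod C j)"
    "Comp C \<phi>0 k0 = Comp C j fold"
    by (rule pushout_arrow[OF E0, of "Id C (Cod C j)" "Cod C j" "Comp C j fold"])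
      (use fold in \<open>simp_all add: assoc\<close>)
  obtain \<phi>1 where \<phi>1: "\<phi>1 \<in> hom C (Cod C e1) (Cod C j)" "Comp C \<phi>1 e1 = Id C (Cod C j)"
    "Comp C \<phi>1 k1 = Comp C j fold"
    by (rule pushout_arrow[OF E1, of "Id C (Cod C j)" "Cod C j" "Comp C j fold"])
      (use fold in \<open>simp_all add: assoc\<close>)
  obtain a0 a1 where A: "is_pushout C k0 k1 a0 a1" using pushoutE[of k0 k1] by auto
  note As [simp] = pushout_simps(3,4,6,7)[OF A]
  have cod_a [simp]: "Cod C a1 = Cod C a0" using pushout_simps(8)[OF A] by simp
  have ac: "a0 \<in> cofs C S" "a1 \<in> cofs C S"
    using cof_pushout[OF kc(2) pushout_sym[OF A]] cof_pushout[OF kc(1) A] .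
  obtain \<phi> where \<phi>: "\<phi> \<in> hom C (Cod C a0) (Cod C j)" "Comp C \<phi> a0 = \<phi>0" "Comp C \<phi> a1 = \<phi>1"
    by (rule pushout_arrow[OF A, of \<phi>0 "Cod C j" \<phi>1]) (use \<phi>0 \<phi>1 in simp_all)
  obtain y d t where dt: "d \<in> hom C (Cod C a0) y" "t \<in> hom C y (Cod C j)" "Comp C t d = \<phi>"
    "d \<in> cofs C S" "t \<in> tfibs S"
    using factorizationE[OF cof_tfib_factorization, of \<phi>] \<phi> by auto
  define c0 c1 where "c0 = Comp C d a0" and "c1 = Comp C d a1"
  have c [simp]: "c0 \<in> Arr C" "Dom C c0 = Cod C e0" "Cod C c0 = y"
    "c1 \<in> Arr C" "Dom C c1 = Cod C e1" "Cod C c1 = y"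
    using dt by (simp_all add: c0_def c1_def)
  have cc: "c0 \<in> cofs C S" "c1 \<in> cofs C S"
    unfolding c0_def c1_def using dt ac by (auto intro: cof_comp)
  have ck: "Comp C c0 k0 = Comp C c1 k1"
    using dt pushout_simps(9)[OF A] by (simp add: c0_def c1_def assoc)
  have tc: "Comp C t (Comp C c0 e0) = Id C (Cod C j)" "Comp C t (Comp C c1 e1) = Id C (Cod C j)"
    using dt \<phi> \<phi>0(2) \<phi>1(2) by (simp_all add: c0_def c1_def assoc comp_reduce[OF dt(3)] comp_reduce[OF \<phi>(2)] comp_reduce[OF \<phi>(3)])
  have idw: "Id C (Cod C j) \<in> weqs S" by (rule iso_weq[OF iso_id]) simp
  have tw: "t \<in> weqs S" using dt(5) by (simp add: tfibs_def)
  have cew: "Comp C c0 e0 \<in> weqs S" "Comp C c1 e1 \<in> weqs S"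
    by (rule weq_left[OF tw]; use tc idw dt(2) in simp)+
  have cw: "c0 \<in> weqs S" "c1 \<in> weqs S"
    using weq_right[OF ew(1) cew(1)] weq_right[OF ew(2) cew(2)] by simp_all
  have cE: "cofibrant C S (Cod C e0)" "cofibrant C S (Cod C e1)"
  proof -
    have "cofibrant C S (Cod C i0)"
      using cofibrant_cof[OF cY, of i0] an(1) tcof_anodyne by (auto simp: cofs_def llp_def tfibs_def)
    then show "cofibrant C S (Cod C e0)" "cofibrant C S (Cod C e1)"
      using cofibrant_cof[OF _ kc(1)] cofibrant_cof[OF _ kc(2)] by auto
  qed
  have can: "c0 \<in> anodyne" "c1 \<in> anodyne"
    using tcof_anodyne cc cw cE by simp_all
  \<comment> \<open>pushing out along \<open>m\<close>: the pushout of the first inclusion is \<open>j\<close> again since \<open>m i0 = id\<close>, that of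
    the second one is \<open>Y''\<close> since \<open>m i1 = s r\<close>\<close>
  obtain \<mu>0 where \<mu>0: "\<mu>0 \<in> hom C (Cod C e0) (Cod C j)" "Comp C \<mu>0 e0 = Id C (Cod C j)"
    "Comp C \<mu>0 k0 = Comp C j m"
    by (rule pushout_arrow[OF E0, of "Id C (Cod C j)" "Cod C j" "Comp C j m"])
      (use m in \<open>simp_all add: assoc\<close>)
  have triv: "is_pushout C j (Id C (Cod C s)) (Id C (Cod C j)) j"
    by (rule pushoutI) auto
  have M0: "is_pushout C k0 m \<mu>0 j"
    by (rule pushout_cancel[OF E0]) (use triv m \<mu>0 in simp_all)
  obtain n0 y0 where N: "is_pushout C c0 \<mu>0 n0 y0" using pushoutE[of c0 \<mu>0] \<mu>0 by auto
  note Ns = pushout_simps[OF N]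
  have y0: "y0 \<in> anodyne" by (rule anodyne_pushout[OF can(1) N])
  have dy0: "Dom C y0 = Cod C j" using Ns \<mu>0 by simp
  have y0w: "y0 \<in> weqs S" using c_weq[OF y0] cY' dy0 by simp
  have M: "is_pushout C m (Comp C c0 k0) (Comp C y0 j) n0"
    by (rule pushout_paste[OF pushout_sym[OF M0] pushout_sym[OF N]])
  obtain yy s'' where Y'': "is_pushout C s p yy s''" using pushoutE[of s p] r by auto
  note Ys = pushout_simps[OF Y'']
  have s''w: "s'' \<in> weqs S"
    using c_weq[OF anodyne_pushout[OF s Y'']] cS' Ys by simp
  have yyc: "yy \<in> cofs C S" by (rule cof_pushout[OF pc pushout_sym[OF Y'']])
  have cY'': "cofibrant C S (Cod C yy)" using cofibrant_cof[OF cY yyc] Ys by simp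
  have J: "is_pushout C j (Comp C s r) (Comp C s'' r') yy"
    by (rule pushout_paste[OF pushout_sym[OF po] pushout_sym[OF Y'']])
  obtain \<mu>1 where \<mu>1: "\<mu>1 \<in> hom C (Cod C e1) (Cod C yy)" "Comp C \<mu>1 e1 = Comp C s'' r'"
    "Comp C \<mu>1 k1 = Comp C yy m"
    by (rule pushout_arrow[OF E1, of "Comp C s'' r'" "Cod C yy" "Comp C yy m"])
      (use pushout_simps(9)[OF J] m Ys in \<open>simp_all add: assoc\<close>)
  have M1: "is_pushout C k1 m \<mu>1 yy"
    by (rule pushout_cancel[OF E1]) (use J m \<mu>1 in simp_all)
  obtain v where v: "v \<in> hom C (Cod C \<mu>1) (Cod C n0)" "Comp C v \<mu>1 = Comp C n0 c1"
    "Comp C v yy = Comp C y0 j"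
    by (rule pushout_arrow[OF M1, of "Comp C n0 c1" "Cod C n0" "Comp C y0 j"])
      (use pushout_simps(9)[OF M] Ns dy0 ck Ys in \<open>simp_all add: assoc\<close>)
  have "is_pushout C \<mu>1 c1 v n0"
    by (rule pushout_cancel[OF pushout_sym[OF M1]]) (use M v ck \<mu>1 pushout_simps[OF M1] in simp_all)
  then have "v \<in> anodyne" by (rule anodyne_pushout[OF can(2) pushout_sym])
  then have vw: "v \<in> weqs S" using c_weq cY'' v \<mu>1 by simp
  \<comment> \<open>both maps from \<open>Y'\<close> to the pushout of \<open>D'\<close> along \<open>m\<close> factor through the weak equivalence \<open>n0\<close>\<close>
  have "Comp C n0 (Comp C c0 e0) = Comp C y0 (Comp C \<mu>0 e0)"
    using Ns(1-8) \<mu>0(1) by (simp add: comp_reduce[OF Ns(9)] assoc)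
  then have "Comp C n0 (Comp C c0 e0) = y0"
    using \<mu>0(2) Ns dy0 by simp
  then have n0w: "n0 \<in> weqs S"
    using weq_right[OF cew(1), of n0] y0w Ns by simp
  have "Comp C v (Comp C s'' r') = Comp C n0 (Comp C c1 e1)"
    unfolding \<mu>1(2)[symmetric] using \<mu>1(1) v(1) Ns by (simp add: comp_reduce[OF v(2)] assoc)
  moreover have "Comp C n0 (Comp C c1 e1) \<in> weqs S"
    using weq_comp[OF cew(2) n0w] Ns by simp
  ultimately have "Comp C s'' r' \<in> weqs S"
    using weq_left[OF vw, of "Comp C s'' r'"] v \<mu>1 Ys by simp
  then show ?thesis
    using weq_left[OF s''w, of r'] Ys by simp
qed

text \<open>By \<open>brown_factorization\<close> a weak equivalence between cofibrant objects is an anodyne arrow followed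
  by a retraction of an anodyne arrow; pushouts of the former are anodyne and those of the latter
  are covered by \<open>retraction_proper\<close>.\<close>

lemma proper_on_cofibrant: "proper_on C S (cofibrant C S)"
  unfolding proper_on_def
proof (intro allI impI, elim conjE)
  fix w j p q
  assume w: "w \<in> weqs S" and j: "j \<in> cofs C S" and cof: "cofibrant C S (Dom C w)" "cofibrant C S (Cod C w)"
    and po: "is_pushout C w j p q"
  note P = pushout_simps[OF po]
  obtain y a b t where f: "a \<in> hom C (Dom C w) y" "b \<in> hom C (Cod C w) y" "t \<in> hom C y (Cod C w)"
    "a \<in> cofs C S" "b \<in> cofs C S" "t \<in> tfibs S" "Comp C t a = w" "Comp C t b = Id C (Cod C w)"
    using brown_factorization[OF P(1) cof] .
  have t: "t \<in> weqs S" using f(6) by (simp add: tfibs_def)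
  have "a \<in> weqs S" using weq_left[OF t, of a] f w by simp
  then have an_a: "a \<in> anodyne" using tcof_anodyne f cof by simp
  have "Id C (Cod C w) \<in> weqs S" using P by (intro iso_weq iso_id) simp
  then have "b \<in> weqs S" using weq_left[OF t, of b] f by simp
  then have an_b: "b \<in> anodyne" using tcof_anodyne f cof by simp
  have cy: "cofibrant C S y" using cofibrant_cof[OF cof(1) f(4)] f(1) by simp
  obtain p1 a' where A: "is_pushout C a j p1 a'" using pushoutE[of a j] f P by auto
  note As = pushout_simps[OF A]
  have "a' \<in> weqs S"
    using anodyne_weq[OF anodyne_pushout[OF an_a A]] cofibrant_cof[OF cof(1) j] As P by simp
  obtain p2 t' where T: "is_pushout C t p1 p2 t'" using pushoutE[of t p1] f As by auto
  note Ts = pushout_simps[OF T]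
  have "t' \<in> weqs S"
    by (rule retraction_proper[OF an_b _ _ _ _ _ _ cof_pushout[OF j pushout_sym[OF A]] T])
      (use f cof cy in simp_all)
  then have "Comp C t' a' \<in> weqs S" using weq_comp[OF \<open>a' \<in> weqs S\<close>] As Ts by simp
  moreover have "is_pushout C w j p2 (Comp C t' a')"
    using pushout_sym[OF pushout_paste[OF pushout_sym[OF A] pushout_sym[OF T]]] f(7) by simp
  then obtain h where "iso_arrow C h" "h \<in> hom C (Cod C (Comp C t' a')) (Cod C q)"
    "Comp C h (Comp C t' a') = q"
    using pushout_iso[OF _ po] by blast
  ultimately show "q \<in> weqs S"
    using weq_comp[of "Comp C t' a'" h] iso_weq[of h] by simp
qed

end

section \<open>The Grothendieck construction\<close>

locale indexed =
  fixes \<Phi> :: "('o, 'm, 'a, 'f) hindexed"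
  assumes indexed: "hindexed_category \<Phi>"
begin

abbreviation "B \<equiv> base \<Phi>"
abbreviation "F \<equiv> fiber \<Phi>"
abbreviation "T \<equiv> total_cat \<Phi>"

lemma category_B: "category B"
  and category_F: "x \<in> Obj B \<Longrightarrow> category (F x)"
  using indexed by (simp_all add: hindexed_category_def)

sublocale B: cat B by standard (rule category_B)

lemma cat_F: "x \<in> Obj B \<Longrightarrow> cat (F x)"
  by standard (rule category_F)

lemmas F_simps [simp] =
  cat.dom_obj[OF cat_F] cat.cod_obj[OF cat_F] cat.id_arr[OF cat_F] cat.id_dom[OF cat_F]
  cat.id_cod[OF cat_F] cat.comp_arr[OF cat_F] cat.comp_dom[OF cat_F] cat.comp_cod[OF cat_F]
  cat.id_right[OF cat_F] cat.id_left[OF cat_F]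

lemmas F_assoc = cat.assoc[OF cat_F]

lemma pull_functor:
  "\<phi> \<in> hom B x y \<Longrightarrow> is_functor (F y) (F x) (pull \<Phi> \<phi>)"
  using indexed by (auto simp: hindexed_category_def)

lemma pull_simps [simp]:
  assumes "\<phi> \<in> Arr B" "Dom B \<phi> = x" "Cod B \<phi> = y"
  shows "a \<in> Obj (F y) \<Longrightarrow> fobj (pull \<Phi> \<phi>) a \<in> Obj (F x)"
    and "f \<in> Arr (F y) \<Longrightarrow> farr (pull \<Phi> \<phi>) f \<in> Arr (F x)"
    and "f \<in> Arr (F y) \<Longrightarrow> Dom (F x) (farr (pull \<Phi> \<phi>) f) = fobj (pull \<Phi> \<phi>) (Dom (F y) f)"
    and "f \<in> Arr (F y) \<Longrightarrow> Cod (F x) (farr (pull \<Phi> \<phi>) f) = fobj (pull \<Phi> \<phi>) (Cod (F y) f)"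
    and "a \<in> Obj (F y) \<Longrightarrow> farr (pull \<Phi> \<phi>) (Id (F y) a) = Id (F x) (fobj (pull \<Phi> \<phi>) a)"
    and "f \<in> Arr (F y) \<Longrightarrow> g \<in> Arr (F y) \<Longrightarrow> Cod (F y) f = Dom (F y) g \<Longrightarrow>
      farr (pull \<Phi> \<phi>) (Comp (F y) g f) = Comp (F x) (farr (pull \<Phi> \<phi>) g) (farr (pull \<Phi> \<phi>) f)"
  using functor_simps[OF pull_functor[of \<phi> x y]] assms by simp_all

lemma pull_id [simp]:
  "x \<in> Obj B \<Longrightarrow> a \<in> Obj (F x) \<Longrightarrow> fobj (pull \<Phi> (Id B x)) a = a"
  "x \<in> Obj B \<Longrightarrow> f \<in> Arr (F x) \<Longrightarrow> farr (pull \<Phi> (Id B x)) f = f"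
  using indexed by (simp_all add: hindexed_category_def)

lemma pull_comp [simp]:
  assumes "\<phi> \<in> Arr B" "\<psi> \<in> Arr B" "Cod B \<phi> = Dom B \<psi>" "Cod B \<psi> = z"
  shows "a \<in> Obj (F z) \<Longrightarrow>
      fobj (pull \<Phi> (Comp B \<psi> \<phi>)) a = fobj (pull \<Phi> \<phi>) (fobj (pull \<Phi> \<psi>) a)"
    and "f \<in> Arr (F z) \<Longrightarrow>
      farr (pull \<Phi> (Comp B \<psi> \<phi>)) f = farr (pull \<Phi> \<phi>) (farr (pull \<Phi> \<psi>) f)"
  using indexed assms by (simp_all add: hindexed_category_def)

lemma total_obj [simp]: "(x, a) \<in> Obj T \<longleftrightarrow> x \<in> Obj B \<and> a \<in> Obj (F x)"
  by (simp add: total_cat_def)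

lemma total_arr [simp]:
  "((x, a), (\<phi>, f), (y, b)) \<in> Arr T \<longleftrightarrow>
     a \<in> Obj (F x) \<and> b \<in> Obj (F y) \<and> \<phi> \<in> hom B x y \<and> f \<in> hom (F x) a (fobj (pull \<Phi> \<phi>) b)"
  by (auto simp: total_cat_def)

lemma total_simps [simp]:
  "Dom T (d, h, c) = d"
  "Cod T (d, h, c) = c"
  "Id T (x, a) = ((x, a), (Id B x, Id (F x) a), (x, a))"
  "Comp T (d', (\<psi>, g), c') ((x, a), (\<phi>, f), c) =
     ((x, a), (Comp B \<psi> \<phi>, Comp (F x) (farr (pull \<Phi> \<phi>) g) f), c')"
  by (simp_all add: total_cat_def)

lemma total_homE:
  assumes "h \<in> hom T (x, a) (y, b)"
  obtains \<phi> f where "h = ((x, a), (\<phi>, f), (y, b))" "\<phi> \<in> Arr B" "Dom B \<phi> = x" "Cod B \<phi> = y"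
    "x \<in> Obj B" "y \<in> Obj B" "a \<in> Obj (F x)" "b \<in> Obj (F y)"
    "f \<in> Arr (F x)" "Dom (F x) f = a" "Cod (F x) f = fobj (pull \<Phi> \<phi>) b"
proof -
  obtain \<phi> f where h: "h = ((x, a), (\<phi>, f), (y, b))" using assms by (cases h) auto
  then have "\<phi> \<in> Arr B" "Dom B \<phi> = x" "Cod B \<phi> = y" using assms by simp_all
  moreover from this have "x \<in> Obj B" "y \<in> Obj B" by auto
  ultimately show ?thesis using that[OF h] assms h by simp
qed

lemma total_arrE:
  assumes "h \<in> Arr T"
  obtains x a \<phi> f y b where "h = ((x, a), (\<phi>, f), (y, b))" "\<phi> \<in> Arr B" "Dom B \<phi> = x" "Cod B \<phi> = y"
    "x \<in> Obj B" "y \<in> Obj B" "a \<in> Obj (F x)" "b \<in> Obj (F y)"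
    "f \<in> Arr (F x)" "Dom (F x) f = a" "Cod (F x) f = fobj (pull \<Phi> \<phi>) b"
proof -
  obtain x a y b where "h \<in> hom T (x, a) (y, b)" using assms by (cases "Dom T h"; cases "Cod T h") auto
  then show ?thesis by (rule total_homE) (rule that)
qed

lemma category_T: "category T"
  unfolding category_def
proof (intro conjI ballI impI)
  fix h assume h: "h \<in> Arr T"
  then show "Dom T h \<in> Obj T" "Cod T h \<in> Obj T" by (auto elim!: total_arrE)
  show "Comp T h (Id T (Dom T h)) = h" "Comp T (Id T (Cod T h)) h = h"
    using h by (auto elim!: total_arrE)
  fix k assume k: "k \<in> Arr T"
  show "Comp T k h \<in> hom T (Dom T h) (Cod T k)" if "Cod T h = Dom T k"
    using h k that by (auto elim!: total_arrE)
  fix l assume l: "l \<in> Arr T"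
  show "Comp T l (Comp T k h) = Comp T (Comp T l k) h" if "Cod T h = Dom T k \<and> Cod T k = Dom T l"
    using h k l that by (auto elim!: total_arrE simp: B.assoc F_assoc)
qed auto

sublocale T: cat T by standard (rule category_T)

definition vertical :: "'o \<Rightarrow> 'f \<Rightarrow> ('o, 'm, 'a, 'f) tot_arr" where
  "vertical x f = ((x, Dom (F x) f), (Id B x, f), (x, Cod (F x) f))"

lemma vertical_simps [simp]:
  "Dom T (vertical x f) = (x, Dom (F x) f)"
  "Cod T (vertical x f) = (x, Cod (F x) f)"
  "x \<in> Obj B \<Longrightarrow> f \<in> Arr (F x) \<Longrightarrow> vertical x f \<in> Arr T"
  by (simp_all add: vertical_def)

lemma vertical_comp:
  assumes "x \<in> Obj B" "f \<in> Arr (F x)" "g \<in> Arr (F x)" "Cod (F x) f = Dom (F x) g"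
  shows "vertical x (Comp (F x) g f) = Comp T (vertical x g) (vertical x f)"
  using assms by (simp add: vertical_def)

lemma vertical_id: "x \<in> Obj B \<Longrightarrow> a \<in> Obj (F x) \<Longrightarrow> vertical x (Id (F x) a) = Id T (x, a)"
  by (simp add: vertical_def)

definition cartesian :: "'m \<Rightarrow> 'a \<Rightarrow> ('o, 'm, 'a, 'f) tot_arr" where
  "cartesian \<phi> b = ((Dom B \<phi>, fobj (pull \<Phi> \<phi>) b),
     (\<phi>, Id (F (Dom B \<phi>)) (fobj (pull \<Phi> \<phi>) b)), (Cod B \<phi>, b))"

lemma cartesian_simps [simp]:
  "Dom T (cartesian \<phi> b) = (Dom B \<phi>, fobj (pull \<Phi> \<phi>) b)"
  "Cod T (cartesian \<phi> b) = (Cod B \<phi>, b)"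
  "\<phi> \<in> Arr B \<Longrightarrow> b \<in> Obj (F (Cod B \<phi>)) \<Longrightarrow> cartesian \<phi> b \<in> Arr T"
  by (simp_all add: cartesian_def)

text \<open>An arrow into \<open>(x, \<phi>\<^sup>* a)\<close> amounts to an arrow into \<open>(y, a)\<close> together with a factorization of its base
  through \<open>\<phi>\<close>.\<close>

lemma pullback_square:
  assumes \<phi>: "\<phi> \<in> hom B x y" and f: "f \<in> hom (F y) a b"
  shows "is_pullback T (vertical y f) (cartesian \<phi> b) (cartesian \<phi> a)
    (vertical x (farr (pull \<Phi> \<phi>) f))"
proof -
  have o [simp]: "x \<in> Obj B" "y \<in> Obj B" "a \<in> Obj (F y)" "b \<in> Obj (F y)" "\<phi> \<in> Arr B" "Dom B \<phi> = x"
    "Cod B \<phi> = y" "f \<in> Arr (F y)" "Dom (F y) f = a" "Cod (F y) f = b"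
  proof -
    show 1: "\<phi> \<in> Arr B" "Dom B \<phi> = x" "Cod B \<phi> = y" "f \<in> Arr (F y)" "Dom (F y) f = a" "Cod (F y) f = b"
      using assms by simp_all
    show 2: "x \<in> Obj B" "y \<in> Obj B" using B.dom_obj[of \<phi>] B.cod_obj[of \<phi>] 1 by simp_all
    show "a \<in> Obj (F y)" "b \<in> Obj (F y)"
      using cat.dom_obj[OF cat_F[OF 2(2)], of f] cat.cod_obj[OF cat_F[OF 2(2)], of f] 1 by simp_all
  qed
  have universal: "\<exists>!h. h \<in> hom T p (x, fobj (pull \<Phi> \<phi>) a) \<and> Comp T (cartesian \<phi> a) h = k \<and>
      Comp T (vertical x (farr (pull \<Phi> \<phi>) f)) h = l"
    if k: "k \<in> hom T p (y, a)" and l: "l \<in> hom T p (x, fobj (pull \<Phi> \<phi>) b)"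
      and e: "Comp T (vertical y f) k = Comp T (cartesian \<phi> b) l" for p k l
  proof -
    obtain z c where p: "p = (z, c)" by (cases p)
    obtain \<kappa> k' where k': "k = ((z, c), (\<kappa>, k'), (y, a))" "\<kappa> \<in> Arr B" "Dom B \<kappa> = z" "Cod B \<kappa> = y"
      "z \<in> Obj B" "y \<in> Obj B" "c \<in> Obj (F z)" "a \<in> Obj (F y)"
      "k' \<in> Arr (F z)" "Dom (F z) k' = c" "Cod (F z) k' = fobj (pull \<Phi> \<kappa>) a"
      using total_homE[of k z c y a] k p by metis
    obtain \<nu> l' where l': "l = ((z, c), (\<nu>, l'), (x, fobj (pull \<Phi> \<phi>) b))" "\<nu> \<in> Arr B" "Dom B \<nu> = z"
      "Cod B \<nu> = x"
      "l' \<in> Arr (F z)" "Dom (F z) l' = c" "Cod (F z) l' = fobj (pull \<Phi> \<nu>) (fobj (pull \<Phi> \<phi>) b)"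
      using total_homE[of l z c x "fobj (pull \<Phi> \<phi>) b"] l p by metis
    have "Comp B (Id B y) \<kappa> = Comp B \<phi> \<nu> \<and> Comp (F z) (farr (pull \<Phi> \<kappa>) f) k' =
        Comp (F z) (farr (pull \<Phi> \<nu>) (Id (F x) (fobj (pull \<Phi> \<phi>) b))) l'"
      using e by (simp add: k'(1) l'(1) vertical_def cartesian_def)
    then have e': "\<kappa> = Comp B \<phi> \<nu>" "Comp (F z) (farr (pull \<Phi> \<kappa>) f) k' = l'"
      using k'(2-4,5) l'(2-) by auto
    have kl: "Comp (F z) (farr (pull \<Phi> \<nu>) (farr (pull \<Phi> \<phi>) f)) k' = l'"
      using e'(2) l'(2-4) unfolding e'(1) by simp
    have kc: "Cod (F z) k' = fobj (pull \<Phi> \<nu>) (fobj (pull \<Phi> \<phi>) a)"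
      using k'(11) l' by (simp add: e'(1))
    show ?thesis
    proof (rule ex1I[of _ "((z, c), (\<nu>, k'), (x, fobj (pull \<Phi> \<phi>) a))"])
      show "((z, c), (\<nu>, k'), (x, fobj (pull \<Phi> \<phi>) a)) \<in> hom T p (x, fobj (pull \<Phi> \<phi>) a) \<and>
        Comp T (cartesian \<phi> a) ((z, c), (\<nu>, k'), (x, fobj (pull \<Phi> \<phi>) a)) = k \<and>
        Comp T (vertical x (farr (pull \<Phi> \<phi>) f)) ((z, c), (\<nu>, k'), (x, fobj (pull \<Phi> \<phi>) a)) = l"
        using k'(1,5,7,9,10) l'(1-4) kc kl by (simp add: p vertical_def cartesian_def e'(1))
    next
      fix h assume h: "h \<in> hom T p (x, fobj (pull \<Phi> \<phi>) a) \<and> Comp T (cartesian \<phi> a) h = k \<and>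
        Comp T (vertical x (farr (pull \<Phi> \<phi>) f)) h = l"
      then obtain \<mu> h' where h': "h = ((z, c), (\<mu>, h'), (x, fobj (pull \<Phi> \<phi>) a))" "\<mu> \<in> Arr B"
        "Dom B \<mu> = z" "Cod B \<mu> = x"
        "h' \<in> Arr (F z)" "Dom (F z) h' = c" "Cod (F z) h' = fobj (pull \<Phi> \<mu>) (fobj (pull \<Phi> \<phi>) a)"
        using total_homE[of h z c x "fobj (pull \<Phi> \<phi>) a"] p by metis
      then show "h = ((z, c), (\<nu>, k'), (x, fobj (pull \<Phi> \<phi>) a))"
        using h k'(1,5) l'(1) by (simp add: vertical_def cartesian_def)
    qed
  qed
  show ?thesis
    unfolding is_pullback_def
  proof (intro conjI allI ballI impI)
    fix p k l
    assume "k \<in> hom T p (Dom T (vertical y f))" "l \<in> hom T p (Dom T (cartesian \<phi> b))"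
      "Comp T (vertical y f) k = Comp T (cartesian \<phi> b) l"
    then show "\<exists>!h. h \<in> hom T p (Dom T (cartesian \<phi> a)) \<and> Comp T (cartesian \<phi> a) h = k \<and>
        Comp T (vertical x (farr (pull \<Phi> \<phi>) f)) h = l"
      using universal[of k p l] by simp
  next
    show "Comp T (vertical y f) (cartesian \<phi> a) =
        Comp T (cartesian \<phi> b) (vertical x (farr (pull \<Phi> \<phi>) f))"
      by (simp add: vertical_def cartesian_def)
  qed simp_all
qed

end

text \<open>The universal property of \<open>vertical_reflection\<close> only concerns arrows over a fixed base.\<close>

definition base_of :: "('o, 'm, 'a, 'f) tot_arr \<Rightarrow> 'm" where
  "base_of h = fst (fst (snd h))"

lemma base_of_simp [simp]: "base_of (d, (\<phi>, f), c) = \<phi>"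
  by (simp add: base_of_def)

lemma (in indexed) base_of_comp:
  "h \<in> Arr T \<Longrightarrow> k \<in> Arr T \<Longrightarrow> Cod T h = Dom T k \<Longrightarrow>
    base_of (Comp T k h) = Comp B (base_of k) (base_of h)"
  by (auto elim!: total_arrE)

lemma (in indexed) base_of_vertical [simp]: "base_of (vertical x f) = Id B x"
  by (simp add: vertical_def)

lemma (in indexed) id_comp_base_of: "h \<in> hom T e (x, a) \<Longrightarrow> Comp B (Id B x) (base_of h) = base_of h"
  by (cases e) (auto elim!: total_homE simp del: in_hom)

section \<open>Left adjoints to the restriction functors\<close>

lemma adjunction_from_universal_arrows:
  assumes "category C" "category D" "is_functor D C R"
    and "\<And>a. a \<in> Obj C \<Longrightarrow> \<exists>b\<in>Obj D. \<exists>u\<in>hom C a (fobj R b). \<forall>d\<in>Obj D. \<forall>f\<in>hom C a (fobj R d).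
      \<exists>!g. g \<in> hom D b d \<and> Comp C (farr R g) u = f"
  shows "\<exists>L \<eta>. adjunction C D L R \<eta>"
proof -
  interpret C: cat C by standard (rule assms)
  interpret D: cat D by standard (rule assms)
  note R [simp] = functor_simps[OF assms(3)]
  obtain l \<eta> where lu: "\<And>a. a \<in> Obj C \<Longrightarrow> l a \<in> Obj D"
      "\<And>a. a \<in> Obj C \<Longrightarrow> \<eta> a \<in> hom C a (fobj R (l a))"
    and ex: "\<And>a d f. a \<in> Obj C \<Longrightarrow> d \<in> Obj D \<Longrightarrow> f \<in> hom C a (fobj R d) \<Longrightarrow>
      \<exists>!g. g \<in> hom D (l a) d \<and> Comp C (farr R g) (\<eta> a) = f"
    using assms(4) by metis
  have \<eta> [simp]: "\<eta> a \<in> Arr C" "Dom C (\<eta> a) = a" "Cod C (\<eta> a) = fobj R (l a)" if "a \<in> Obj C" for a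
    using lu(2)[OF that] by simp_all
  have uniq: "g = h" if "a \<in> Obj C" "g \<in> Arr D" "h \<in> Arr D" "Dom D g = l a" "Dom D h = l a"
    "Cod D g = Cod D h" "Comp C (farr R g) (\<eta> a) = Comp C (farr R h) (\<eta> a)" for a g h
  proof -
    have "Comp C (farr R g) (\<eta> a) \<in> hom C a (fobj R (Cod D g))" using that by simp
    from ex[OF that(1) _ this] show ?thesis by (rule ex1E) (use that in auto)
  qed
  define la where "la f = (THE g. g \<in> hom D (l (Dom C f)) (l (Cod C f)) \<and>
    Comp C (farr R g) (\<eta> (Dom C f)) = Comp C (\<eta> (Cod C f)) f)" for f
  have la: "la f \<in> hom D (l (Dom C f)) (l (Cod C f)) \<and>
      Comp C (farr R (la f)) (\<eta> (Dom C f)) = Comp C (\<eta> (Cod C f)) f" if "f \<in> Arr C" for f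
    unfolding la_def by (rule theI'[OF ex]) (use that lu in simp_all)
  then have las [simp]: "la f \<in> Arr D" "Dom D (la f) = l (Dom C f)" "Cod D (la f) = l (Cod C f)"
    "Comp C (farr R (la f)) (\<eta> (Dom C f)) = Comp C (\<eta> (Cod C f)) f" if "f \<in> Arr C" for f
    using that by simp_all
  define L where "L = \<lparr>fobj = l, farr = la\<rparr>"
  have "is_functor C D L"
    unfolding is_functor_def
  proof (intro conjI ballI impI)
    fix a assume a: "a \<in> Obj C"
    show "farr L (Id C a) = Id D (fobj L a)"
      by (rule uniq[of a]) (use a las(4)[of "Id C a"] lu in \<open>simp_all add: L_def\<close>)
  next
    fix f g assume fg: "f \<in> Arr C" "g \<in> Arr C" "Cod C f = Dom C g"
    have "Comp C (Comp C (farr R (la g)) (farr R (la f))) (\<eta> (Dom C f)) =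
        Comp C (Comp C (farr R (la g)) (\<eta> (Dom C g))) f"
      using fg las(4)[OF fg(1)] lu(1) by (simp add: C.assoc del: las(4))
    also have "\<dots> = Comp C (\<eta> (Cod C g)) (Comp C g f)"
      using fg las(4)[OF fg(2)] by (simp add: C.assoc)
    finally show "farr L (Comp C g f) = Comp D (farr L g) (farr L f)"
      by (intro uniq[of "Dom C f"]) (use fg las(4)[of "Comp C g f"] in \<open>simp_all add: L_def\<close>)
  qed (auto simp: L_def lu)
  moreover have "nat_trans C C id_functor (comp_functor R L) \<eta>"
    by (simp add: nat_trans_def L_def)
  moreover have "\<exists>!g. g \<in> hom D (fobj L a) b \<and> Comp C (farr R g) (\<eta> a) = f"
    if "a \<in> Obj C" "b \<in> Obj D" "f \<in> hom C a (fobj R b)" for a b f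
    using ex[OF that] by (simp add: L_def)
  ultimately have "adjunction C D L R \<eta>"
    using assms(3) unfolding adjunction_def by blast
  then show ?thesis by blast
qed

locale indexed_initial = indexed \<Phi> for \<Phi> :: "('o, 'm, 'a, 'f) hindexed" +
  fixes i :: "'o \<Rightarrow> 'a"
  assumes initial: "x \<in> Obj (base \<Phi>) \<Longrightarrow> initial_object (fiber \<Phi> x) (i x)"
begin

definition ini :: "'o \<Rightarrow> 'a \<Rightarrow> 'f" where
  "ini x a = (THE f. f \<in> hom (F x) (i x) a)"

lemma initial_obj [simp]: "x \<in> Obj B \<Longrightarrow> i x \<in> Obj (F x)"
  using initial by (simp add: initial_object_def)

lemma ini_simps [simp]:
  assumes "x \<in> Obj B" "a \<in> Obj (F x)"
  shows "ini x a \<in> Arr (F x)" "Dom (F x) (ini x a) = i x" "Cod (F x) (ini x a) = a"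
proof -
  have "\<exists>!f. f \<in> hom (F x) (i x) a"
    using initial[OF assms(1)] assms(2) by (simp add: initial_object_def)
  from theI'[OF this] show "ini x a \<in> Arr (F x)" "Dom (F x) (ini x a) = i x" "Cod (F x) (ini x a) = a"
    by (simp_all add: ini_def)
qed

lemma ini_unique:
  assumes "x \<in> Obj B" "f \<in> Arr (F x)" "Dom (F x) f = i x" "Cod (F x) f = a"
  shows "f = ini x a"
proof -
  have a: "a \<in> Obj (F x)" using assms cat.cod_obj[OF cat_F] by blast
  show ?thesis by (rule initial_unique[OF initial[OF assms(1)]]) (use assms a in simp_all)
qed

text \<open>The comparison arrow \<open>i x \<rightarrow> \<phi>\<^sup>*(i y)\<close> of the theorem appears as \<open>over \<phi> (i y)\<close>, and the arrow from \<open>(x, i x)\<close> to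
  \<open>(x, a)\<close> in a fibre as \<open>over (Id B x) a\<close>. Composites of these arrows are determined by their bases.\<close>

definition over :: "'m \<Rightarrow> 'a \<Rightarrow> ('o, 'm, 'a, 'f) tot_arr" where
  "over \<phi> b = ((Dom B \<phi>, i (Dom B \<phi>)), (\<phi>, ini (Dom B \<phi>) (fobj (pull \<Phi> \<phi>) b)), (Cod B \<phi>, b))"

lemma over_simps [simp]:
  "Dom T (over \<phi> b) = (Dom B \<phi>, i (Dom B \<phi>))"
  "Cod T (over \<phi> b) = (Cod B \<phi>, b)"
  "\<phi> \<in> Arr B \<Longrightarrow> b \<in> Obj (F (Cod B \<phi>)) \<Longrightarrow> over \<phi> b \<in> Arr T"
  by (simp_all add: over_def)

lemma over_unique:
  assumes "((x, i x), (\<phi>, f), (y, b)) \<in> Arr T"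
  shows "((x, i x), (\<phi>, f), (y, b)) = over \<phi> b"
  using assms ini_unique[of x f] B.dom_obj[of \<phi>] by (auto simp: over_def)

lemma over_id: "x \<in> Obj B \<Longrightarrow> over (Id B x) (i x) = Id T (x, i x)"
  using over_unique[of x "Id B x" "Id (F x) (i x)" x "i x"] by simp

lemma comp_over:
  assumes "((y, b), (\<psi>, g), (z, c)) \<in> Arr T" "\<phi> \<in> Arr B" "Cod B \<phi> = y"
  shows "Comp T ((y, b), (\<psi>, g), (z, c)) (over \<phi> b) = over (Comp B \<psi> \<phi>) c"
proof -
  have 1: "Comp T ((y, b), (\<psi>, g), (z, c)) (over \<phi> b) \<in> Arr T"
    using assms by (intro T.comp_arr) simp_all
  then show ?thesis
    unfolding over_def total_simps by (subst over_unique) (simp_all add: over_def)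
qed

lemma over_comp_over:
  assumes "\<phi> \<in> Arr B" "\<psi> \<in> Arr B" "Cod B \<phi> = Dom B \<psi>" "c \<in> Obj (F (Cod B \<psi>))"
  shows "Comp T (over \<psi> c) (over \<phi> (i (Dom B \<psi>))) = over (Comp B \<psi> \<phi>) c"
  using comp_over[of "Dom B \<psi>" "i (Dom B \<psi>)" \<psi> _ "Cod B \<psi>" c \<phi>] over_simps(3)[of \<psi> c] assms
  unfolding over_def[of \<psi> c] by simp

text \<open>The pushout \<open>(z, b)\<close> of \<open>(y, i y) \<leftarrow> (x, i x) \<rightarrow> (x, a)\<close> represents the arrows from \<open>a\<close> to \<open>\<phi>\<^sup>* d\<close>
  provided that the base \<open>\<kappa> : y \<rightarrow> z\<close> of its leg is invertible. To invert \<open>\<kappa>\<close>, map the pushout to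
  \<open>(y, \<kappa>\<^sup>* b)\<close> by the universal cocone itself: the base \<open>\<nu>\<close> of this map is a retraction of \<open>\<kappa>\<close>, and
  composing it with the cartesian arrow over \<open>\<kappa>\<close> gives an endomorphism of the pushout that fixes
  the cocone, hence the identity. The left adjoint of \<open>\<phi>\<^sup>*\<close> sends \<open>a\<close> to \<open>\<kappa>\<^sup>* b\<close>.\<close>

lemma left_adjoint_exists:
  assumes "has_pushouts T" and \<phi>: "\<phi> \<in> hom B x y"
  shows "\<exists>L \<eta>. adjunction (F x) (F y) L (pull \<Phi> \<phi>) \<eta>"
proof (rule adjunction_from_universal_arrows)
  have [simp]: "\<phi> \<in> Arr B" "Dom B \<phi> = x" "Cod B \<phi> = y" using \<phi> by simp_all
  have [simp]: "x \<in> Obj B" "y \<in> Obj B" using B.dom_obj[of \<phi>] B.cod_obj[of \<phi>] by simp_all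
  show "category (F x)" "category (F y)" by (simp_all add: category_F)
  show "is_functor (F y) (F x) (pull \<Phi> \<phi>)" by (rule pull_functor[OF \<phi>])
  fix a assume a [simp]: "a \<in> Obj (F x)"
  obtain p q where po: "is_pushout T (over (Id B x) a) (over \<phi> (i y)) p q"
  proof -
    have "over (Id B x) a \<in> Arr T" "over \<phi> (i y) \<in> Arr T"
      "Dom T (over (Id B x) a) = Dom T (over \<phi> (i y))" by simp_all
    then show ?thesis using assms(1) that unfolding has_pushouts_def by blast
  qed
  note P = pushout_simps[OF po]
  obtain z b where zb: "Cod T p = (z, b)" by (cases "Cod T p")
  have "p \<in> hom T (x, a) (z, b)" "q \<in> hom T (y, i y) (z, b)"
    using P zb by simp_all
  then obtain \<pi> u \<kappa> v where p: "p = ((x, a), (\<pi>, u), (z, b))" and q: "q = ((y, i y), (\<kappa>, v), (z, b))"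
    and [simp]: "\<pi> \<in> Arr B" "Dom B \<pi> = x" "Cod B \<pi> = z" "\<kappa> \<in> Arr B" "Dom B \<kappa> = y" "Cod B \<kappa> = z"
      "z \<in> Obj B" "b \<in> Obj (F z)" "u \<in> Arr (F x)" "Dom (F x) u = a"
    and u: "Cod (F x) u = fobj (pull \<Phi> \<pi>) b"
    by (elim total_homE) blast
  have qo: "q = over \<kappa> b" using over_unique[of y \<kappa> v z b] P(4) q by simp
  have \<pi>: "\<pi> = Comp B \<kappa> \<phi>"
    using P(9) by (simp add: p q over_def)
  have u' [simp]: "Cod (F x) u = fobj (pull \<Phi> \<phi>) (fobj (pull \<Phi> \<kappa>) b)" using u by (simp add: \<pi>)
  have mediate: "\<exists>\<mu> k. ((z, b), (\<mu>, k), (y, d)) \<in> Arr T \<and> Comp B \<mu> \<kappa> = Id B y \<and>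
      Comp (F x) (farr (pull \<Phi> \<pi>) k) u = f"
    if [simp]: "d \<in> Obj (F y)" and f: "f \<in> hom (F x) a (fobj (pull \<Phi> \<phi>) d)" for d f
  proof -
    have fa: "((x, a), (\<phi>, f), (y, d)) \<in> Arr T" using f by simp
    have e: "Comp T ((x, a), (\<phi>, f), (y, d)) (over (Id B x) a) = Comp T (over (Id B y) d) (over \<phi> (i y))"
      using comp_over[OF fa, of "Id B x"] over_comp_over[of \<phi> "Id B y" d] by simp
    obtain h where h: "h \<in> hom T (z, b) (y, d)" "Comp T h p = ((x, a), (\<phi>, f), (y, d))"
      "Comp T h q = over (Id B y) d"
      by (rule pushout_arrow[OF po _ _ e, of "(y, d)"]) (use fa zb in simp_all)
    then obtain \<mu> k where k: "h = ((z, b), (\<mu>, k), (y, d))" by (elim total_homE)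
    then show ?thesis using h by (auto simp: p q over_def)
  qed
  define e where "e = fobj (pull \<Phi> \<kappa>) b"
  have e [simp]: "e \<in> Obj (F y)" by (simp add: e_def)
  obtain \<nu> g where \<nu>: "((z, b), (\<nu>, g), (y, e)) \<in> Arr T" "Comp B \<nu> \<kappa> = Id B y"
    "Comp (F x) (farr (pull \<Phi> \<pi>) g) u = u"
    using mediate[of e u] by (auto simp: e_def)
  then have [simp]: "\<nu> \<in> Arr B" "Dom B \<nu> = z" "Cod B \<nu> = y" by simp_all
  have \<nu>\<pi>: "Comp B \<nu> \<pi> = \<phi>" using \<nu>(2) by (simp add: \<pi> B.comp_reduce)
  have \<kappa>\<nu>: "Comp B \<kappa> \<nu> = Id B z"
  proof -
    let ?h = "((z, b), (\<nu>, g), (y, e))"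
    have c: "cartesian \<kappa> b \<in> hom T (y, e) (z, b)" by (simp add: e_def)
    have "Comp T (cartesian \<kappa> b) ?h = Id T (z, b)"
    proof (rule pushout_unique[OF category_T po, of _ "(z, b)"])
      show "Comp T (Comp T (cartesian \<kappa> b) ?h) p = Comp T (Id T (z, b)) p"
        using \<nu> by (simp add: p cartesian_def e_def[symmetric] B.assoc \<nu>\<pi> \<pi>[symmetric] u del: u')
      have "Comp T (Comp T (cartesian \<kappa> b) ?h) q = Comp T (cartesian \<kappa> b) (over (Id B y) e)"
        using \<nu>(1,2) c comp_over[OF \<nu>(1), of \<kappa>] by (simp add: T.assoc qo del: total_simps(4))
      also have "\<dots> = over \<kappa> b"
        using comp_over[of y e \<kappa> _ z b "Id B y"] c by (simp add: cartesian_def e_def[symmetric])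
      finally show "Comp T (Comp T (cartesian \<kappa> b) ?h) q = Comp T (Id T (z, b)) q"
        using P(4) by (simp add: qo del: total_simps)
    qed (use \<nu>(1) c zb in simp_all)
    then show ?thesis by (simp add: cartesian_def)
  qed
  have b: "b = fobj (pull \<Phi> \<nu>) e" using pull_comp(1)[of \<nu> \<kappa> z b] by (simp add: \<kappa>\<nu> e_def)
  show "\<exists>e\<in>Obj (F y). \<exists>u\<in>hom (F x) a (fobj (pull \<Phi> \<phi>) e). \<forall>d\<in>Obj (F y).
      \<forall>f\<in>hom (F x) a (fobj (pull \<Phi> \<phi>) d). \<exists>!g. g \<in> hom (F y) e d \<and> Comp (F x) (farr (pull \<Phi> \<phi>) g) u = f"
  proof (intro bexI ballI)
    show "e \<in> Obj (F y)" "u \<in> hom (F x) a (fobj (pull \<Phi> \<phi>) e)" by (simp_all add: e_def)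
    fix d f assume d [simp]: "d \<in> Obj (F y)" and f: "f \<in> hom (F x) a (fobj (pull \<Phi> \<phi>) d)"
    obtain \<mu> k where k: "((z, b), (\<mu>, k), (y, d)) \<in> Arr T" "Comp B \<mu> \<kappa> = Id B y"
      "Comp (F x) (farr (pull \<Phi> \<pi>) k) u = f"
      using mediate[OF d f] by blast
    have [simp]: "\<mu> \<in> Arr B" "Dom B \<mu> = z" "Cod B \<mu> = y" "k \<in> Arr (F z)" "Dom (F z) k = b"
      "Cod (F z) k = fobj (pull \<Phi> \<mu>) d" using k(1) by simp_all
    have \<mu>: "fobj (pull \<Phi> \<kappa>) (fobj (pull \<Phi> \<mu>) d) = d"
      using pull_comp(1)[of \<kappa> \<mu> y d] k(2) by simp
    show "\<exists>!g. g \<in> hom (F y) e d \<and> Comp (F x) (farr (pull \<Phi> \<phi>) g) u = f"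
    proof (rule ex1I[of _ "farr (pull \<Phi> \<kappa>) k"])
      show "farr (pull \<Phi> \<kappa>) k \<in> hom (F y) e d \<and> Comp (F x) (farr (pull \<Phi> \<phi>) (farr (pull \<Phi> \<kappa>) k)) u = f"
        using k(3) by (simp add: \<mu> e_def \<pi>)
      fix g assume g: "g \<in> hom (F y) e d \<and> Comp (F x) (farr (pull \<Phi> \<phi>) g) u = f"
      have reindexed: "farr (pull \<Phi> \<nu>) l \<in> hom (F z) b (fobj (pull \<Phi> \<nu>) d)" if "l \<in> hom (F y) e d" for l
        using that b by simp
      have "((z, b), (\<nu>, farr (pull \<Phi> \<nu>) g), (y, d)) =
          ((z, b), (\<nu>, farr (pull \<Phi> \<nu>) (farr (pull \<Phi> \<kappa>) k)), (y, d))"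
      proof (rule pushout_unique[OF category_T po, of _ "(y, d)"])
        have \<nu>\<pi>f: "farr (pull \<Phi> \<pi>) (farr (pull \<Phi> \<nu>) l) = farr (pull \<Phi> \<phi>) l" if "l \<in> Arr (F y)" for l
          using pull_comp(2)[of \<pi> \<nu> y l] that \<nu>\<pi> by simp
        show "Comp T ((z, b), (\<nu>, farr (pull \<Phi> \<nu>) g), (y, d)) p =
            Comp T ((z, b), (\<nu>, farr (pull \<Phi> \<nu>) (farr (pull \<Phi> \<kappa>) k)), (y, d)) p"
          using g k(3) \<nu>\<pi>f by (simp add: p \<nu>\<pi>) (simp add: \<pi>)
        show "Comp T ((z, b), (\<nu>, farr (pull \<Phi> \<nu>) g), (y, d)) q =
            Comp T ((z, b), (\<nu>, farr (pull \<Phi> \<nu>) (farr (pull \<Phi> \<kappa>) k)), (y, d)) q"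
          unfolding qo using g reindexed[of g] reindexed[of "farr (pull \<Phi> \<kappa>) k"] \<mu>
          by (subst (1 2) comp_over) (simp_all add: e_def)
      qed (use g reindexed[of g] reindexed[of "farr (pull \<Phi> \<kappa>) k"] \<mu> zb in \<open>simp_all add: e_def\<close>)
      then have "farr (pull \<Phi> \<kappa>) (farr (pull \<Phi> \<nu>) g) =
          farr (pull \<Phi> \<kappa>) (farr (pull \<Phi> \<nu>) (farr (pull \<Phi> \<kappa>) k))" by simp
      moreover have "farr (pull \<Phi> \<kappa>) (farr (pull \<Phi> \<nu>) l) = l" if "l \<in> Arr (F y)" for l
        using pull_comp(2)[of \<kappa> \<nu> y l] that \<nu>(2) by simp
      ultimately show "g = farr (pull \<Phi> \<kappa>) k" using g by simp
    qed
  qed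
qed

text \<open>A cocone on the span is an arrow \<open>\<kappa> : y \<rightarrow> z\<close> with an arrow \<open>a \<rightarrow> \<phi>\<^sup>*(\<kappa>\<^sup>* c)\<close>, and the latter transposes
  to \<open>\<phi>\<^sub>! a \<rightarrow> \<kappa>\<^sup>* c\<close>.\<close>

lemma adjunction_pushout:
  assumes adj: "adjunction (F x) (F y) L (pull \<Phi> \<phi>) \<eta>" and \<phi>: "\<phi> \<in> hom B x y"
    and a [simp]: "a \<in> Obj (F x)"
  shows "is_pushout T (over \<phi> (i y)) (over (Id B x) a) (over (Id B y) (fobj L a))
    ((x, a), (\<phi>, \<eta> a), (y, fobj L a))"
proof -
  have [simp]: "\<phi> \<in> Arr B" "Dom B \<phi> = x" "Cod B \<phi> = y" using \<phi> by simp_all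
  have [simp]: "x \<in> Obj B" "y \<in> Obj B" using B.dom_obj[of \<phi>] B.cod_obj[of \<phi>] by simp_all
  have [simp]: "fobj L a \<in> Obj (F y)" using functor_simps(1)[OF adjunction_simps(1)[OF adj]] by simp
  have u [simp]: "((x, a), (\<phi>, \<eta> a), (y, fobj L a)) \<in> Arr T"
    using adjunction_simps(3-5)[OF adj] by simp
  note [simp] = adjunction_simps(3-5)[OF adj]
  show ?thesis
  proof (rule pushoutI)
    show "Comp T (over (Id B y) (fobj L a)) (over \<phi> (i y)) =
        Comp T ((x, a), (\<phi>, \<eta> a), (y, fobj L a)) (over (Id B x) a)"
      using over_comp_over[of \<phi> "Id B y" "fobj L a"] comp_over[OF u, of "Id B x"] by simp
  next
    fix w k l
    assume k: "k \<in> hom T (Cod T (over \<phi> (i y))) w" and l: "l \<in> hom T (Cod T (over (Id B x) a)) w"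
      and e: "Comp T k (over \<phi> (i y)) = Comp T l (over (Id B x) a)"
    obtain z c where w: "w = (z, c)" by (cases w)
    obtain \<kappa> k' where k': "k = ((y, i y), (\<kappa>, k'), (z, c))" "\<kappa> \<in> Arr B" "Dom B \<kappa> = y" "Cod B \<kappa> = z"
      "z \<in> Obj B" "c \<in> Obj (F z)"
    proof -
      have "k \<in> hom T (y, i y) (z, c)" using k w by simp
      then show ?thesis using that by (rule total_homE)
    qed
    obtain \<nu> l' where l': "l = ((x, a), (\<nu>, l'), (z, c))" "\<nu> \<in> Arr B" "Dom B \<nu> = x" "Cod B \<nu> = z"
      "l' \<in> Arr (F x)" "Dom (F x) l' = a" "Cod (F x) l' = fobj (pull \<Phi> \<nu>) c"
    proof -
      have "l \<in> hom T (x, a) (z, c)" using l w by simp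
      then show ?thesis using that by (rule total_homE)
    qed
    have ko: "k = over \<kappa> c" using over_unique[of y \<kappa> k' z c] k k'(1) by simp
    have \<nu>: "\<nu> = Comp B \<kappa> \<phi>" using e k' l' by (simp add: over_def)
    have "l' \<in> hom (F x) a (fobj (pull \<Phi> \<phi>) (fobj (pull \<Phi> \<kappa>) c))"
      using l'(5-7) k'(2-6) by (simp add: \<nu>)
    then obtain g where g: "g \<in> hom (F y) (fobj L a) (fobj (pull \<Phi> \<kappa>) c)"
      "Comp (F x) (farr (pull \<Phi> \<phi>) g) (\<eta> a) = l'"
      using adjunction_transpose[OF adj a] k'(2-6) by (metis pull_simps(1))
    have gA: "((y, fobj L a), (\<kappa>, g), (z, c)) \<in> Arr T" using g k' by simp
    show "\<exists>h. h \<in> hom T (Cod T (over (Id B y) (fobj L a))) w \<and>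
        Comp T h (over (Id B y) (fobj L a)) = k \<and> Comp T h ((x, a), (\<phi>, \<eta> a), (y, fobj L a)) = l"
      using gA g(2) comp_over[OF gA, of "Id B y"] k'(2,3)
      by (intro exI[of _ "((y, fobj L a), (\<kappa>, g), (z, c))"]) (simp add: w ko l'(1) \<nu>)
  next
    fix w h k
    assume h: "h \<in> hom T (Cod T (over (Id B y) (fobj L a))) w"
      and k: "k \<in> hom T (Cod T (over (Id B y) (fobj L a))) w"
      and e: "Comp T h (over (Id B y) (fobj L a)) = Comp T k (over (Id B y) (fobj L a))"
        "Comp T h ((x, a), (\<phi>, \<eta> a), (y, fobj L a)) = Comp T k ((x, a), (\<phi>, \<eta> a), (y, fobj L a))"
    obtain z c where w: "w = (z, c)" by (cases w)
    obtain \<kappa> k' where k': "k = ((y, fobj L a), (\<kappa>, k'), (z, c))" "\<kappa> \<in> Arr B" "Dom B \<kappa> = y" "Cod B \<kappa> = z"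
      "c \<in> Obj (F z)" "k' \<in> Arr (F y)" "Dom (F y) k' = fobj L a" "Cod (F y) k' = fobj (pull \<Phi> \<kappa>) c"
    proof -
      have "k \<in> hom T (y, fobj L a) (z, c)" using k w by simp
      then show ?thesis using that by (rule total_homE)
    qed
    obtain \<nu> h' where h': "h = ((y, fobj L a), (\<nu>, h'), (z, c))" "\<nu> \<in> Arr B" "Dom B \<nu> = y" "Cod B \<nu> = z"
      "h' \<in> Arr (F y)" "Dom (F y) h' = fobj L a" "Cod (F y) h' = fobj (pull \<Phi> \<nu>) c"
    proof -
      have "h \<in> hom T (y, fobj L a) (z, c)" using h w by simp
      then show ?thesis using that by (rule total_homE)
    qed
    have \<nu>: "\<nu> = \<kappa>" using e(1) k'(1-4) h'(1-4) by (simp add: over_def)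
    have "h' = k'"
      by (rule adjunction_unique[OF adj _ a, of "fobj (pull \<Phi> \<kappa>) c"])
        (use e(2) k' h' in \<open>simp_all add: \<nu> category_F\<close>)
    then show "h = k" using h'(1) k'(1) \<nu> by simp
  qed simp_all
qed

end

section \<open>Global semi-model structures\<close>

locale global_semi_model = indexed_initial \<Phi> i + M: semi_model_category "total_cat \<Phi>" "global \<Phi>" G
  for \<Phi> :: "('o, 'm, 'a, 'f) hindexed" and i G +
  assumes pushouts: "has_pushouts (total_cat \<Phi>)"
begin

lemma global_simps [simp]:
  "((x, a), (\<phi>, f), c) \<in> weqs (global \<Phi>) \<longleftrightarrow>
     ((x, a), (\<phi>, f), c) \<in> Arr T \<and> \<phi> \<in> weqs (horiz \<Phi>) \<and> f \<in> weqs (vert \<Phi> x)"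
  "((x, a), (\<phi>, f), c) \<in> fibs (global \<Phi>) \<longleftrightarrow>
     ((x, a), (\<phi>, f), c) \<in> Arr T \<and> \<phi> \<in> fibs (horiz \<Phi>) \<and> f \<in> fibs (vert \<Phi> x)"
  by (cases c; auto simp: global_def simp del: total_arr)+

text \<open>The identity of \<open>(x, a)\<close> is a global weak equivalence and fibration, and so are its components. For
  the identity of \<open>x\<close> take \<open>a = i x\<close>.\<close>

lemma id_classes [simp]:
  assumes "x \<in> Obj B"
  shows "Id B x \<in> weqs (horiz \<Phi>)" "Id B x \<in> fibs (horiz \<Phi>)"
    and "a \<in> Obj (F x) \<Longrightarrow> Id (F x) a \<in> weqs (vert \<Phi> x)"
    and "a \<in> Obj (F x) \<Longrightarrow> Id (F x) a \<in> fibs (vert \<Phi> x)"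
proof -
  have "Id T (x, a) \<in> weqs (global \<Phi>) \<and> Id T (x, a) \<in> fibs (global \<Phi>)" if "a \<in> Obj (F x)" for a
  proof -
    have "iso_arrow T (Id T (x, a))" using that assms by (intro T.iso_id) simp
    then show ?thesis using M.iso_weq M.iso_fib by blast
  qed
  then have *: "Id B x \<in> weqs (horiz \<Phi>) \<and> Id B x \<in> fibs (horiz \<Phi>) \<and> Id (F x) a \<in> weqs (vert \<Phi> x) \<and>
    Id (F x) a \<in> fibs (vert \<Phi> x)" if "a \<in> Obj (F x)" for a
    using that by simp
  show "Id B x \<in> weqs (horiz \<Phi>)" "Id B x \<in> fibs (horiz \<Phi>)" using *[of "i x"] assms by simp_all
  show "a \<in> Obj (F x) \<Longrightarrow> Id (F x) a \<in> weqs (vert \<Phi> x)"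
    "a \<in> Obj (F x) \<Longrightarrow> Id (F x) a \<in> fibs (vert \<Phi> x)" using * by simp_all
qed

lemma vertical_classes:
  assumes "x \<in> Obj B" "f \<in> Arr (F x)"
  shows "vertical x f \<in> weqs (global \<Phi>) \<longleftrightarrow> f \<in> weqs (vert \<Phi> x)"
    and "vertical x f \<in> fibs (global \<Phi>) \<longleftrightarrow> f \<in> fibs (vert \<Phi> x)"
    and "vertical x f \<in> tfibs (global \<Phi>) \<longleftrightarrow> f \<in> tfibs (vert \<Phi> x)"
  using assms by (auto simp: vertical_def tfibs_def)

lemma vert_arr:
  assumes "x \<in> Obj B"
  shows "f \<in> weqs (vert \<Phi> x) \<Longrightarrow> f \<in> Arr (F x)" "f \<in> fibs (vert \<Phi> x) \<Longrightarrow> f \<in> Arr (F x)"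
    "f \<in> tfibs (vert \<Phi> x) \<Longrightarrow> f \<in> Arr (F x)"
  using indexed assms by (auto simp: hindexed_category_def homotopically_structured_def tfibs_def)

lemma pull_preserves:
  assumes "\<phi> \<in> hom B x y"
  shows "f \<in> fibs (vert \<Phi> y) \<Longrightarrow> farr (pull \<Phi> \<phi>) f \<in> fibs (vert \<Phi> x)"
    and "f \<in> tfibs (vert \<Phi> y) \<Longrightarrow> farr (pull \<Phi> \<phi>) f \<in> tfibs (vert \<Phi> x)"
proof -
  have [simp]: "\<phi> \<in> Arr B" "Dom B \<phi> = x" "Cod B \<phi> = y" using assms by simp_all
  have [simp]: "x \<in> Obj B" "y \<in> Obj B" using B.dom_obj[of \<phi>] B.cod_obj[of \<phi>] by simp_all
  show "farr (pull \<Phi> \<phi>) f \<in> fibs (vert \<Phi> x)" if f: "f \<in> fibs (vert \<Phi> y)"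
  proof -
    have fA: "f \<in> Arr (F y)" using vert_arr f by simp
    then have "vertical y f \<in> fibs (global \<Phi>)" using f vertical_classes by simp
    from M.fib_pullback[OF this pullback_square[OF assms]] show ?thesis
      using vertical_classes fA by simp
  qed
  show "farr (pull \<Phi> \<phi>) f \<in> tfibs (vert \<Phi> x)" if f: "f \<in> tfibs (vert \<Phi> y)"
  proof -
    have fA: "f \<in> Arr (F y)" using vert_arr f by simp
    then have "vertical y f \<in> tfibs (global \<Phi>)" using f vertical_classes by simp
    from M.tfib_pullback[OF this pullback_square[OF assms]] show ?thesis
      using vertical_classes fA by simp
  qed
qed

lemma quillen_pair_exists:
  assumes "\<phi> \<in> hom B x y"
  shows "\<exists>L \<eta>. quillen_pair (F x) (vert \<Phi> x) (F y) (vert \<Phi> y) L (pull \<Phi> \<phi>) \<eta>"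
  using left_adjoint_exists[OF pushouts assms] pull_preserves[OF assms]
  unfolding quillen_pair_def by blast

lemma cartesian_classes:
  assumes "\<phi> \<in> Arr B" "b \<in> Obj (F (Cod B \<phi>))"
  shows "cartesian \<phi> b \<in> weqs (global \<Phi>) \<longleftrightarrow> \<phi> \<in> weqs (horiz \<Phi>)"
    and "cartesian \<phi> b \<in> tfibs (global \<Phi>) \<longleftrightarrow> \<phi> \<in> tfibs (horiz \<Phi>)"
  using assms by (auto simp: cartesian_def tfibs_def)

lemma cartesian_comp:
  assumes "\<phi> \<in> Arr B" "\<psi> \<in> Arr B" "Cod B \<phi> = Dom B \<psi>" "b \<in> Obj (F (Cod B \<psi>))"
  shows "Comp T (cartesian \<psi> b) (cartesian \<phi> (fobj (pull \<Phi> \<psi>) b)) = cartesian (Comp B \<psi> \<phi>) b"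
  using assms by (simp add: cartesian_def)

text \<open>A horizontal arrow is a weak equivalence iff a cartesian arrow over it is one; the initial object
  of the fibre over the codomain provides such an arrow.\<close>

lemma horiz_two_out_of_three: "two_out_of_three B (weqs (horiz \<Phi>))"
  unfolding two_out_of_three_def
proof (intro ballI impI)
  fix \<phi> \<psi> assume *: "\<phi> \<in> Arr B" "\<psi> \<in> Arr B" "Cod B \<phi> = Dom B \<psi>"
  let ?b = "i (Cod B \<psi>)"
  let ?f = "cartesian \<phi> (fobj (pull \<Phi> \<psi>) ?b)" and ?g = "cartesian \<psi> ?b"
  have b: "?b \<in> Obj (F (Cod B \<psi>))" "fobj (pull \<Phi> \<psi>) ?b \<in> Obj (F (Cod B \<phi>))" using * by simp_all
  have "?f \<in> Arr T" "?g \<in> Arr T" "Cod T ?f = Dom T ?g" using * b by simp_all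
  note tt = two_out_of_threeD[OF M.weq_23 this]
  have eq: "?f \<in> weqs (global \<Phi>) \<longleftrightarrow> \<phi> \<in> weqs (horiz \<Phi>)" "?g \<in> weqs (global \<Phi>) \<longleftrightarrow> \<psi> \<in> weqs (horiz \<Phi>)"
    "Comp T ?g ?f \<in> weqs (global \<Phi>) \<longleftrightarrow> Comp B \<psi> \<phi> \<in> weqs (horiz \<Phi>)"
    using * b cartesian_comp[of \<phi> \<psi> ?b] by (simp_all add: cartesian_classes(1))
  show "(\<phi> \<in> weqs (horiz \<Phi>) \<and> \<psi> \<in> weqs (horiz \<Phi>) \<longrightarrow> Comp B \<psi> \<phi> \<in> weqs (horiz \<Phi>)) \<and>
    (\<phi> \<in> weqs (horiz \<Phi>) \<and> Comp B \<psi> \<phi> \<in> weqs (horiz \<Phi>) \<longrightarrow> \<psi> \<in> weqs (horiz \<Phi>)) \<and>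
    (\<psi> \<in> weqs (horiz \<Phi>) \<and> Comp B \<psi> \<phi> \<in> weqs (horiz \<Phi>) \<longrightarrow> \<phi> \<in> weqs (horiz \<Phi>))"
    using tt unfolding eq by blast
qed

lemmas horiz_weq_right = two_out_of_threeD(2)[OF horiz_two_out_of_three]
lemmas horiz_weq_left = two_out_of_threeD(3)[OF horiz_two_out_of_three]

lemma vert_two_out_of_three:
  assumes "x \<in> Obj B" shows "two_out_of_three (F x) (weqs (vert \<Phi> x))"
  unfolding two_out_of_three_def
proof (intro ballI impI)
  fix f g assume *: "f \<in> Arr (F x)" "g \<in> Arr (F x)" "Cod (F x) f = Dom (F x) g"
  have "vertical x f \<in> Arr T" "vertical x g \<in> Arr T" "Cod T (vertical x f) = Dom T (vertical x g)"
    using * assms by simp_all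
  note tt = two_out_of_threeD[OF M.weq_23 this, folded vertical_comp[OF assms *]]
  have "Comp (F x) g f \<in> Arr (F x)" using * assms by simp
  note eq = vertical_classes(1)[OF assms *(1)] vertical_classes(1)[OF assms *(2)] vertical_classes(1)[OF assms this]
  show "(f \<in> weqs (vert \<Phi> x) \<and> g \<in> weqs (vert \<Phi> x) \<longrightarrow> Comp (F x) g f \<in> weqs (vert \<Phi> x)) \<and>
    (f \<in> weqs (vert \<Phi> x) \<and> Comp (F x) g f \<in> weqs (vert \<Phi> x) \<longrightarrow> g \<in> weqs (vert \<Phi> x)) \<and>
    (g \<in> weqs (vert \<Phi> x) \<and> Comp (F x) g f \<in> weqs (vert \<Phi> x) \<longrightarrow> f \<in> weqs (vert \<Phi> x))"
    using tt unfolding eq by blast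
qed

text \<open>The square formed by \<open>g\<close>, its reindexing and two cartesian arrows over \<open>\<phi>\<close> commutes,
  and the cartesian arrows are weak equivalences.\<close>

lemma pull_weq_iff:
  assumes \<phi>: "\<phi> \<in> hom B x y" "\<phi> \<in> weqs (horiz \<Phi>)" and g: "g \<in> Arr (F y)"
  shows "farr (pull \<Phi> \<phi>) g \<in> weqs (vert \<Phi> x) \<longleftrightarrow> g \<in> weqs (vert \<Phi> y)"
proof -
  have [simp]: "\<phi> \<in> Arr B" "Dom B \<phi> = x" "Cod B \<phi> = y" using \<phi> by simp_all
  have [simp]: "x \<in> Obj B" "y \<in> Obj B" using B.dom_obj[of \<phi>] B.cod_obj[of \<phi>] by simp_all
  let ?d = "cartesian \<phi> (Dom (F y) g)" and ?c = "cartesian \<phi> (Cod (F y) g)"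
  let ?g = "vertical x (farr (pull \<Phi> \<phi>) g)"
  have sq: "Comp T (vertical y g) ?d = Comp T ?c ?g"
    using g by (simp add: vertical_def cartesian_def)
  have dc: "?d \<in> weqs (global \<Phi>)" "?c \<in> weqs (global \<Phi>)" using \<phi> g cartesian_classes by simp_all
  have "?g \<in> weqs (global \<Phi>) \<longleftrightarrow> Comp T ?c ?g \<in> weqs (global \<Phi>)"
    using M.weq_comp[OF _ dc(2), of ?g] M.weq_left[OF dc(2), of ?g] g by auto
  also have "\<dots> \<longleftrightarrow> vertical y g \<in> weqs (global \<Phi>)"
    unfolding sq[symmetric]
    using M.weq_comp[OF dc(1), of "vertical y g"] M.weq_right[OF dc(1), of "vertical y g"] g by auto
  finally show ?thesis using g by (simp add: vertical_classes)
qed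

text \<open>A lifting problem for \<open>(id, f)\<close> against a global trivial fibration over \<open>\<pi>\<close> has the base of its
  upper arrow as base of the lift, and reduces to a lifting problem for \<open>f\<close> against a reindexed
  vertical trivial fibration.\<close>

lemma vertical_cof:
  assumes x [simp]: "x \<in> Obj B" and f: "f \<in> cofs (F x) (vert \<Phi> x)"
  shows "vertical x f \<in> cofs T (global \<Phi>)"
  unfolding cofs_def
proof (intro CollectI conjI ballI)
  have fA [simp]: "f \<in> Arr (F x)" using f by (simp add: cofs_def)
  show "vertical x f \<in> Arr T" by simp
  fix p assume p: "p \<in> tfibs (global \<Phi>)"
  then have "p \<in> Arr T" using M.tfibs_arr by auto
  then obtain y d \<pi> r z e where r: "p = ((y, d), (\<pi>, r), (z, e))" and [simp]: "\<pi> \<in> Arr B" "Dom B \<pi> = y"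
    "Cod B \<pi> = z" "y \<in> Obj B" "z \<in> Obj B" "d \<in> Obj (F y)" "e \<in> Obj (F z)"
    "r \<in> Arr (F y)" "Dom (F y) r = d" "Cod (F y) r = fobj (pull \<Phi> \<pi>) e"
    by (rule total_arrE)
  have rt: "r \<in> tfibs (vert \<Phi> y)" using p by (simp add: r tfibs_def)
  show "lifts T (vertical x f) p"
    unfolding lifts_def
  proof (intro ballI impI)
    fix s t assume s: "s \<in> hom T (Dom T (vertical x f)) (Dom T p)"
      and t: "t \<in> hom T (Cod T (vertical x f)) (Cod T p)" and e: "Comp T p s = Comp T t (vertical x f)"
    have "s \<in> hom T (x, Dom (F x) f) (y, d)" using s by (simp add: r)
    then obtain \<sigma> s' where s': "s = ((x, Dom (F x) f), (\<sigma>, s'), (y, d))" and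
      [simp]: "\<sigma> \<in> Arr B" "Dom B \<sigma> = x" "Cod B \<sigma> = y"
      "s' \<in> Arr (F x)" "Dom (F x) s' = Dom (F x) f" "Cod (F x) s' = fobj (pull \<Phi> \<sigma>) d"
      by (rule total_homE)
    have "t \<in> hom T (x, Cod (F x) f) (z, e)" using t by (simp add: r)
    then obtain \<tau> t' where t': "t = ((x, Cod (F x) f), (\<tau>, t'), (z, e))" and
      [simp]: "\<tau> \<in> Arr B" "Dom B \<tau> = x" "Cod B \<tau> = z"
      "t' \<in> Arr (F x)" "Dom (F x) t' = Cod (F x) f" and ct: "Cod (F x) t' = fobj (pull \<Phi> \<tau>) e"
      by (rule total_homE)
    have \<tau>: "\<tau> = Comp B \<pi> \<sigma>" and e': "Comp (F x) (farr (pull \<Phi> \<sigma>) r) s' = Comp (F x) t' f"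
      using e by (simp_all add: r s' t' vertical_def)
    have [simp]: "Cod (F x) t' = fobj (pull \<Phi> \<sigma>) (fobj (pull \<Phi> \<pi>) e)" using ct by (simp add: \<tau>)
    have "farr (pull \<Phi> \<sigma>) r \<in> tfibs (vert \<Phi> x)" by (rule pull_preserves(2)[OF _ rt]) simp
    then have "lifts (F x) f (farr (pull \<Phi> \<sigma>) r)" using f by (simp add: cofs_def)
    then obtain h where h: "h \<in> hom (F x) (Cod (F x) f) (fobj (pull \<Phi> \<sigma>) d)" "Comp (F x) h f = s'"
      "Comp (F x) (farr (pull \<Phi> \<sigma>) r) h = t'"
      by (rule liftE[OF _ _ _ e']) simp_all
    show "\<exists>h\<in>hom T (Cod T (vertical x f)) (Dom T p). Comp T h (vertical x f) = s \<and> Comp T p h = t"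
      using h by (intro bexI[of _ "((x, Cod (F x) f), (\<sigma>, h), (y, d))"])
        (simp_all add: r s' t' vertical_def \<tau>)
  qed
qed

text \<open>The definition of cofibrant objects provides some initial object of the fibre, which need not be
  \<open>i x\<close>; the lifting property transfers because arrows out of initial objects are unique.\<close>

lemma over_cof:
  assumes x [simp]: "x \<in> Obj B" and a [simp]: "a \<in> Obj (F x)" and cof: "cofibrant (F x) (vert \<Phi> x) a"
  shows "over (Id B x) a \<in> cofs T (global \<Phi>)"
proof -
  obtain z f where f: "initial_object (F x) z" "f \<in> hom (F x) z a" "f \<in> cofs (F x) (vert \<Phi> x)"
    using cof by (auto simp: cofibrant_def)
  have z: "z \<in> Obj (F x)" using f(1) by (simp add: initial_object_def)
  have fA [simp]: "f \<in> Arr (F x)" "Dom (F x) f = z" "Cod (F x) f = a" using f(2) by simp_all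
  have "lifts (F x) (ini x a) p" if p: "p \<in> tfibs (vert \<Phi> x)" for p
    unfolding lifts_def
  proof (intro ballI impI)
    have [simp]: "p \<in> Arr (F x)" by (rule vert_arr[OF x]) (rule p)
    fix s t assume st: "s \<in> hom (F x) (Dom (F x) (ini x a)) (Dom (F x) p)"
      "t \<in> hom (F x) (Cod (F x) (ini x a)) (Cod (F x) p)"
    obtain s' where s': "s' \<in> hom (F x) z (Dom (F x) p)"
      by (rule initial_arrow[OF f(1), of "Dom (F x) p"]) simp
    have "Comp (F x) p s' = Comp (F x) t f"
      by (rule initial_unique[OF f(1)]) (use s' st in simp_all)
    then obtain h where h: "h \<in> hom (F x) a (Dom (F x) p)" "Comp (F x) p h = t"
      using liftE[of "F x" f p s' t] f(3) p s' st by (auto simp: cofs_def)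
    have "Comp (F x) h (ini x a) = s"
      by (rule initial_unique[OF initial[OF x]]) (use h st in simp_all)
    then show "\<exists>h\<in>hom (F x) (Cod (F x) (ini x a)) (Dom (F x) p). Comp (F x) h (ini x a) = s \<and> Comp (F x) p h = t"
      using h by (intro bexI[of _ h]) simp_all
  qed
  then have "ini x a \<in> cofs (F x) (vert \<Phi> x)" by (simp add: cofs_def)
  from vertical_cof[OF x this] show ?thesis by (simp add: vertical_def over_def)
qed

lemma unit_weq:
  assumes \<phi>: "\<phi> \<in> hom B x y" and adj: "adjunction (F x) (F y) L (pull \<Phi> \<phi>) \<eta>" and a: "a \<in> Obj (F x)"
    and "over \<phi> (i y) \<in> weqs (global \<Phi>)" "over (Id B x) a \<in> cofs T (global \<Phi>)"
    and "proper_on T (global \<Phi>) H" "H (x, i x)" "H (y, i y)"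
  shows "((x, a), (\<phi>, \<eta> a), (y, fobj L a)) \<in> weqs (global \<Phi>)"
  by (rule proper_onD[OF assms(6,4,5) _ _ adjunction_pushout[OF adj \<phi> a]]) (use assms in simp_all)

text \<open>The cartesian arrows make \<open>\<phi>\<^sup>*\<close> homotopical, so a replacement functor on the domain fibre is all
  that the criterion for deformable adjunctions asks for.\<close>

lemma quillen_equivalence_criterion:
  assumes \<phi>: "\<phi> \<in> hom B x y" "\<phi> \<in> weqs (horiz \<Phi>)" and adj: "adjunction (F x) (F y) L (pull \<Phi> \<phi>) \<eta>"
    and Q: "is_functor (F x) (F x) Q" "nat_trans (F x) (F x) Q id_functor q"
    and weq: "\<And>a. a \<in> Obj (F x) \<Longrightarrow> q a \<in> weqs (vert \<Phi> x)"
      "\<And>a. a \<in> Obj (F x) \<Longrightarrow> \<eta> (fobj Q a) \<in> weqs (vert \<Phi> x)"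
  shows "quillen_equivalence (F x) (vert \<Phi> x) (F y) (vert \<Phi> y) L (pull \<Phi> \<phi>) \<eta>"
proof (rule deformable_quillen_equivalence)
  have xy: "x \<in> Obj B" "y \<in> Obj B" using B.dom_obj[of \<phi>] B.cod_obj[of \<phi>] \<phi>(1) by auto
  show "quillen_pair (F x) (vert \<Phi> x) (F y) (vert \<Phi> y) L (pull \<Phi> \<phi>) \<eta>"
    using adj pull_preserves[OF \<phi>(1)] by (simp add: quillen_pair_def)
  show "deformable_adjunction (F x) (weqs (vert \<Phi> x)) (F y) (weqs (vert \<Phi> y)) L (pull \<Phi> \<phi>) \<eta> Q q"
    using adj Q weq pull_weq_iff[OF \<phi>] vert_two_out_of_three vert_arr xy
    by unfold_locales (auto simp: category_F)
qed

section \<open>Cofibrant replacement inside a fibre\<close>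

text \<open>A cofibration from \<open>(x, i x)\<close> to \<open>(z, c)\<close> splits as \<open>(x, i x) \<rightarrow> (z, i z) \<rightarrow> (z, c)\<close>. The second
  arrow is a cofibration since lifts against vertical arrows \<open>(id, p)\<close> over \<open>z\<close> are vertical.\<close>

lemma vertical_part_cof:
  assumes cof: "((x, i x), (\<psi>, g), (z, c)) \<in> cofs T (global \<Phi>)"
  shows "over (Id B z) c \<in> cofs T (global \<Phi>)"
proof -
  have "((x, i x), (\<psi>, g), (z, c)) \<in> Arr T" using M.cof_arr cof by blast
  then have A [simp]: "\<psi> \<in> Arr B" "Dom B \<psi> = x" "Cod B \<psi> = z" "c \<in> Obj (F z)" "g \<in> Arr (F x)"
    "Dom (F x) g = i x" "Cod (F x) g = fobj (pull \<Phi> \<psi>) c" by simp_all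
  have [simp]: "x \<in> Obj B" "z \<in> Obj B" using B.dom_obj[of \<psi>] B.cod_obj[of \<psi>] by simp_all
  have g: "((x, i x), (\<psi>, g), (z, c)) = over \<psi> c" by (rule over_unique) simp
  have "lifts (F z) (ini z c) p" if p: "p \<in> tfibs (vert \<Phi> z)" for p
    unfolding lifts_def
  proof (intro ballI impI)
    have [simp]: "p \<in> Arr (F z)" by (rule vert_arr[of z]) (use p in simp_all)
    fix s t assume st: "s \<in> hom (F z) (Dom (F z) (ini z c)) (Dom (F z) p)"
      "t \<in> hom (F z) (Cod (F z) (ini z c)) (Cod (F z) p)"
    have vt: "vertical z t \<in> Arr T" using st by simp
    have vp: "vertical z p \<in> tfibs (global \<Phi>)" using p vertical_classes by simp
    have vpA: "vertical z p \<in> Arr T" by simp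
    have e: "Comp T (vertical z p) (over \<psi> (Dom (F z) p)) = Comp T (vertical z t) (over \<psi> c)"
      using comp_over[OF vpA[unfolded vertical_def], of \<psi>] comp_over[OF vt[unfolded vertical_def], of \<psi>] st
      by (simp add: vertical_def)
    obtain h where h: "h \<in> hom T (z, c) (z, Dom (F z) p)" "Comp T (vertical z p) h = vertical z t"
      by (rule liftE[OF M.cof_lifts[OF cof[unfolded g] vp] _ _ e]) (use st vt in simp_all)
    from h(1) obtain \<chi> k where k: "h = ((z, c), (\<chi>, k), (z, Dom (F z) p))" and
      K: "\<chi> \<in> Arr B" "Dom B \<chi> = z" "Cod B \<chi> = z"
      "k \<in> Arr (F z)" "Dom (F z) k = c" "Cod (F z) k = fobj (pull \<Phi> \<chi>) (Dom (F z) p)"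
      by (elim total_homE)
    have \<chi>: "\<chi> = Id B z" using h(2) K by (simp add: k vertical_def)
    have k': "Comp (F z) p k = t" using h(2) K by (simp add: k vertical_def \<chi>)
    have "Comp (F z) k (ini z c) = s"
      by (rule initial_unique[OF initial[of z]]) (use K st in \<open>simp_all add: \<chi>\<close>)
    then show "\<exists>h\<in>hom (F z) (Cod (F z) (ini z c)) (Dom (F z) p). Comp (F z) h (ini z c) = s \<and> Comp (F z) p h = t"
      using K k' by (intro bexI[of _ k]) (simp_all add: \<chi>)
  qed
  then have "ini z c \<in> cofs (F z) (vert \<Phi> z)" by (simp add: cofs_def)
  from vertical_cof[OF _ this] show ?thesis by (simp add: vertical_def over_def)
qed

text \<open>For the first arrow of the splitting the lifting problem only concerns the bases. To use the
  given cofibration, the base \<open>\<pi>\<close> of the trivial fibration is covered by a cartesian arrow.\<close>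

lemma horizontal_part_cof:
  assumes cof: "((x, i x), (\<psi>, g), (z, c)) \<in> cofs T (global \<Phi>)"
  shows "over \<psi> (i z) \<in> cofs T (global \<Phi>)"
  unfolding cofs_def
proof (intro CollectI conjI ballI)
  have "((x, i x), (\<psi>, g), (z, c)) \<in> Arr T" using M.cof_arr cof by blast
  then have A [simp]: "\<psi> \<in> Arr B" "Dom B \<psi> = x" "Cod B \<psi> = z" "c \<in> Obj (F z)" "g \<in> Arr (F x)"
    "Dom (F x) g = i x" "Cod (F x) g = fobj (pull \<Phi> \<psi>) c" by simp_all
  have [simp]: "x \<in> Obj B" "z \<in> Obj B" using B.dom_obj[of \<psi>] B.cod_obj[of \<psi>] by simp_all
  have g: "((x, i x), (\<psi>, g), (z, c)) = over \<psi> c" by (rule over_unique) simp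
  show "over \<psi> (i z) \<in> Arr T" by simp
  fix p assume p: "p \<in> tfibs (global \<Phi>)"
  then have "p \<in> Arr T" using M.tfibs_arr by auto
  then obtain y d \<pi> r w e where r: "p = ((y, d), (\<pi>, r), (w, e))" and [simp]: "\<pi> \<in> Arr B" "Dom B \<pi> = y"
    "Cod B \<pi> = w" "y \<in> Obj B" "w \<in> Obj B" "d \<in> Obj (F y)" "e \<in> Obj (F w)"
    "r \<in> Arr (F y)" "Dom (F y) r = d" "Cod (F y) r = fobj (pull \<Phi> \<pi>) e"
    by (rule total_arrE)
  have \<pi>: "\<pi> \<in> tfibs (horiz \<Phi>)" using p by (simp add: r tfibs_def)
  show "lifts T (over \<psi> (i z)) p"
    unfolding lifts_def
  proof (intro ballI impI)
    fix s t assume s: "s \<in> hom T (Dom T (over \<psi> (i z))) (Dom T p)"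
      and t: "t \<in> hom T (Cod T (over \<psi> (i z))) (Cod T p)" and e: "Comp T p s = Comp T t (over \<psi> (i z))"
    have "s \<in> hom T (x, i x) (y, d)" using s by (simp add: r)
    then obtain \<sigma> s' where s': "s = ((x, i x), (\<sigma>, s'), (y, d))" and
      [simp]: "\<sigma> \<in> Arr B" "Dom B \<sigma> = x" "Cod B \<sigma> = y" by (rule total_homE)
    have so: "s = over \<sigma> d" using over_unique[of x \<sigma> s' y d] s s' by simp
    have "t \<in> hom T (z, i z) (w, e)" using t by (simp add: r)
    then obtain \<tau> t' where t': "t = ((z, i z), (\<tau>, t'), (w, e))" and
      [simp]: "\<tau> \<in> Arr B" "Dom B \<tau> = z" "Cod B \<tau> = w" by (rule total_homE)
    have to: "t = over \<tau> e" using over_unique[of z \<tau> t' w e] t t' by simp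
    have \<pi>\<sigma>: "Comp B \<pi> \<sigma> = Comp B \<tau> \<psi>" using e by (simp add: r s' t' over_def)
    \<comment> \<open>a cartesian trivial fibration over \<open>\<pi>\<close> whose codomain receives a morphism from \<open>(z, c)\<close>
      over \<open>\<tau>\<close>: its fibre component is the pushforward of \<open>c\<close>\<close>
    obtain L \<eta> where adj: "adjunction (F z) (F w) L (pull \<Phi> \<tau>) \<eta>"
      using left_adjoint_exists[OF pushouts, of \<tau> z w] by auto
    let ?e = "fobj L c"
    have [simp]: "?e \<in> Obj (F w)" using functor_simps(1)[OF adjunction_simps(1)[OF adj]] by simp
    have u: "((z, c), (\<tau>, \<eta> c), (w, ?e)) \<in> Arr T" using adjunction_simps(3-5)[OF adj] by simp
    have tf: "cartesian \<pi> ?e \<in> tfibs (global \<Phi>)" using cartesian_classes(2)[of \<pi> ?e] \<pi> by simp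
    have cA: "cartesian \<pi> ?e \<in> Arr T" by simp
    have e: "Comp T (cartesian \<pi> ?e) (over \<sigma> (fobj (pull \<Phi> \<pi>) ?e)) =
        Comp T ((z, c), (\<tau>, \<eta> c), (w, ?e)) (over \<psi> c)"
      using comp_over[OF u, of \<psi>] comp_over[OF cA[unfolded cartesian_def], of \<sigma>] \<pi>\<sigma>
      by (simp add: cartesian_def)
    obtain h where h: "h \<in> hom T (z, c) (y, fobj (pull \<Phi> \<pi>) ?e)"
      "Comp T h (over \<psi> c) = over \<sigma> (fobj (pull \<Phi> \<pi>) ?e)"
      "Comp T (cartesian \<pi> ?e) h = ((z, c), (\<tau>, \<eta> c), (w, ?e))"
      by (rule liftE[OF M.cof_lifts[OF cof[unfolded g] tf] _ _ e]) (use u in simp_all)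
    from h(1) obtain \<kappa> k where k: "h = ((z, c), (\<kappa>, k), (y, fobj (pull \<Phi> \<pi>) ?e))" and
      [simp]: "\<kappa> \<in> Arr B" "Dom B \<kappa> = z" "Cod B \<kappa> = y"
      by (elim total_homE)
    have \<kappa>: "Comp B \<kappa> \<psi> = \<sigma>" "Comp B \<pi> \<kappa> = \<tau>"
      using h(2,3) by (simp_all add: k over_def cartesian_def)
    have pA: "((y, d), (\<pi>, r), (w, e)) \<in> Arr T" by simp
    show "\<exists>h\<in>hom T (Cod T (over \<psi> (i z))) (Dom T p). Comp T h (over \<psi> (i z)) = s \<and> Comp T p h = t"
      using over_comp_over[of \<psi> \<kappa> d] comp_over[OF pA, of \<kappa>] \<kappa>
      by (intro bexI[of _ "over \<kappa> d"]) (simp_all add: so to, simp_all add: r)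
  qed
qed

text \<open>Factor \<open>(x, i x) \<rightarrow> (z, i z)\<close> as a trivial cofibration followed by a fibration with base \<open>b\<close>. Then
  \<open>b\<close> is a horizontal trivial fibration, the cofibration lifts against the cartesian arrow over it,
  and the base of the lift presents \<open>(x, i x) \<rightarrow> (z, i z)\<close> as a retract of the trivial cofibration.\<close>

lemma horizontal_part_weq:
  assumes cof: "((x, i x), (\<psi>, g), (z, c)) \<in> cofs T (global \<Phi>)"
    and \<psi>: "\<psi> \<in> weqs (horiz \<Phi>)" and Gx: "G (x, i x)"
  shows "over \<psi> (i z) \<in> weqs (global \<Phi>)"
proof -
  have "((x, i x), (\<psi>, g), (z, c)) \<in> Arr T" using M.cof_arr cof by blast
  then have A [simp]: "\<psi> \<in> Arr B" "Dom B \<psi> = x" "Cod B \<psi> = z" by simp_all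
  have [simp]: "x \<in> Obj B" "z \<in> Obj B" using B.dom_obj[of \<psi>] B.cod_obj[of \<psi>] by simp_all
  have oc: "over \<psi> (i z) \<in> cofs T (global \<Phi>)" by (rule horizontal_part_cof[OF cof])
  obtain ye \<alpha> \<beta> where f: "\<alpha> \<in> hom T (Dom T (over \<psi> (i z))) ye" "\<beta> \<in> hom T ye (Cod T (over \<psi> (i z)))"
    "Comp T \<beta> \<alpha> = over \<psi> (i z)" "\<alpha> \<in> tcofs T (global \<Phi>)" "\<beta> \<in> fibs (global \<Phi>)"
    by (rule factorizationE[OF M.tcof_fib_factorization, of "over \<psi> (i z)"]) (use Gx in simp_all)
  obtain y e where ye: "ye = (y, e)" by (cases ye)
  have "\<alpha> \<in> hom T (x, i x) (y, e)" using f(1) ye by simp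
  then obtain a a' where a: "\<alpha> = ((x, i x), (a, a'), (y, e))" and
    [simp]: "a \<in> Arr B" "Dom B a = x" "Cod B a = y" "y \<in> Obj B" "e \<in> Obj (F y)"
    by (rule total_homE)
  have ao: "\<alpha> = over a e" using over_unique[of x a a' y e] f(1) a by simp
  have "\<beta> \<in> hom T (y, e) (z, i z)" using f(2) ye by simp
  then obtain b b' where b: "\<beta> = ((y, e), (b, b'), (z, i z))" and [simp]: "b \<in> Arr B" "Dom B b = y" "Cod B b = z"
    by (rule total_homE)
  have ba: "Comp B b a = \<psi>" using f(3) by (simp add: a b over_def)
  have aw: "a \<in> weqs (horiz \<Phi>)" using f(4) by (simp add: a tcofs_def)
  have "b \<in> tfibs (horiz \<Phi>)"
    using horiz_weq_right[of a b] aw ba \<psi> f(5) by (simp add: b tfibs_def)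
  then have tf: "cartesian b (i z) \<in> tfibs (global \<Phi>)" using cartesian_classes(2)[of b "i z"] by simp
  have cA: "cartesian b (i z) \<in> Arr T" by simp
  have e: "Comp T (cartesian b (i z)) (over a (fobj (pull \<Phi> b) (i z))) =
      Comp T (Id T (z, i z)) (over \<psi> (i z))"
    using comp_over[OF cA[unfolded cartesian_def], of a] ba T.id_left[of "over \<psi> (i z)" "(z, i z)"]
    by (simp add: cartesian_def del: total_simps(3,4))
  obtain h where h: "h \<in> hom T (z, i z) (y, fobj (pull \<Phi> b) (i z))"
    "Comp T h (over \<psi> (i z)) = over a (fobj (pull \<Phi> b) (i z))"
    "Comp T (cartesian b (i z)) h = Id T (z, i z)"
    by (rule liftE[OF M.cof_lifts[OF oc tf] _ _ e]) simp_all
  from h(1) obtain \<kappa> k where k: "h = ((z, i z), (\<kappa>, k), (y, fobj (pull \<Phi> b) (i z)))" and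
    [simp]: "\<kappa> \<in> Arr B" "Dom B \<kappa> = z" "Cod B \<kappa> = y"
    by (elim total_homE)
  have \<kappa>: "Comp B \<kappa> \<psi> = a" "Comp B b \<kappa> = Id B z"
    using h(2,3) by (simp_all add: k over_def cartesian_def)
  have bA: "((y, e), (b, b'), (z, i z)) \<in> Arr T" using f(2) by (simp add: b ye)
  have 1: "Comp T \<alpha> (Id T (x, i x)) = Comp T (over \<kappa> e) (over \<psi> (i z))"
    using over_comp_over[of \<psi> \<kappa> e] \<kappa>(1) T.id_right[of \<alpha> "(x, i x)"] f(1)
    by (simp add: ao del: total_simps(3,4))
  have 2: "Comp T (over \<psi> (i z)) (Id T (x, i x)) = Comp T \<beta> \<alpha>"
    using f(3) T.id_right[of "over \<psi> (i z)" "(x, i x)"] by simp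
  have 3: "Comp T \<beta> (over \<kappa> e) = Id T (z, i z)"
    using comp_over[OF bA, of \<kappa>] \<kappa>(2) over_id[of z] by (simp add: b)
  have "retract_of T (over \<psi> (i z)) \<alpha>"
    unfolding retract_of_def
    by (intro conjI bexI[of _ "Id T (x, i x)"] bexI[of _ "over \<kappa> e"] bexI[of _ \<beta>])
      (use 1 2 3 f(1,2) ye T.id_left[of "Id T (x, i x)" "(x, i x)"] T.id_arr[of "(x, i x)"] in
        \<open>simp_all del: total_simps(4)\<close>)
  then show ?thesis by (rule M.weq_retract[rotated]) (use f(4) in \<open>simp add: tcofs_def\<close>)
qed

text \<open>The object \<open>n\<close> is the pushforward of the fibre component of the middle object \<open>e\<close> along the base \<open>\<chi>\<close>
  of \<open>\<beta>\<close>. Since \<open>\<chi>\<close> has the section \<open>\<psi>\<close>, the base of \<open>\<alpha>\<close>, for which \<open>horizontal_part_weq\<close> holds,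
  the arrow \<open>(z, i z) \<rightarrow> (x, i x)\<close> over \<open>\<chi>\<close> is a weak equivalence, and so is its pushout \<open>u\<close>.\<close>

lemma vertical_reflection:
  assumes x [simp]: "x \<in> Obj B" and a [simp]: "a \<in> Obj (F x)"
    and \<alpha>: "\<alpha> \<in> cofs T (global \<Phi>)" "\<alpha> \<in> hom T (x, i x) e"
    and \<beta>: "\<beta> \<in> hom T e (x, a)" "base_of \<beta> \<in> weqs (horiz \<Phi>)" and e: "Comp T \<beta> \<alpha> = over (Id B x) a"
    and proper: "proper_on T (global \<Phi>) G" and Gx: "G (x, i x)"
    and G_cof: "\<And>k. k \<in> cofs T (global \<Phi>) \<Longrightarrow> G (Dom T k) \<Longrightarrow> G (Cod T k)"
  shows "\<exists>n u. n \<in> Obj (F x) \<and> u \<in> hom T e (x, n) \<and> u \<in> weqs (global \<Phi>) \<and> base_of u = base_of \<beta> \<and>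
    over (Id B x) n \<in> cofs T (global \<Phi>) \<and>
    (\<forall>d\<in>Obj (F x). \<forall>h\<in>hom T e (x, d). base_of h = base_of \<beta> \<longrightarrow>
       (\<exists>!g. g \<in> hom (F x) n d \<and> Comp T (vertical x g) u = h))"
proof -
  obtain z c where zc: "e = (z, c)" by (cases e)
  obtain \<psi> f where \<psi>: "\<alpha> = ((x, i x), (\<psi>, f), (z, c))" and [simp]: "\<psi> \<in> Arr B" "Dom B \<psi> = x" "Cod B \<psi> = z"
    "z \<in> Obj B" "c \<in> Obj (F z)"
    using \<alpha>(2) unfolding zc by (rule total_homE)
  obtain \<chi> b where \<chi>: "\<beta> = ((z, c), (\<chi>, b), (x, a))" and [simp]: "\<chi> \<in> Arr B" "Dom B \<chi> = z" "Cod B \<chi> = x"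
    using \<beta>(1) unfolding zc by (rule total_homE)
  have \<chi>\<psi>: "Comp B \<chi> \<psi> = Id B x" using e by (simp add: \<psi> \<chi> over_def)
  have "\<psi> \<in> weqs (horiz \<Phi>)"
    by (rule horiz_weq_left[of _ \<chi>]) (use \<beta>(2) \<chi>\<psi> in \<open>simp_all add: \<chi>\<close>)
  then have w: "over \<psi> (i z) \<in> weqs (global \<Phi>)" and k: "over \<psi> (i z) \<in> cofs T (global \<Phi>)"
    using horizontal_part_weq[OF \<alpha>(1)[unfolded \<psi>]] horizontal_part_cof[OF \<alpha>(1)[unfolded \<psi>]] Gx by simp_all
  have Gz: "G (z, i z)" using G_cof[OF k] Gx by simp
  have "Comp T (over \<chi> (i x)) (over \<psi> (i z)) = Id T (x, i x)"
    using over_comp_over[of \<psi> \<chi> "i x"] \<chi>\<psi> over_id[of x] by simp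
  moreover have "iso_arrow T (Id T (x, i x))" by (rule T.iso_id) simp
  ultimately have "over \<chi> (i x) \<in> weqs (global \<Phi>)"
    using M.weq_right[OF w, of "over \<chi> (i x)"] M.iso_weq by simp
  moreover have ic: "over (Id B z) c \<in> cofs T (global \<Phi>)" by (rule vertical_part_cof[OF \<alpha>(1)[unfolded \<psi>]])
  moreover obtain L \<eta> where adj: "adjunction (F z) (F x) L (pull \<Phi> \<chi>) \<eta>"
    using left_adjoint_exists[OF pushouts, of \<chi> z x] by auto
  ultimately have uw: "((z, c), (\<chi>, \<eta> c), (x, fobj L c)) \<in> weqs (global \<Phi>)"
    using unit_weq[OF _ adj _ _ _ proper Gz Gx, of c] by simp
  have n [simp]: "fobj L c \<in> Obj (F x)" using functor_simps(1)[OF adjunction_simps(1)[OF adj]] by simp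
  have nc: "over (Id B x) (fobj L c) \<in> cofs T (global \<Phi>)"
    using M.cof_pushout[OF ic pushout_sym[OF adjunction_pushout[OF adj]]] by simp
  have universal: "\<exists>!g. g \<in> hom (F x) (fobj L c) d \<and> Comp T (vertical x g) ((z, c), (\<chi>, \<eta> c), (x, fobj L c)) = h"
    if d: "d \<in> Obj (F x)" and h: "h \<in> hom T (z, c) (x, d)" "base_of h = \<chi>" for d h
  proof -
    obtain h' where h': "h = ((z, c), (\<chi>, h'), (x, d))" "h' \<in> hom (F z) c (fobj (pull \<Phi> \<chi>) d)"
      using h(1) by (rule total_homE) (use h(2) that in auto)
    have "\<exists>!g. g \<in> hom (F x) (fobj L c) d \<and> Comp (F z) (farr (pull \<Phi> \<chi>) g) (\<eta> c) = h'"
      using adj d h'(2) unfolding adjunction_def by simp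
    moreover have "Comp T (vertical x g) ((z, c), (\<chi>, \<eta> c), (x, fobj L c)) = h \<longleftrightarrow>
        Comp (F z) (farr (pull \<Phi> \<chi>) g) (\<eta> c) = h'" if "g \<in> hom (F x) (fobj L c) d" for g
      using that by (simp add: vertical_def h'(1))
    ultimately show ?thesis by (auto simp del: in_hom)
  qed
  show ?thesis
    using uw nc universal adjunction_simps(3-5)[OF adj]
    by (intro exI[of _ "fobj L c"] exI[of _ "((z, c), (\<chi>, \<eta> c), (x, fobj L c))"])
      (auto simp: zc \<chi>)
qed

text \<open>The vertical reflections of the middle objects of the factorizations of \<open>(x, i x) \<rightarrow> (x, a)\<close>.
  Functoriality comes from that of the factorization: the induced map of middle objects commutes
  with the projections \<open>\<beta>\<close> to the fibre over \<open>x\<close>, so it is compatible with the bases and descends to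
  the reflections.\<close>

lemma fibre_replacement:
  assumes x [simp]: "x \<in> Obj B" and proper: "proper_on T (global \<Phi>) G" and Gx: "G (x, i x)"
    and G_cof: "\<And>k. k \<in> cofs T (global \<Phi>) \<Longrightarrow> G (Dom T k) \<Longrightarrow> G (Cod T k)"
  obtains Q q where "is_functor (F x) (F x) Q" "nat_trans (F x) (F x) Q id_functor q"
    "\<And>a. a \<in> Obj (F x) \<Longrightarrow> q a \<in> weqs (vert \<Phi> x)"
    "\<And>a. a \<in> Obj (F x) \<Longrightarrow> over (Id B x) (fobj Q a) \<in> cofs T (global \<Phi>)"
proof -
  interpret X: cat "F x" by (rule cat_F) simp
  obtain E \<alpha> \<beta> m where
    "factorization T (Arr T) (cofs T (global \<Phi>)) (tfibs (global \<Phi>)) E \<alpha> \<beta> m"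
    using factorization_exists[OF category_T M.cof_tfib_factorization] by blast
  then interpret fac: factorization T "Arr T" "cofs T (global \<Phi>)" "tfibs (global \<Phi>)" E \<alpha> \<beta> m .
  let ?v = "over (Id B x)" and ?I = "Id T (x, i x)"
  have I: "?I \<in> hom T (x, i x) (x, i x)" "Comp T ?I ?I = ?I" by simp_all
  have v [simp]: "?v a \<in> Arr T" "Dom T (?v a) = (x, i x)" "Cod T (?v a) = (x, a)" if "a \<in> Obj (F x)" for a
    using that by simp_all
  have \<alpha>: "\<alpha> (?v a) \<in> hom T (x, i x) (E (?v a))" "\<alpha> (?v a) \<in> cofs T (global \<Phi>)"
    and \<beta>: "\<beta> (?v a) \<in> hom T (E (?v a)) (x, a)" "\<beta> (?v a) \<in> tfibs (global \<Phi>)"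
    and \<beta>\<alpha>: "Comp T (\<beta> (?v a)) (\<alpha> (?v a)) = ?v a" if "a \<in> Obj (F x)" for a
    using fac.fac[OF v(1)[OF that]] that by simp_all
  have \<beta>w: "base_of (\<beta> (?v a)) \<in> weqs (horiz \<Phi>)" if "a \<in> Obj (F x)" for a
  proof -
    obtain d \<phi> f c where "\<beta> (?v a) = (d, (\<phi>, f), c)" by (metis prod.exhaust)
    then show ?thesis using \<beta>(2)[OF that] by (cases d) (simp add: tfibs_def)
  qed
  define reflection where "reflection a n u \<longleftrightarrow> n \<in> Obj (F x) \<and> u \<in> hom T (E (?v a)) (x, n) \<and>
    u \<in> weqs (global \<Phi>) \<and> base_of u = base_of (\<beta> (?v a)) \<and> ?v n \<in> cofs T (global \<Phi>) \<and>
    (\<forall>d\<in>Obj (F x). \<forall>h\<in>hom T (E (?v a)) (x, d). base_of h = base_of (\<beta> (?v a)) \<longrightarrow>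
       (\<exists>!g. g \<in> hom (F x) n d \<and> Comp T (vertical x g) u = h))" for a n u
  have "\<exists>n u. reflection a n u" if a: "a \<in> Obj (F x)" for a
    unfolding reflection_def
    using vertical_reflection[OF x a \<alpha>(2)[OF a] \<alpha>(1)[OF a] \<beta>(1)[OF a] \<beta>w[OF a] \<beta>\<alpha>[OF a] proper Gx G_cof] .
  then obtain n u where nu: "reflection a (n a) (u a)" if "a \<in> Obj (F x)" for a
    by metis
  have n [simp]: "n a \<in> Obj (F x)" and u: "u a \<in> hom T (E (?v a)) (x, n a)"
    and u_weq: "u a \<in> weqs (global \<Phi>)" and u_base: "base_of (u a) = base_of (\<beta> (?v a))"
    and n_cof: "?v (n a) \<in> cofs T (global \<Phi>)" if "a \<in> Obj (F x)" for a
    using nu[OF that] unfolding reflection_def by blast+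
  have universal: "\<exists>!g. g \<in> hom (F x) (n a) d \<and> Comp T (vertical x g) (u a) = h"
    if "a \<in> Obj (F x)" "d \<in> Obj (F x)" "h \<in> hom T (E (?v a)) (x, d)" "base_of h = base_of (\<beta> (?v a))"
    for a d h
    using nu[OF that(1)] that unfolding reflection_def by blast
  have us [simp]: "u a \<in> Arr T" "Dom T (u a) = E (?v a)" "Cod T (u a) = (x, n a)" if "a \<in> Obj (F x)" for a
    using u[OF that] by simp_all
  have \<beta>s [simp]: "\<beta> (?v a) \<in> Arr T" "Dom T (\<beta> (?v a)) = E (?v a)" "Cod T (\<beta> (?v a)) = (x, a)"
    if "a \<in> Obj (F x)" for a
    using \<beta>(1)[OF that] by simp_all
  \<comment> \<open>arrows out of a reflection are determined by their composites with \<open>u\<close>\<close>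
  have uniq: "g = k" if "a \<in> Obj (F x)" "g \<in> Arr (F x)" "k \<in> Arr (F x)" "Dom (F x) g = n a"
    "Dom (F x) k = n a" "Cod (F x) g = Cod (F x) k"
    "Comp T (vertical x g) (u a) = Comp T (vertical x k) (u a)" for a g k
  proof -
    have h: "Comp T (vertical x g) (u a) \<in> hom T (E (?v a)) (x, Cod (F x) g)"
      using that(1,2,4) by simp
    have "base_of (Comp T (vertical x g) (u a)) = Comp B (Id B x) (base_of (u a))"
      using that(1,2,4) by (subst base_of_comp) simp_all
    also have "\<dots> = base_of (\<beta> (?v a))"
      using id_comp_base_of[OF u[OF that(1)]] u_base[OF that(1)] by simp
    finally have b: "base_of (Comp T (vertical x g) (u a)) = base_of (\<beta> (?v a))" .
    from universal[OF that(1) _ h b] show ?thesis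
      by (rule ex1E) (use that in auto)
  qed
  \<comment> \<open>the map of middle objects induced by \<open>f\<close>\<close>
  define \<mu> where "\<mu> f = m (?v (Dom (F x) f)) (?v (Cod (F x) f)) ?I (vertical x f)" for f
  have sq: "Comp T (?v (Cod (F x) f)) ?I = Comp T (vertical x f) (?v (Dom (F x) f))" if "f \<in> Arr (F x)" for f
  proof -
    have "vertical x f \<in> Arr T" using that by simp
    from comp_over[OF this[unfolded vertical_def], of "Id B x"]
    show ?thesis using that T.id_right[of "?v (Cod (F x) f)" "(x, i x)"] by (simp add: vertical_def del: total_simps(3,4))
  qed
  have \<mu>: "\<mu> f \<in> hom T (E (?v (Dom (F x) f))) (E (?v (Cod (F x) f)))"
    and \<beta>\<mu>: "Comp T (\<beta> (?v (Cod (F x) f))) (\<mu> f) = Comp T (vertical x f) (\<beta> (?v (Dom (F x) f)))"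
    if "f \<in> Arr (F x)" for f
  proof -
    have "\<mu> f \<in> hom T (E (?v (Dom (F x) f))) (E (?v (Cod (F x) f))) \<and>
      Comp T (\<mu> f) (\<alpha> (?v (Dom (F x) f))) = Comp T (\<alpha> (?v (Cod (F x) f))) ?I \<and>
      Comp T (\<beta> (?v (Cod (F x) f))) (\<mu> f) = Comp T (vertical x f) (\<beta> (?v (Dom (F x) f)))"
      unfolding \<mu>_def
      by (rule fac.fac_map[OF _ _ _ _ sq[OF that]]) (use that in simp_all)
    then show "\<mu> f \<in> hom T (E (?v (Dom (F x) f))) (E (?v (Cod (F x) f)))"
      "Comp T (\<beta> (?v (Cod (F x) f))) (\<mu> f) = Comp T (vertical x f) (\<beta> (?v (Dom (F x) f)))" by blast+
  qed
  have \<mu>s [simp]: "\<mu> f \<in> Arr T" "Dom T (\<mu> f) = E (?v (Dom (F x) f))" "Cod T (\<mu> f) = E (?v (Cod (F x) f))"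
    if "f \<in> Arr (F x)" for f
    using \<mu>[OF that] by simp_all
  have \<mu>_id: "\<mu> (Id (F x) a) = Id T (E (?v a))" if "a \<in> Obj (F x)" for a
    using fac.fac_id[OF v(1)[OF that]] that by (simp add: \<mu>_def vertical_id del: total_simps(3))
  have \<mu>_comp: "\<mu> (Comp (F x) g f) = Comp T (\<mu> g) (\<mu> f)"
    if fg: "f \<in> Arr (F x)" "g \<in> Arr (F x)" "Cod (F x) f = Dom (F x) g" for f g
  proof -
    have "m (?v (Dom (F x) f)) (?v (Cod (F x) g)) (Comp T ?I ?I) (Comp T (vertical x g) (vertical x f)) =
      Comp T (m (?v (Dom (F x) g)) (?v (Cod (F x) g)) ?I (vertical x g))
        (m (?v (Dom (F x) f)) (?v (Dom (F x) g)) ?I (vertical x f))"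
      by (rule fac.fac_comp[OF _ _ _ _ _ _ _ conjI[OF sq[OF fg(1), unfolded fg(3)] sq[OF fg(2)]]])
        (use fg in simp_all)
    then show ?thesis using fg I(2) by (simp add: \<mu>_def vertical_comp del: total_simps(3,4))
  qed
  have ex: "\<exists>!g. g \<in> hom (F x) (n (Dom (F x) f)) (n (Cod (F x) f)) \<and>
      Comp T (vertical x g) (u (Dom (F x) f)) = Comp T (u (Cod (F x) f)) (\<mu> f)" if f: "f \<in> Arr (F x)" for f
  proof (rule universal)
    have "base_of (Comp T (u (Cod (F x) f)) (\<mu> f)) = base_of (Comp T (\<beta> (?v (Cod (F x) f))) (\<mu> f))"
      using f by (simp add: base_of_comp u_base)
    also have "\<dots> = Comp B (Id B x) (base_of (\<beta> (?v (Dom (F x) f))))"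
      unfolding \<beta>\<mu>[OF f] using f by (simp add: base_of_comp)
    also have "\<dots> = base_of (\<beta> (?v (Dom (F x) f)))"
      using id_comp_base_of[OF \<beta>(1)] f by simp
    finally show "base_of (Comp T (u (Cod (F x) f)) (\<mu> f)) = base_of (\<beta> (?v (Dom (F x) f)))" .
  qed (use f in simp_all)
  define Qa where "Qa f = (THE g. g \<in> hom (F x) (n (Dom (F x) f)) (n (Cod (F x) f)) \<and>
      Comp T (vertical x g) (u (Dom (F x) f)) = Comp T (u (Cod (F x) f)) (\<mu> f))" for f
  have Qa: "Qa f \<in> hom (F x) (n (Dom (F x) f)) (n (Cod (F x) f)) \<and>
      Comp T (vertical x (Qa f)) (u (Dom (F x) f)) = Comp T (u (Cod (F x) f)) (\<mu> f)" if "f \<in> Arr (F x)" for f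
    unfolding Qa_def by (rule theI'[OF ex[OF that]])
  then have Qs [simp]: "Qa f \<in> Arr (F x)" "Dom (F x) (Qa f) = n (Dom (F x) f)"
    "Cod (F x) (Qa f) = n (Cod (F x) f)" if "f \<in> Arr (F x)" for f
    using that by simp_all
  define Q where "Q = \<lparr>fobj = n, farr = Qa\<rparr>"
  have Q: "is_functor (F x) (F x) Q"
    unfolding is_functor_def
  proof (intro conjI ballI impI)
    fix a assume a: "a \<in> Obj (F x)"
    have "Comp T (vertical x (Qa (Id (F x) a))) (u a) = Comp T (vertical x (Id (F x) (n a))) (u a)"
      using Qa[of "Id (F x) a"] a T.id_right[of "u a"] T.id_left[of "u a" "(x, n a)"]
      by (simp add: \<mu>_id vertical_id del: total_simps(3,4))
    then show "farr Q (Id (F x) a) = Id (F x) (fobj Q a)"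
      using a by (simp add: Q_def) (rule uniq[of a], simp_all)
  next
    fix f g assume fg: "f \<in> Arr (F x)" "g \<in> Arr (F x)" "Cod (F x) f = Dom (F x) g"
    have "Comp T (vertical x (Qa (Comp (F x) g f))) (u (Dom (F x) f)) =
        Comp T (Comp T (u (Cod (F x) g)) (\<mu> g)) (\<mu> f)"
      using Qa[of "Comp (F x) g f"] fg by (simp add: \<mu>_comp T.assoc del: total_simps)
    also have "\<dots> = Comp T (vertical x (Qa g)) (Comp T (u (Dom (F x) g)) (\<mu> f))"
      using conjunct2[OF Qa[OF fg(2)], symmetric] fg by (simp add: T.assoc del: total_simps)
    also have "\<dots> = Comp T (vertical x (Comp (F x) (Qa g) (Qa f))) (u (Dom (F x) f))"
      using conjunct2[OF Qa[OF fg(1)], symmetric] fg by (simp add: T.assoc vertical_comp del: total_simps)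
    finally show "farr Q (Comp (F x) g f) = Comp (F x) (farr Q g) (farr Q f)"
      using fg by (simp add: Q_def) (rule uniq[of "Dom (F x) f"], simp_all)
  qed (simp_all add: Q_def)
  have "\<forall>a\<in>Obj (F x). \<exists>g. g \<in> hom (F x) (n a) a \<and> Comp T (vertical x g) (u a) = \<beta> (?v a)"
    using universal \<beta>(1) by blast
  then obtain q where q: "\<And>a. a \<in> Obj (F x) \<Longrightarrow> q a \<in> hom (F x) (n a) a"
    "\<And>a. a \<in> Obj (F x) \<Longrightarrow> Comp T (vertical x (q a)) (u a) = \<beta> (?v a)"
    by metis
  have qs [simp]: "q a \<in> Arr (F x)" "Dom (F x) (q a) = n a" "Cod (F x) (q a) = a" if "a \<in> Obj (F x)" for a
    using q(1)[OF that] by simp_all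
  have "Comp (F x) (q (Cod (F x) f)) (Qa f) = Comp (F x) f (q (Dom (F x) f))" if f: "f \<in> Arr (F x)" for f
  proof -
    have "Comp T (vertical x (Comp (F x) (q (Cod (F x) f)) (Qa f))) (u (Dom (F x) f)) =
        Comp T (vertical x (q (Cod (F x) f))) (Comp T (u (Cod (F x) f)) (\<mu> f))"
      using conjunct2[OF Qa[OF f], symmetric] f by (simp add: T.assoc vertical_comp del: total_simps)
    also have "\<dots> = Comp T (vertical x f) (\<beta> (?v (Dom (F x) f)))"
      using T.comp_reduce[OF q(2)[of "Cod (F x) f"], of "\<mu> f"] \<beta>\<mu>[OF f] f by simp
    also have "\<dots> = Comp T (vertical x (Comp (F x) f (q (Dom (F x) f)))) (u (Dom (F x) f))"
      using q(2)[of "Dom (F x) f", symmetric] f by (simp add: T.assoc vertical_comp del: total_simps)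
    finally show ?thesis using f by (intro uniq[of "Dom (F x) f"]) simp_all
  qed
  then have "nat_trans (F x) (F x) Q id_functor q"
    by (simp add: nat_trans_def Q_def)
  moreover have "q a \<in> weqs (vert \<Phi> x)" if a: "a \<in> Obj (F x)" for a
  proof -
    have "\<beta> (?v a) \<in> weqs (global \<Phi>)" using \<beta>(2)[OF a] by (simp add: tfibs_def)
    then have "vertical x (q a) \<in> weqs (global \<Phi>)"
      using M.weq_right[OF u_weq[OF a], of "vertical x (q a)"] q(2)[OF a] a by simp
    then show ?thesis using a by (simp add: vertical_classes)
  qed
  ultimately show ?thesis using that[of Q q] Q n_cof by (simp add: Q_def)
qed

section \<open>The Quillen equivalence\<close>

text \<open>The Brown factorization of \<open>(x, i x) \<rightarrow> (y, i y)\<close> goes through some \<open>(z, c)\<close> with cofibrations from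
  both ends, whose bases are horizontal weak equivalences by two out of three. By
  \<open>horizontal_part_weq\<close> both \<open>(x, i x)\<close> and \<open>(y, i y)\<close> are weakly equivalent to \<open>(z, i z)\<close>, compatibly with
  the arrow from \<open>(z, i z)\<close> to \<open>(y, i y)\<close>.\<close>

lemma initial_comparison_weq:
  assumes G: "G = cofibrant T (global \<Phi>)" and \<phi>: "\<phi> \<in> hom B x y" "\<phi> \<in> weqs (horiz \<Phi>)"
    and cof: "G (x, i x)" "G (y, i y)"
  shows "over \<phi> (i y) \<in> weqs (global \<Phi>)"
proof -
  interpret K: cofibrant_semi_model T "global \<Phi>"
    by standard (use M.ax pushouts G in auto)
  have [simp]: "\<phi> \<in> Arr B" "Dom B \<phi> = x" "Cod B \<phi> = y" using \<phi> by simp_all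
  have [simp]: "x \<in> Obj B" "y \<in> Obj B" using B.dom_obj[of \<phi>] B.cod_obj[of \<phi>] by simp_all
  obtain e a b t where f: "a \<in> hom T (Dom T (over \<phi> (i y))) e" "b \<in> hom T (Cod T (over \<phi> (i y))) e"
    "t \<in> hom T e (Cod T (over \<phi> (i y)))" "a \<in> cofs T (global \<Phi>)" "b \<in> cofs T (global \<Phi>)" "t \<in> tfibs (global \<Phi>)"
    "Comp T t a = over \<phi> (i y)" "Comp T t b = Id T (Cod T (over \<phi> (i y)))"
    by (rule K.brown_factorization[of "over \<phi> (i y)"]) (use cof G in simp_all)
  obtain z c where e: "e = (z, c)" by (cases e)
  have "a \<in> hom T (x, i x) (z, c)" using f(1) e by simp
  then obtain \<alpha> a' where a: "a = ((x, i x), (\<alpha>, a'), (z, c))" and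
    [simp]: "\<alpha> \<in> Arr B" "Dom B \<alpha> = x" "Cod B \<alpha> = z" "z \<in> Obj B" by (rule total_homE)
  have "b \<in> hom T (y, i y) (z, c)" using f(2) e by simp
  then obtain \<beta> b' where b: "b = ((y, i y), (\<beta>, b'), (z, c))" and
    [simp]: "\<beta> \<in> Arr B" "Dom B \<beta> = y" "Cod B \<beta> = z" by (rule total_homE)
  have "t \<in> hom T (z, c) (y, i y)" using f(3) e by simp
  then obtain \<tau> t' where t: "t = ((z, c), (\<tau>, t'), (y, i y))" and
    [simp]: "\<tau> \<in> Arr B" "Dom B \<tau> = z" "Cod B \<tau> = y" by (rule total_homE)
  have \<tau>: "\<tau> \<in> weqs (horiz \<Phi>)" using f(6) by (simp add: t tfibs_def)
  have \<tau>\<alpha>: "Comp B \<tau> \<alpha> = \<phi>" and \<tau>\<beta>: "Comp B \<tau> \<beta> = Id B y"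
    using f(7,8) by (simp_all add: t a b over_def)
  have "\<alpha> \<in> weqs (horiz \<Phi>)" using horiz_weq_left[of \<alpha> \<tau>] \<tau> \<tau>\<alpha> \<phi> by simp
  then have \<alpha>w: "over \<alpha> (i z) \<in> weqs (global \<Phi>)"
    using horizontal_part_weq[OF f(4)[unfolded a]] cof by simp
  have "\<beta> \<in> weqs (horiz \<Phi>)" using horiz_weq_left[of \<beta> \<tau>] \<tau> \<tau>\<beta> by simp
  then have \<beta>w: "over \<beta> (i z) \<in> weqs (global \<Phi>)"
    using horizontal_part_weq[OF f(5)[unfolded b]] cof by simp
  have "Comp T (over \<tau> (i y)) (over \<beta> (i z)) = Id T (y, i y)"
    using over_comp_over[of \<beta> \<tau> "i y"] \<tau>\<beta> over_id[of y] by simp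
  moreover have "iso_arrow T (Id T (y, i y))" by (rule T.iso_id) simp
  ultimately have "over \<tau> (i y) \<in> weqs (global \<Phi>)"
    using M.weq_right[OF \<beta>w, of "over \<tau> (i y)"] M.iso_weq by simp
  then have "Comp T (over \<tau> (i y)) (over \<alpha> (i z)) \<in> weqs (global \<Phi>)"
    using M.weq_comp[OF \<alpha>w, of "over \<tau> (i y)"] by simp
  then show ?thesis using over_comp_over[of \<alpha> \<tau> "i y"] \<tau>\<alpha> by simp
qed

lemma over_weqI:
  assumes "\<phi> \<in> hom B x y" "\<phi> \<in> weqs (horiz \<Phi>)"
    and "\<forall>\<tau>\<in>hom (F x) (i x) (fobj (pull \<Phi> \<phi>) (i y)). \<tau> \<in> weqs (vert \<Phi> x)"
  shows "over \<phi> (i y) \<in> weqs (global \<Phi>)"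
proof -
  have [simp]: "\<phi> \<in> Arr B" "Dom B \<phi> = x" "Cod B \<phi> = y" using assms by simp_all
  have [simp]: "x \<in> Obj B" "y \<in> Obj B" using B.dom_obj[of \<phi>] B.cod_obj[of \<phi>] by simp_all
  show ?thesis using assms by (simp add: over_def)
qed

lemma quillen_equivalence_over:
  assumes \<phi>: "\<phi> \<in> hom B x y" "\<phi> \<in> weqs (horiz \<Phi>)" and adj: "adjunction (F x) (F y) L (pull \<Phi> \<phi>) \<eta>"
    and w: "over \<phi> (i y) \<in> weqs (global \<Phi>)"
    and proper: "proper_on T (global \<Phi>) G" and Gxy: "G (x, i x)" "G (y, i y)"
    and G_cof: "\<And>k. k \<in> cofs T (global \<Phi>) \<Longrightarrow> G (Dom T k) \<Longrightarrow> G (Cod T k)"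
  shows "quillen_equivalence (F x) (vert \<Phi> x) (F y) (vert \<Phi> y) L (pull \<Phi> \<phi>) \<eta>"
proof -
  have x: "x \<in> Obj B" using B.dom_obj[of \<phi>] \<phi>(1) by auto
  obtain Q q where Q: "is_functor (F x) (F x) Q" "nat_trans (F x) (F x) Q id_functor q"
    "\<And>a. a \<in> Obj (F x) \<Longrightarrow> q a \<in> weqs (vert \<Phi> x)"
    "\<And>a. a \<in> Obj (F x) \<Longrightarrow> over (Id B x) (fobj Q a) \<in> cofs T (global \<Phi>)"
    using fibre_replacement[OF x proper Gxy(1) G_cof] by blast
  show ?thesis
  proof (rule quillen_equivalence_criterion[OF \<phi> adj Q(1-3)])
    fix a assume a: "a \<in> Obj (F x)"
    then have "fobj Q a \<in> Obj (F x)" using functor_simps(1)[OF Q(1)] by simp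
    from unit_weq[OF \<phi>(1) adj this w Q(4)[OF a] proper Gxy] show "\<eta> (fobj Q a) \<in> weqs (vert \<Phi> x)"
      by simp
  qed simp
qed

text \<open>With factorizations inside the fibre, the middle object of \<open>i x \<rightarrow> a\<close> is a replacement of \<open>a\<close>, and
  properness is used only for the single weak equivalence \<open>(x, i x) \<rightarrow> (y, i y)\<close>.\<close>

lemma quillen_equivalence_vertical:
  assumes \<phi>: "\<phi> \<in> hom B x y" "\<phi> \<in> weqs (horiz \<Phi>)" and adj: "adjunction (F x) (F y) L (pull \<Phi> \<phi>) \<eta>"
    and w: "over \<phi> (i y) \<in> weqs (global \<Phi>)"
    and proper: "proper_on T (global \<Phi>) H" and Hxy: "H (x, i x)" "H (y, i y)"
    and fac: "functorial_factorization (F x) (Arr (F x)) (cofs (F x) (vert \<Phi> x)) (tfibs (vert \<Phi> x))"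
  shows "quillen_equivalence (F x) (vert \<Phi> x) (F y) (vert \<Phi> y) L (pull \<Phi> \<phi>) \<eta>"
proof -
  have x [simp]: "x \<in> Obj B" using B.dom_obj[of \<phi>] \<phi>(1) by auto
  interpret X: cat "F x" by (rule cat_F) simp
  obtain E \<alpha> \<beta> m where
    "factorization (F x) (Arr (F x)) (cofs (F x) (vert \<Phi> x)) (tfibs (vert \<Phi> x)) E \<alpha> \<beta> m"
    using factorization_exists[OF category_F[OF x] fac] by blast
  then interpret fac: factorization "F x" "Arr (F x)" "cofs (F x) (vert \<Phi> x)" "tfibs (vert \<Phi> x)" E \<alpha> \<beta> m .
  let ?v = "ini x" and ?I = "Id (F x) (i x)"
  have \<alpha>: "\<alpha> (?v a) \<in> hom (F x) (i x) (E (?v a))" "\<alpha> (?v a) \<in> cofs (F x) (vert \<Phi> x)"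
    and \<beta>: "\<beta> (?v a) \<in> hom (F x) (E (?v a)) a" "\<beta> (?v a) \<in> tfibs (vert \<Phi> x)" if "a \<in> Obj (F x)" for a
    using fac.fac[of "?v a"] that by simp_all
  have E [simp]: "E (?v a) \<in> Obj (F x)" if "a \<in> Obj (F x)" for a
    using \<beta>(1)[OF that] X.dom_obj[of "\<beta> (?v a)"] by simp
  have sq: "Comp (F x) (?v (Cod (F x) f)) ?I = Comp (F x) f (?v (Dom (F x) f))" if "f \<in> Arr (F x)" for f
    by (rule initial_unique[OF initial[OF x]]) (use that in simp_all)
  define Q where "Q = \<lparr>fobj = (\<lambda>a. E (?v a)),
    farr = (\<lambda>f. m (?v (Dom (F x) f)) (?v (Cod (F x) f)) ?I f)\<rparr>"
  have mf: "farr Q f \<in> hom (F x) (fobj Q (Dom (F x) f)) (fobj Q (Cod (F x) f))"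
    and \<beta>f: "Comp (F x) (\<beta> (?v (Cod (F x) f))) (farr Q f) = Comp (F x) f (\<beta> (?v (Dom (F x) f)))"
    if f: "f \<in> Arr (F x)" for f
    using fac.fac_map[OF _ _ _ _ sq[OF f]] f by (simp_all add: Q_def)
  have "is_functor (F x) (F x) Q"
    unfolding is_functor_def
  proof (intro conjI ballI impI)
    fix a assume "a \<in> Obj (F x)"
    then show "farr Q (Id (F x) a) = Id (F x) (fobj Q a)"
      using fac.fac_id[of "?v a"] by (simp add: Q_def)
  next
    fix f g assume fg: "f \<in> Arr (F x)" "g \<in> Arr (F x)" "Cod (F x) f = Dom (F x) g"
    show "farr Q (Comp (F x) g f) = Comp (F x) (farr Q g) (farr Q f)"
      using fac.fac_comp[OF _ _ _ _ _ _ _ conjI[OF sq[OF fg(1), unfolded fg(3)] sq[OF fg(2)]]] fg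
      by (simp add: Q_def)
  qed (use mf in \<open>simp_all add: Q_def\<close>)
  moreover have "nat_trans (F x) (F x) Q id_functor (\<lambda>a. \<beta> (?v a))"
    using \<beta>(1) \<beta>f by (simp add: nat_trans_def Q_def)
  moreover have "\<beta> (?v a) \<in> weqs (vert \<Phi> x)" if "a \<in> Obj (F x)" for a
    using \<beta>(2)[OF that] by (simp add: tfibs_def)
  moreover have "\<eta> (fobj Q a) \<in> weqs (vert \<Phi> x)" if a: "a \<in> Obj (F x)" for a
  proof -
    have "\<alpha> (?v a) = ini x (E (?v a))"
      by (rule ini_unique[OF x]) (use \<alpha>(1)[OF a] in simp_all)
    then have "vertical x (ini x (E (?v a))) \<in> cofs T (global \<Phi>)"
      using vertical_cof[OF x \<alpha>(2)[OF a]] by simp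
    then have "over (Id B x) (E (?v a)) \<in> cofs T (global \<Phi>)"
      using a by (simp add: vertical_def over_def)
    from unit_weq[OF \<phi>(1) adj _ w this proper Hxy] show ?thesis
      using a by (simp add: Q_def)
  qed
  ultimately show ?thesis by (rule quillen_equivalence_criterion[OF \<phi> adj])
qed

end

theorem theorem3p22:
  fixes \<Phi> :: "('o, 'm, 'a, 'f) hindexed"
    and \<Psi> :: "('p, 'n, 'b, 'g) hindexed"
    and U :: "('o, 'm, 'p, 'n) fnctr"
    and u :: "'o \<Rightarrow> ('a, 'f, 'b, 'g) fnctr"
    and i :: "'o \<Rightarrow> 'a"
  assumes "infinite (UNIV :: 'u set)"
    and "hindexed_category \<Phi>"
    and "hindexed_category \<Psi>"
    and "forgetful_morphism \<Phi> \<Psi> U u"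
    and "cocomplete TYPE('u) (total_cat \<Phi>)"
    and "\<And>x. x \<in> Obj (base \<Phi>) \<Longrightarrow> initial_object (fiber \<Phi> x) (i x)"
  shows
    "(model_structure (total_cat \<Phi>) (global \<Phi>) \<and> left_proper (total_cat \<Phi>) (global \<Phi>) \<longrightarrow>
       (\<forall>x y. \<forall>\<phi>\<in>hom (base \<Phi>) x y.
          (\<exists>L \<eta>. quillen_pair (fiber \<Phi> x) (vert \<Phi> x) (fiber \<Phi> y) (vert \<Phi> y) L (pull \<Phi> \<phi>) \<eta>) \<and>
          (\<forall>L \<eta>. adjunction (fiber \<Phi> x) (fiber \<Phi> y) L (pull \<Phi> \<phi>) \<eta> \<and>
             \<phi> \<in> weqs (horiz \<Phi>) \<and>
             (\<forall>\<tau>\<in>hom (fiber \<Phi> x) (i x) (fobj (pull \<Phi> \<phi>) (i y)). \<tau> \<in> weqs (vert \<Phi> x)) \<longrightarrow>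
             (\<forall>a. cofibrant (fiber \<Phi> x) (vert \<Phi> x) a \<longrightarrow> \<eta> a \<in> weqs (vert \<Phi> x)) \<and>
             (reflects_weqs (fiber \<Phi> y) (vert \<Phi> y) (vert \<Phi> x) (pull \<Phi> \<phi>) \<longrightarrow>
                quillen_equivalence (fiber \<Phi> x) (vert \<Phi> x) (fiber \<Phi> y) (vert \<Phi> y)
                  L (pull \<Phi> \<phi>) \<eta>))))
     \<and>
     ((model_structure (total_cat \<Phi>) (global \<Phi>) \<or>
         semi_model_structure_over TYPE('u) (total_cat \<Phi>) (global \<Phi>) (total_cat \<Psi>) (global \<Psi>)
           (total_functor U u)) \<and>
       transferred \<Phi> \<Psi> U u \<and>
       cofibrantly_generated TYPE('u) (total_cat \<Phi>) (global \<Phi>) \<and>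
       relatively_left_proper (total_cat \<Phi>) (global \<Phi>) (total_cat \<Psi>) (global \<Psi>) (total_functor U u) \<longrightarrow>
       (\<forall>x\<in>Obj (base \<Phi>). \<forall>y\<in>Obj (base \<Phi>).
          (\<forall>z\<in>{x, y}. model_structure (fiber \<Phi> z) (vert \<Phi> z) \<or>
             semi_model_structure_over TYPE('u) (fiber \<Phi> z) (vert \<Phi> z)
               (fiber \<Psi> (fobj U z)) (vert \<Psi> (fobj U z)) (u z)) \<and>
          relatively_cofibrant \<Psi> U x \<and> relatively_cofibrant \<Psi> U y \<longrightarrow>
          (\<forall>\<phi>\<in>hom (base \<Phi>) x y.
             (\<exists>L \<eta>. quillen_pair (fiber \<Phi> x) (vert \<Phi> x) (fiber \<Phi> y) (vert \<Phi> y) L (pull \<Phi> \<phi>) \<eta>) \<and>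
             (\<forall>L \<eta>. adjunction (fiber \<Phi> x) (fiber \<Phi> y) L (pull \<Phi> \<phi>) \<eta> \<and>
                \<phi> \<in> weqs (horiz \<Phi>) \<and>
                reflects_weqs (fiber \<Phi> y) (vert \<Phi> y) (vert \<Phi> x) (pull \<Phi> \<phi>) \<and>
                (\<forall>\<tau>\<in>hom (fiber \<Phi> x) (i x) (fobj (pull \<Phi> \<phi>) (i y)). \<tau> \<in> weqs (vert \<Phi> x)) \<and>
                cofibrant (total_cat \<Psi>) (global \<Psi>) (fobj (total_functor U u) (x, i x)) \<and>
                cofibrant (total_cat \<Psi>) (global \<Psi>) (fobj (total_functor U u) (y, i y)) \<longrightarrow>
                quillen_equivalence (fiber \<Phi> x) (vert \<Phi> x) (fiber \<Phi> y) (vert \<Phi> y)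
                  L (pull \<Phi> \<phi>) \<eta>))))
     \<and>
     (semi_model_structure (total_cat \<Phi>) (global \<Phi>) \<and>
       cofibrantly_generated TYPE('u) (total_cat \<Phi>) (global \<Phi>) \<longrightarrow>
       (\<forall>x\<in>Obj (base \<Phi>). \<forall>y\<in>Obj (base \<Phi>).
          cofibrant (total_cat \<Phi>) (global \<Phi>) (x, i x) \<and> cofibrant (total_cat \<Phi>) (global \<Phi>) (y, i y) \<longrightarrow>
          (\<forall>\<phi>\<in>hom (base \<Phi>) x y.
             (\<exists>L \<eta>. quillen_pair (fiber \<Phi> x) (vert \<Phi> x) (fiber \<Phi> y) (vert \<Phi> y) L (pull \<Phi> \<phi>) \<eta>) \<and>
             (\<forall>L \<eta>. adjunction (fiber \<Phi> x) (fiber \<Phi> y) L (pull \<Phi> \<phi>) \<eta> \<and>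
                \<phi> \<in> weqs (horiz \<Phi>) \<and>
                reflects_weqs (fiber \<Phi> y) (vert \<Phi> y) (vert \<Phi> x) (pull \<Phi> \<phi>) \<longrightarrow>
                quillen_equivalence (fiber \<Phi> x) (vert \<Phi> x) (fiber \<Phi> y) (vert \<Phi> y)
                  L (pull \<Phi> \<phi>) \<eta>))))"
proof (intro conjI impI)
  let "(?A1 \<longrightarrow> ?C1) \<and> (?A2 \<longrightarrow> ?C2) \<and> (?A3 \<longrightarrow> ?C3)" = ?thesis
  let ?T = "total_cat \<Phi>"
  interpret I: indexed_initial \<Phi> i by standard (rule assms(2), rule assms(6))
  have po: "has_pushouts ?T"
    by (rule cocomplete_has_pushouts[OF assms(1) I.category_T assms(5)])
  have gsm: "global_semi_model \<Phi> i G" if "semi_model_axioms ?T (global \<Phi>) G" for G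
    using that po by unfold_locales
  {
    assume *: ?A1
    interpret global_semi_model \<Phi> i "\<lambda>_. True"
      by (rule gsm) (use * model_structure_semi_model I.category_T in blast)
    have proper: "proper_on ?T (global \<Phi>) (\<lambda>_. True)"
      using * by (simp only: left_proper_iff)
    show ?C1
    proof (intro allI ballI conjI impI; (elim conjE)?)
      fix x y \<phi> assume \<phi>: "\<phi> \<in> hom (base \<Phi>) x y"
      show "\<exists>L \<eta>. quillen_pair (fiber \<Phi> x) (vert \<Phi> x) (fiber \<Phi> y) (vert \<Phi> y) L (pull \<Phi> \<phi>) \<eta>"
        by (rule quillen_pair_exists[OF \<phi>])
      have x: "x \<in> Obj (base \<Phi>)" using I.B.dom_obj[of \<phi>] \<phi> by auto
      fix L \<eta> assume adj: "adjunction (fiber \<Phi> x) (fiber \<Phi> y) L (pull \<Phi> \<phi>) \<eta>" and w: "\<phi> \<in> weqs (horiz \<Phi>)"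
        and \<tau>: "\<forall>\<tau>\<in>hom (fiber \<Phi> x) (i x) (fobj (pull \<Phi> \<phi>) (i y)). \<tau> \<in> weqs (vert \<Phi> x)"
      note ow = over_weqI[OF \<phi> w \<tau>]
      show "quillen_equivalence (fiber \<Phi> x) (vert \<Phi> x) (fiber \<Phi> y) (vert \<Phi> y) L (pull \<Phi> \<phi>) \<eta>"
        by (rule quillen_equivalence_over[OF \<phi> w adj ow proper]) simp_all
      fix a assume a: "cofibrant (fiber \<Phi> x) (vert \<Phi> x) a"
      then obtain z j where "j \<in> hom (fiber \<Phi> x) z a" by (auto simp: cofibrant_def simp del: in_hom)
      then have a': "a \<in> Obj (fiber \<Phi> x)" using cat.cod_obj[OF I.cat_F[OF x], of j] by simp
      show "\<eta> a \<in> weqs (vert \<Phi> x)"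
        using unit_weq[OF \<phi> adj a' ow over_cof[OF x a' a] proper] by simp
    qed
  next
    assume *: ?A2
    obtain G where G: "semi_model_axioms ?T (global \<Phi>) G"
      using * model_structure_semi_model[OF I.category_T] unfolding semi_model_structure_over_def by blast
    interpret global_semi_model \<Phi> i G by (rule gsm[OF G])
    let ?H = "\<lambda>a. cofibrant (total_cat \<Psi>) (global \<Psi>) (fobj (total_functor U u) a)"
    have proper: "proper_on ?T (global \<Phi>) ?H"
      using * by (simp only: relatively_left_proper_iff)
    show ?C2
    proof (intro allI ballI conjI impI; (elim conjE)?)
      fix x y \<phi> assume \<phi>: "\<phi> \<in> hom (base \<Phi>) x y"
      show "\<exists>L \<eta>. quillen_pair (fiber \<Phi> x) (vert \<Phi> x) (fiber \<Phi> y) (vert \<Phi> y) L (pull \<Phi> \<phi>) \<eta>"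
        by (rule quillen_pair_exists[OF \<phi>])
      assume "\<forall>z\<in>{x, y}. model_structure (fiber \<Phi> z) (vert \<Phi> z) \<or>
        semi_model_structure_over TYPE('u) (fiber \<Phi> z) (vert \<Phi> z) (fiber \<Psi> (fobj U z)) (vert \<Psi> (fobj U z)) (u z)"
      then have fac: "functorial_factorization (fiber \<Phi> x) (Arr (fiber \<Phi> x)) (cofs (fiber \<Phi> x) (vert \<Phi> x)) (tfibs (vert \<Phi> x))"
        by (auto simp: model_structure_def semi_model_structure_over_def semi_model_axioms_def)
      fix L \<eta> assume adj: "adjunction (fiber \<Phi> x) (fiber \<Phi> y) L (pull \<Phi> \<phi>) \<eta>" and w: "\<phi> \<in> weqs (horiz \<Phi>)"
        and \<tau>: "\<forall>\<tau>\<in>hom (fiber \<Phi> x) (i x) (fobj (pull \<Phi> \<phi>) (i y)). \<tau> \<in> weqs (vert \<Phi> x)"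
        and H: "cofibrant (total_cat \<Psi>) (global \<Psi>) (fobj (total_functor U u) (x, i x))"
          "cofibrant (total_cat \<Psi>) (global \<Psi>) (fobj (total_functor U u) (y, i y))"
      show "quillen_equivalence (fiber \<Phi> x) (vert \<Phi> x) (fiber \<Phi> y) (vert \<Phi> y) L (pull \<Phi> \<phi>) \<eta>"
        by (rule quillen_equivalence_vertical[OF \<phi> w adj over_weqI[OF \<phi> w \<tau>] proper H fac])
    qed
  next
    assume *: ?A3
    then have ax: "semi_model_axioms ?T (global \<Phi>) (cofibrant ?T (global \<Phi>))"
      by (simp add: semi_model_structure_def)
    interpret global_semi_model \<Phi> i "cofibrant ?T (global \<Phi>)" by (rule gsm[OF ax])
    interpret K: cofibrant_semi_model ?T "global \<Phi>" by standard (use ax po in auto)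
    show ?C3
    proof (intro allI ballI conjI impI; (elim conjE)?)
      fix x y \<phi> assume \<phi>: "\<phi> \<in> hom (base \<Phi>) x y"
      show "\<exists>L \<eta>. quillen_pair (fiber \<Phi> x) (vert \<Phi> x) (fiber \<Phi> y) (vert \<Phi> y) L (pull \<Phi> \<phi>) \<eta>"
        by (rule quillen_pair_exists[OF \<phi>])
      assume cof: "cofibrant ?T (global \<Phi>) (x, i x)" "cofibrant ?T (global \<Phi>) (y, i y)"
      fix L \<eta> assume adj: "adjunction (fiber \<Phi> x) (fiber \<Phi> y) L (pull \<Phi> \<phi>) \<eta>" and w: "\<phi> \<in> weqs (horiz \<Phi>)"
      show "quillen_equivalence (fiber \<Phi> x) (vert \<Phi> x) (fiber \<Phi> y) (vert \<Phi> y) L (pull \<Phi> \<phi>) \<eta>"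
        by (rule quillen_equivalence_over[OF \<phi> w adj initial_comparison_weq[OF refl \<phi> w cof]
              K.proper_on_cofibrant cof]) (rule M.cofibrant_cof[OF _ _ refl])
    qed
  }
qed

end
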